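(* Let $T$ be an ergodic automorphism of a standard Borel probability space $(X,\mathcal{B},\mu)$ and let $d\ge 1$. Suppose that $f\in L^2(X,\mu)$ is a (strictly) positive function with $\int_X f\,d\mu=1$ and that there exists $c>0$ such that $f^{(k)}(x)\geq ck$ for a.e. $x\in X$ and for all $k\in\mathbb{N}$ large enough. Put $f_0=f-\int_X f\,d\mu$. Let $(q_n^i)_{n\geq 1}$, $0\le i\le d-1$, be rigidity sequences for $T$. Suppose moreover that for each $0\leq i\leq d-1$ the sequence $\big(f_0^{(q_n^i)}\big)_{n\geq 1}$ is bounded in $L^2(X,\mu)$ and that $$\big(f_0^{(q_n^0)},\dots,f_0^{(q_n^{d-1})}\big)_\ast(\mu)\to P\quad\text{weakly in }\mathcal{P}(\mathbb{R}^d).$$ Then, as $n\to\infty$, $$(\mu^f)_{T^f_{q^0_n},\ldots,T^f_{q^{d-1}_n}}\to\int_{\mathbb{R}^d}(\mu^f)_{T^f_{-t_0},\ldots,T^f_{-t_{d-1}}}\,dP(t_0,\dots,t_{d-1})$$ in the space $J_{d+1}(T^f)$ of $(d+1)$-self-joinings of the special flow $T^f$.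
   Context: Cocycle sums: $f^{(k)}(x)=f(x)+f(Tx)+\dots+f(T^{k-1}x)$ for $k>0$, $f^{(0)}=0$, and $f^{(k)}(x)=-(f(T^kx)+\dots+f(T^{-1}x))$ for $k<0$ (similarly for $f_0$). Special flow: $X^f=\{(x,s)\in X\times\mathbb{R}:0\le s<f(x)\}$ with the measure $\mu^f$, the restriction of $\mu\otimes\lambda_{\mathbb{R}}$ ($\lambda_{\mathbb R}$ = Lebesgue measure). The special flow $T^f=(T^f_t)_{t\in\mathbb{R}}$ on $(X^f,\mu^f)$ is $T^f_t(x,r)=(T^nx,\,r+t-f^{(n)}(x))$, where $n\in\mathbb{Z}$ is the unique integer with $f^{(n)}(x)\le r+t<f^{(n+1)}(x)$. A sequence of integers $q_n\to\infty$ is a rigidity sequence for $T$ if $T^{q_n}\to \mathrm{Id}$, i.e. $\mu(T^{q_n}A\triangle A)\to0$ for every $A\in\mathcal{B}$. For a measure-preserving flow $\mathcal{T}$ on a probability space $(Y,\mathcal{C},\nu)$, a $k$-self-joining is a $(T_t\times\dots\times T_t)_{t\in\mathbb{R}}$-invariant probability measure on $Y^k$ all of whose one-dimensional marginals equal $\nu$; $J_k(\mathcal{T})$ is the set of these, with the (compact metrizable) topology in which $\rho_n\to\rho$ iff $\rho_n(A_1\times\dots\times A_k)\to\rho(A_1\times\dots\times A_k)$ for all $A_i\in\mathcal{C}$. For $S_1,\dots,S_{k-1}$ in the centralizer, $\nu_{S_1,\ldots,S_{k-1}}(A_1\times\dots\times A_k)=\nu(S_1^{-1}A_1\cap\dots\cap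 S_{k-1}^{-1}A_{k-1}\cap A_k)$. Integrals of joinings are defined setwise. $\mathcal{P}(\mathbb{R}^d)$ is the set of Borel probability measures on $\mathbb{R}^d$. *)

theory Defs
  imports "HOL-Probability.Probability"
begin

definition standard_borel :: "'a measure \<Rightarrow> bool" where
  "standard_borel M \<longleftrightarrow>
     (\<exists>S. topspace S = space M \<and> completely_metrizable_space S \<and> second_countable S \<and>
          sets M = sigma_sets (space M) {U. openin S U})"

definition automorphism :: "'a measure \<Rightarrow> ('a \<Rightarrow> 'a) \<Rightarrow> bool" where
  "automorphism M T \<longleftrightarrow>
     bij_betw T (space M) (space M) \<and> T \<in> M \<rightarrow>\<^sub>M M \<and>
     the_inv_into (space M) T \<in> M \<rightarrow>\<^sub>M M \<and> distr M M T = M"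

definition ergodic :: "'a measure \<Rightarrow> ('a \<Rightarrow> 'a) \<Rightarrow> bool" where
  "ergodic M T \<longleftrightarrow>
     (\<forall>A\<in>sets M. T -` A \<inter> space M = A \<longrightarrow> measure M A = 0 \<or> measure M A = 1)"

definition int_iterate :: "'a measure \<Rightarrow> ('a \<Rightarrow> 'a) \<Rightarrow> int \<Rightarrow> 'a \<Rightarrow> 'a" where
  "int_iterate M T k =
     (if 0 \<le> k then T ^^ nat k else the_inv_into (space M) T ^^ nat (- k))"

definition cocycle_sum :: "'a measure \<Rightarrow> ('a \<Rightarrow> 'a) \<Rightarrow> ('a \<Rightarrow> real) \<Rightarrow> int \<Rightarrow> 'a \<Rightarrow> real" where
  "cocycle_sum M T f k x =
     (if 0 \<le> k then (\<Sum>j\<in>{0..<k}. f (int_iterate M T j x))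
      else - (\<Sum>j\<in>{k..-1}. f (int_iterate M T j x)))"

definition rigidity_sequence :: "'a measure \<Rightarrow> ('a \<Rightarrow> 'a) \<Rightarrow> (nat \<Rightarrow> int) \<Rightarrow> bool" where
  "rigidity_sequence M T q \<longleftrightarrow>
     filterlim q at_top sequentially \<and>
     (\<forall>A\<in>sets M.
        (\<lambda>n. measure M (sym_diff (int_iterate M T (q n) ` A) A))
          \<longlonglongrightarrow> 0)"

definition in_L2 :: "'a measure \<Rightarrow> ('a \<Rightarrow> real) \<Rightarrow> bool" where
  "in_L2 M g \<longleftrightarrow> g \<in> borel_measurable M \<and> integrable M (\<lambda>x. (g x)\<^sup>2)"

definition bounded_in_L2 :: "'a measure \<Rightarrow> (nat \<Rightarrow> 'a \<Rightarrow> real) \<Rightarrow> bool" where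
  "bounded_in_L2 M g \<longleftrightarrow>
     (\<forall>n. in_L2 M (g n)) \<and> (\<exists>C. \<forall>n. sqrt (\<integral>x. (g n x)\<^sup>2 \<partial>M) \<le> C)"

text \<open>Euclidean space of dimension \<open>d\<close> is represented by the extensional functions on
  \<open>{..<d}\<close>, with the product topology and the product (hence Borel) sigma-algebra.\<close>

definition borel_Rd :: "nat \<Rightarrow> (nat \<Rightarrow> real) measure" where
  "borel_Rd d = Pi\<^sub>M {..<d} (\<lambda>_. borel)"

definition prob_measures_Rd :: "nat \<Rightarrow> (nat \<Rightarrow> real) measure set" where
  "prob_measures_Rd d = {P. sets P = sets (borel_Rd d) \<and> prob_space P}"

definition weakly_converges_Rd ::
    "nat \<Rightarrow> (nat \<Rightarrow> (nat \<Rightarrow> real) measure) \<Rightarrow> (nat \<Rightarrow> real) measure \<Rightarrow> bool" where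
  "weakly_converges_Rd d Ps P \<longleftrightarrow>
     (\<forall>n. Ps n \<in> prob_measures_Rd d) \<and> P \<in> prob_measures_Rd d \<and>
     (\<forall>g. continuous_map (product_topology (\<lambda>_. euclideanreal) {..<d}) euclideanreal g \<and>
          bounded (g ` ({..<d} \<rightarrow>\<^sub>E UNIV)) \<longrightarrow>
          (\<lambda>n. \<integral>t. g t \<partial>Ps n) \<longlonglongrightarrow> (\<integral>t. g t \<partial>P))"

definition special_measure :: "'a measure \<Rightarrow> ('a \<Rightarrow> real) \<Rightarrow> ('a \<times> real) measure" where
  "special_measure M f =
     restrict_space (M \<Otimes>\<^sub>M lborel) {(x, s). x \<in> space M \<and> 0 \<le> s \<and> s < f x}"

text \<open>The integer \<open>n\<close> in the definition of the special flow exists for all levels only if the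
  cocycle sums over the orbit of \<open>x\<close> are unbounded in both time directions. For integrable
  \<open>f > 0\<close> and measure preserving \<open>T\<close> this fails at most on a \<open>T\<close>-invariant null set of points
  \<open>x\<close>; over that set the flow is taken to be the identity.\<close>

definition special_flow ::
    "'a measure \<Rightarrow> ('a \<Rightarrow> 'a) \<Rightarrow> ('a \<Rightarrow> real) \<Rightarrow> real \<Rightarrow> 'a \<times> real \<Rightarrow> 'a \<times> real" where
  "special_flow M T f t = (\<lambda>(x, r).
     if \<forall>s. \<exists>!n. cocycle_sum M T f n x \<le> s \<and> s < cocycle_sum M T f (n + 1) x
     then let n = (THE n. cocycle_sum M T f n x \<le> r + t \<and> r + t < cocycle_sum M T f (n + 1) x)
          in (int_iterate M T n x, r + t - cocycle_sum M T f n x)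
     else (x, r))"

text \<open>Coordinates of the \<open>k\<close>-fold power of a space are numbered from \<open>0\<close> to \<open>k - 1\<close>.\<close>

definition self_joinings :: "nat \<Rightarrow> 'b measure \<Rightarrow> (real \<Rightarrow> 'b \<Rightarrow> 'b) \<Rightarrow> (nat \<Rightarrow> 'b) measure set" where
  "self_joinings k N S =
     {\<rho>. sets \<rho> = sets (Pi\<^sub>M {..<k} (\<lambda>_. N)) \<and> prob_space \<rho> \<and>
         (\<forall>t. distr \<rho> (Pi\<^sub>M {..<k} (\<lambda>_. N)) (\<lambda>y. \<lambda>i\<in>{..<k}. S t (y i)) = \<rho>) \<and>
         (\<forall>i<k. distr \<rho> N (\<lambda>y. y i) = N)}"

definition converges_in_self_joinings ::
    "nat \<Rightarrow> 'b measure \<Rightarrow> (real \<Rightarrow> 'b \<Rightarrow> 'b) \<Rightarrow>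
     (nat \<Rightarrow> (nat \<Rightarrow> 'b) measure) \<Rightarrow> (nat \<Rightarrow> 'b) measure \<Rightarrow> bool" where
  "converges_in_self_joinings k N S \<rho>s \<rho> \<longleftrightarrow>
     (\<forall>n. \<rho>s n \<in> self_joinings k N S) \<and> \<rho> \<in> self_joinings k N S \<and>
     (\<forall>A. (\<forall>i<k. A i \<in> sets N) \<longrightarrow>
          (\<lambda>n. measure (\<rho>s n) (Pi\<^sub>E {..<k} A)) \<longlonglongrightarrow> measure \<rho> (Pi\<^sub>E {..<k} A))"

text \<open>The joining determined by maps \<open>S 0, \<dots>, S (k - 2)\<close>, as the image measure under
  \<open>y \<mapsto> (S 0 y, \<dots>, S (k - 2) y, y)\<close>; its values on boxes are given by the lemma below.\<close>

definition graph_joining ::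
    "nat \<Rightarrow> 'b measure \<Rightarrow> (nat \<Rightarrow> 'b \<Rightarrow> 'b) \<Rightarrow> (nat \<Rightarrow> 'b) measure" where
  "graph_joining k N S =
     distr N (Pi\<^sub>M {..<k} (\<lambda>_. N)) (\<lambda>y. \<lambda>i\<in>{..<k}. if i < k - 1 then S i y else y)"

lemma emeasure_graph_joining_box:
  assumes k: "1 \<le> k"
    and S: "\<And>i. i < k - 1 \<Longrightarrow> S i \<in> N \<rightarrow>\<^sub>M N"
    and A: "\<And>i. i < k \<Longrightarrow> A i \<in> sets N"
  shows "emeasure (graph_joining k N S) (Pi\<^sub>E {..<k} A) =
         emeasure N {y \<in> space N. (\<forall>i<k - 1. S i y \<in> A i) \<and> y \<in> A (k - 1)}"
proof -
  have m: "(\<lambda>y. \<lambda>i\<in>{..<k}. if i < k - 1 then S i y else y) \<in> N \<rightarrow>\<^sub>M Pi\<^sub>M {..<k} (\<lambda>_. N)"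
  proof (rule measurable_restrict)
    fix i assume "i \<in> {..<k}"
    show "(\<lambda>y. if i < k - 1 then S i y else y) \<in> N \<rightarrow>\<^sub>M N"
      using S[of i] by (cases "i < k - 1") simp_all
  qed
  have box: "Pi\<^sub>E {..<k} A \<in> sets (Pi\<^sub>M {..<k} (\<lambda>_. N))"
    using A by (intro sets_PiM_I_finite) auto
  have "(\<lambda>y. \<lambda>i\<in>{..<k}. if i < k - 1 then S i y else y) -` Pi\<^sub>E {..<k} A \<inter> space N =
        {y \<in> space N. \<forall>i<k. (if i < k - 1 then S i y else y) \<in> A i}"
    unfolding PiE_iff vimage_def by fastforce
  also have "\<dots> = {y \<in> space N. (\<forall>i<k - 1. S i y \<in> A i) \<and> y \<in> A (k - 1)}"
  proof (intro Collect_cong conj_cong refl)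
    fix y
    obtain m where "k = Suc m" using k by (cases k) simp_all
    then show "(\<forall>i<k. (if i < k - 1 then S i y else y) \<in> A i) \<longleftrightarrow>
               (\<forall>i<k - 1. S i y \<in> A i) \<and> y \<in> A (k - 1)"
      by (simp add: All_less_Suc conj_commute)
  qed
  finally show ?thesis
    unfolding graph_joining_def by (simp only: emeasure_distr[OF m box])
qed

definition joining_integral ::
    "nat \<Rightarrow> 'b measure \<Rightarrow> 'c measure \<Rightarrow> ('c \<Rightarrow> (nat \<Rightarrow> 'b) measure) \<Rightarrow> (nat \<Rightarrow> 'b) measure" where
  "joining_integral k N P \<rho> =
     measure_of (space (Pi\<^sub>M {..<k} (\<lambda>_. N))) (sets (Pi\<^sub>M {..<k} (\<lambda>_. N)))
       (\<lambda>A. \<integral>\<^sup>+t. emeasure (\<rho> t) A \<partial>P)"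

end

(*
  Write S_t for the special flow and F_n for the vector of cocycle sums f_0^(q_n^i). For x in a set of
  full measure, S_q (x, r) is the point reached from (T^q x, 0) after time r - f_0^(q)(x). Since
  T^(q_n) tends to the identity, T^(q_n) x may be replaced by x in the limit, so S_(q_n) acts on
  (x, r) like S_(-F_n(x)). Moreover F_n o T - F_n tends to 0 in L^1, whence by ergodicity F_n becomes
  independent of the base point and the pair (x, F_n(x)) converges in law to the product of the
  invariant measure and P. To turn this into convergence on all boxes, the sides of a box are
  approximated in L^1 by functions that are Lipschitz along the flow, uniformly in n because the
  flow preserves the measure.
*)

theory Submission
  imports Defs
begin

section \<open>Iterates and cocycle sums\<close>

text \<open>The roof has mean 1 and the times are integers, so a time q balances the expected height
  of q floors and what remains is minus the centred sum. The obstacle is that weak convergence of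
  F_n tests functions of t alone, while boxes lead to test functions h(x, t) that are merely
  measurable in x. Ergodic averages of h(., t) converge for each fixed t, and so do differences
  h(T^q x, t) - h(x, t) under rigidity, but both are needed at t = F_n(x), which varies with x.
  Lipschitz dependence on t, inherited from the Lipschitz condition along the flow, and bounded
  first moments of F_n, supplied by the L^2 bound, reduce this to finitely many t. The last
  coordinate of the joining is not moved, so the last side of a box keeps its indicator; it is only
  cut down to points under a bounded roof, which confines heights to a bounded interval and permits
  dominated convergence in the height. The linear growth of f^(k) makes almost every orbit of the
  flow complete in both time directions.\<close>

locale automorphism_space = prob_space M for M :: "'a measure" +
  fixes T :: "'a \<Rightarrow> 'a"
  assumes automorphism: "automorphism M T"
begin

abbreviation "iter \<equiv> int_iterate M T"

lemma iter_0 [simp]: "iter 0 x = x"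
  by (simp add: int_iterate_def)

lemma iter_of_nat: "iter (int k) = T ^^ k"
  by (simp add: int_iterate_def)

lemma T_inverse:
  assumes "x \<in> space M"
  shows "T x \<in> space M" "the_inv_into (space M) T x \<in> space M"
    "T (the_inv_into (space M) T x) = x" "the_inv_into (space M) T (T x) = x"
proof -
  have b: "bij_betw T (space M) (space M)"
    using automorphism by (simp add: automorphism_def)
  show "T x \<in> space M" using b assms by (rule bij_betwE[rule_format])
  show "the_inv_into (space M) T x \<in> space M"
    using bij_betw_the_inv_into[OF b] assms by (rule bij_betwE[rule_format])
  show "T (the_inv_into (space M) T x) = x"
    using b assms by (metis bij_betw_def f_the_inv_into_f)
  show "the_inv_into (space M) T (T x) = x"
    using b assms by (metis bij_betw_def the_inv_into_f_f)
qed

lemma iter_in_space: "x \<in> space M \<Longrightarrow> iter k x \<in> space M"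
proof -
  assume x: "x \<in> space M"
  have "(T ^^ n) x \<in> space M" "(the_inv_into (space M) T ^^ n) x \<in> space M" for n
    by (induction n) (use x in \<open>auto simp: T_inverse\<close>)
  then show ?thesis by (simp add: int_iterate_def)
qed

lemma iter_Suc: "x \<in> space M \<Longrightarrow> iter (k + 1) x = T (iter k x)"
proof -
  assume x: "x \<in> space M"
  show ?thesis
  proof (cases "0 \<le> k")
    case True
    then show ?thesis by (simp add: int_iterate_def nat_add_distrib)
  next
    case False
    then obtain m where k: "k = - int (Suc m)"
      by (metis int_cases4 of_nat_0_le_iff not0_implies_Suc of_nat_0 minus_zero)
    have "iter (- int m) x = (the_inv_into (space M) T ^^ m) x"
      by (cases "m = 0") (simp_all add: int_iterate_def)
    moreover have "iter k x = the_inv_into (space M) T ((the_inv_into (space M) T ^^ m) x)"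
      using k by (simp add: int_iterate_def nat_add_distrib flip: of_nat_Suc)
    ultimately show ?thesis
      using k T_inverse(3)[OF iter_in_space[OF x, of "- int m"]] by simp
  qed
qed

lemma iter_pred: "x \<in> space M \<Longrightarrow> iter (k - 1) x = the_inv_into (space M) T (iter k x)"
  using iter_Suc[of x "k - 1"] T_inverse(4)[OF iter_in_space[of x "k - 1"]] by simp

lemma iter_add: "x \<in> space M \<Longrightarrow> iter (j + k) x = iter j (iter k x)"
proof (induction j rule: int_induct[where k = 0])
  case base
  then show ?case by simp
next
  case (step1 i)
  then show ?case
    using iter_Suc[of x "i + k"] iter_Suc[of "iter k x" i] iter_in_space
    by (simp add: algebra_simps)
next
  case (step2 i)
  then show ?case
    using iter_pred[of x "i + k"] iter_pred[of "iter k x" i] iter_in_space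
    by (simp add: algebra_simps)
qed

lemma iter_minus: "x \<in> space M \<Longrightarrow> iter (- k) (iter k x) = x" "x \<in> space M \<Longrightarrow> iter k (iter (- k) x) = x"
  using iter_add[of x "-k" k] iter_add[of x k "-k"] by simp_all

lemma measurable_T [measurable]: "T \<in> M \<rightarrow>\<^sub>M M"
  using automorphism by (simp add: automorphism_def)

lemma measurable_T_inv: "the_inv_into (space M) T \<in> M \<rightarrow>\<^sub>M M"
  using automorphism by (simp add: automorphism_def)

lemma measurable_iter [measurable]: "iter k \<in> M \<rightarrow>\<^sub>M M"
proof (cases "0 \<le> k")
  case True
  then show ?thesis by (simp add: int_iterate_def)
next
  case False
  then show ?thesis using measurable_T_inv by (simp add: int_iterate_def)
qed

lemma distr_iter: "distr M M (iter k) = M"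
proof -
  have T: "distr M M T = M" using automorphism by (simp add: automorphism_def)
  have step: "distr M M (\<lambda>x. T (iter k x)) = distr M M (iter k)" if "distr M M (iter k) = M" for k
    using T distr_distr[of T M M "iter k" M] that by (simp add: comp_def)
  have "distr M M (iter (k + 1)) = distr M M (\<lambda>x. T (iter k x))" for k
    by (intro distr_cong refl iter_Suc)
  note up = this
  \<comment> \<open>Invariance is known for \<open>T\<close> only; writing \<open>M\<close> as its
    own image under \<open>T\<close> and cancelling yields it for the inverse, which the downward
    half of the induction uses.\<close>
  have "distr M M (the_inv_into (space M) T) = distr (distr M M T) M (the_inv_into (space M) T)"
    by (simp add: T)
  also have "\<dots> = distr M M (\<lambda>x. x)"
    unfolding distr_distr[OF measurable_T_inv measurable_T] comp_def
    by (intro distr_cong refl T_inverse)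
  finally have Ti: "distr M M (the_inv_into (space M) T) = M" by (simp add: distr_id)
  have down: "distr M M (iter (k - 1)) = distr (distr M M (iter k)) M (the_inv_into (space M) T)" for k
    by (subst distr_distr) (auto intro!: distr_cong simp: iter_pred measurable_T_inv)
  show ?thesis
  proof (induction k rule: int_induct[where k = 0])
    case base
    then show ?case by (simp add: distr_id cong: distr_cong)
  next
    case (step1 i)
    then show ?case using up[of i] step[of i] by simp
  next
    case (step2 i)
    then show ?case using down[of i] Ti by simp
  qed
qed

lemma integral_iter:
  fixes g :: "'a \<Rightarrow> real"
  assumes "g \<in> borel_measurable M"
  shows "(\<integral>x. g (iter k x) \<partial>M) = (\<integral>x. g x \<partial>M)"
  using integral_distr[of "iter k" M M g] assms by (simp add: distr_iter)

lemma integrable_iter: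
  fixes g :: "'a \<Rightarrow> real"
  assumes "integrable M g"
  shows "integrable M (\<lambda>x. g (iter k x))"
  using integrable_distr[of "iter k" M M g] assms by (simp add: distr_iter)

lemma nn_integral_iter:
  assumes "g \<in> borel_measurable M"
  shows "(\<integral>\<^sup>+x. g (iter k x) \<partial>M) = (\<integral>\<^sup>+x. g x \<partial>M)"
  using nn_integral_distr[of "iter k" M M g] assms by (simp add: distr_iter)

lemma AE_iter:
  assumes "AE x in M. P x"
  shows "AE x in M. P (iter k x)"
proof -
  have "AE x in distr M M (iter k). P x"
    unfolding distr_iter by (rule assms)
  then show ?thesis by (rule AE_distrD[OF measurable_iter])
qed

abbreviation "csum \<equiv> cocycle_sum M T"

lemma csum_0 [simp]: "csum g 0 x = 0"
  by (simp add: cocycle_sum_def)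

lemma csum_Suc: "csum g (k + 1) x = csum g k x + g (iter k x)"
proof (cases "0 \<le> k")
  case True
  have "{0..<k + 1} = insert k {0..<k}" using True by auto
  then show ?thesis using True by (simp add: cocycle_sum_def)
next
  case False
  have "{k..-1} = insert k {k + 1..-1}" using False by auto
  moreover have "csum g (k + 1) x = - (\<Sum>j\<in>{k + 1..-1}. g (iter j x))"
    using False by (cases "k = -1") (auto simp: cocycle_sum_def)
  ultimately show ?thesis using False by (simp add: cocycle_sum_def)
qed

lemma csum_add:
  assumes x: "x \<in> space M"
  shows "csum g (j + k) x = csum g k x + csum g j (iter k x)"
proof (induction j rule: int_induct[where k = 0])
  case base
  then show ?case by simp
next
  case (step1 i)
  then show ?case
    using csum_Suc[of g "i + k" x] csum_Suc[of g i "iter k x"] iter_add[OF x, of i k]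
    by (simp add: algebra_simps)
next
  case (step2 i)
  then show ?case
    using csum_Suc[of g "i + k - 1" x] csum_Suc[of g "i - 1" "iter k x"] iter_add[OF x, of "i - 1" k]
    by (simp add: algebra_simps)
qed

lemma csum_minus:
  assumes "x \<in> space M"
  shows "csum g (- k) x = - csum g k (iter (- k) x)"
  using csum_add[OF assms, of g k "-k"] by simp

lemma csum_of_nat: "csum g (int n) x = (\<Sum>j<n. g ((T ^^ j) x))"
proof (induction n)
  case (Suc n)
  then show ?case
    using csum_Suc[of g "int n" x] by (simp add: iter_of_nat add.commute)
qed simp

text \<open>For \<open>a = 1\<close> this is f_0^(k) = f^(k) - k for all integers k, which converts
  integer flow times into centred sums.\<close>

lemma csum_const_diff:
  "csum (\<lambda>x. g x - a) k x = csum g k x - a * real_of_int k"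
proof (induction k rule: int_induct[where k = 0])
  case base
  then show ?case by simp
next
  case (step1 i)
  then show ?case
    using csum_Suc[of g i x] csum_Suc[of "\<lambda>x. g x - a" i x] by (simp add: algebra_simps)
next
  case (step2 i)
  then show ?case
    using csum_Suc[of g "i - 1" x] csum_Suc[of "\<lambda>x. g x - a" "i - 1" x]
    by (simp add: algebra_simps)
qed

lemma measurable_csum [measurable]:
  "g \<in> borel_measurable M \<Longrightarrow> csum g k \<in> borel_measurable M"
proof -
  assume [measurable]: "g \<in> borel_measurable M"
  have m: "(\<lambda>x. \<Sum>j\<in>J. g (iter j x)) \<in> borel_measurable M" for J :: "int set"
    by (intro borel_measurable_sum) measurable
  show ?thesis
    unfolding cocycle_sum_def[abs_def] using m by (cases "0 \<le> k") simp_all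
qed

lemma integrable_csum:
  "integrable M g \<Longrightarrow> integrable M (csum g k)"
  unfolding cocycle_sum_def[abs_def]
  by (cases "0 \<le> k") (auto intro!: Bochner_Integration.integrable_sum integrable_iter)

end

section \<open>The special flow\<close>

text \<open>The growth of the cocycle sums is recorded through its consequence
  \<open>csum_unbounded\<close>: with a positive roof it says that almost every orbit passes every
  level, upward and downward. Bounds range over natural numbers so that the set of such points is a
  countable combination of measurable sets.\<close>

locale special_flow_space = automorphism_space M T for M :: "'a measure" and T +
  fixes f :: "'a \<Rightarrow> real"
  assumes integrable_roof: "integrable M f"
    and roof_pos: "x \<in> space M \<Longrightarrow> 0 < f x"
    and integral_roof: "(\<integral>x. f x \<partial>M) = 1"
    and csum_unbounded: "AE x in M. (\<forall>b::nat. \<exists>k. real b < cocycle_sum M T f k x) \<and>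
                                    (\<forall>b::nat. \<exists>k. cocycle_sum M T f k x < - real b)"
begin

abbreviation "flow \<equiv> special_flow M T f"
abbreviation "N \<equiv> special_measure M f"

definition good :: "'a set" where
  "good = {x \<in> space M. (\<forall>b::nat. \<exists>k. real b < csum f k x) \<and> (\<forall>b::nat. \<exists>k. csum f k x < - real b)}"

definition floor_index :: "'a \<Rightarrow> real \<Rightarrow> int" where
  "floor_index x v = (THE n. csum f n x \<le> v \<and> v < csum f (n + 1) x)"

text \<open>The value \<open>(x, 0)\<close> off \<open>good\<close> is a placeholder that keeps the map inside the space below the roof.\<close>

definition base_flow :: "'a \<Rightarrow> real \<Rightarrow> 'a \<times> real" where
  "base_flow x v =
     (if x \<in> good then (iter (floor_index x v) x, v - csum f (floor_index x v) x) else (x, 0))"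

lemma measurable_roof [measurable]: "f \<in> borel_measurable M"
  using integrable_roof by simp

lemma good_in_space: "x \<in> good \<Longrightarrow> x \<in> space M"
  by (simp add: good_def)

lemma sets_good [measurable]: "good \<in> sets M"
  unfolding good_def by measurable

lemma AE_good: "AE x in M. x \<in> good"
  using csum_unbounded by (rule AE_mp) (simp add: good_def)

lemma csum_roof_less:
  assumes "m < n" "x \<in> space M"
  shows "csum f m x < csum f n x"
  using assms
proof (induction n rule: int_gr_induct)
  case base
  then show ?case using csum_Suc[of f m x] roof_pos iter_in_space by simp
next
  case (step i)
  have "csum f i x < csum f (i + 1) x"
    using csum_Suc[of f i x] roof_pos iter_in_space step by simp
  then show ?case using step by simp
qed

lemma csum_roof_le: "x \<in> space M \<Longrightarrow> m \<le> n \<Longrightarrow> csum f m x \<le> csum f n x"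
  using csum_roof_less[of m n x] by (cases "m = n") auto

lemma floor_unique:
  assumes "x \<in> space M" "csum f n x \<le> v" "v < csum f (n + 1) x"
    "csum f m x \<le> v" "v < csum f (m + 1) x"
  shows "m = n"
  using csum_roof_le[of x "n + 1" m] csum_roof_le[of x "m + 1" n] assms
  by (cases m n rule: linorder_cases) auto

text \<open>A discrete intermediate value argument: if no interval between consecutive sums
  contained \<open>v\<close>, the bound \<open>csum f n x \<le> v\<close> would propagate upward
  from an index where it holds and contradict unboundedness above.\<close>

lemma ex_floor:
  assumes x: "x \<in> good"
  shows "\<exists>n. csum f n x \<le> v \<and> v < csum f (n + 1) x"
proof (rule ccontr)
  assume no: "\<not> ?thesis"
  obtain b :: nat where b: "\<bar>v\<bar> < real b" using reals_Archimedean2 by blast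
  obtain k where k: "csum f k x < - real b" using x unfolding good_def by blast
  obtain l where l: "real b < csum f l x" using x unfolding good_def by blast
  have le: "csum f n x \<le> v" if "n \<ge> k" for n
    using that
  proof (induction n rule: int_ge_induct)
    case base
    then show ?case using k b by simp
  next
    case (step i)
    then show ?case using no by (metis linorder_not_less)
  qed
  have "l \<ge> k"
    using csum_roof_le[of x l k] good_in_space[OF x] k l by (cases "l \<le> k") auto
  from le[OF this] show False using l b by simp
qed

lemma floor_index_eq:
  assumes "x \<in> space M" "csum f n x \<le> v" "v < csum f (n + 1) x"
  shows "floor_index x v = n"
  unfolding floor_index_def
  by (rule the_equality) (use assms floor_unique in auto)

lemma floor_index:
  assumes "x \<in> good"
  shows "csum f (floor_index x v) x \<le> v" "v < csum f (floor_index x v + 1) x"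
  using ex_floor[OF assms, of v] floor_index_eq good_in_space[OF assms] by blast+

text \<open>Identifies \<open>good\<close> with the exact case distinction in the definition of the
  special flow, so that \<open>flow_eq\<close> holds over every point of the base and not only
  almost everywhere.\<close>

lemma good_iff:
  assumes x: "x \<in> space M"
  shows "x \<in> good \<longleftrightarrow> (\<forall>v. \<exists>!n. csum f n x \<le> v \<and> v < csum f (n + 1) x)"
proof
  assume "x \<in> good"
  then show "\<forall>v. \<exists>!n. csum f n x \<le> v \<and> v < csum f (n + 1) x"
    using ex_floor floor_unique[OF x] by blast
next
  assume ex: "\<forall>v. \<exists>!n. csum f n x \<le> v \<and> v < csum f (n + 1) x"
  have "\<exists>k. real b < csum f k x" for b :: nat
    using ex by blast
  moreover have "\<exists>k. csum f k x < - real b" for b :: nat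
  proof -
    \<comment> \<open>The extra 1 turns the weak inequality into the strict one asked for.\<close>
    obtain n where "csum f n x \<le> - real b - 1" using ex by blast
    then show ?thesis by (intro exI[of _ n]) simp
  qed
  ultimately show "x \<in> good" using x by (simp add: good_def)
qed

lemma good_iter [simp]:
  assumes x: "x \<in> space M"
  shows "iter k x \<in> good \<longleftrightarrow> x \<in> good"
proof -
  have *: "iter k x \<in> good" if x: "x \<in> good" for x k
  proof -
    have sp: "x \<in> space M" using x by (rule good_in_space)
    have c: "csum f j (iter k x) = csum f (j + k) x - csum f k x" for j
      using csum_add[OF sp, of f j k] by simp
    \<comment> \<open>\<open>b0\<close> absorbs the constant \<open>csum f k x\<close> by which the
      sums along the two base points differ.\<close>
    obtain b0 :: nat where b0: "\<bar>csum f k x\<bar> < real b0" using reals_Archimedean2 by blast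
    have "\<exists>j. real b < csum f j (iter k x)" for b
    proof -
      obtain l where "real (b + b0) < csum f l x" using x unfolding good_def by blast
      then have "real b < csum f (l - k) (iter k x)" using b0 by (simp add: c)
      then show ?thesis ..
    qed
    moreover have "\<exists>j. csum f j (iter k x) < - real b" for b
    proof -
      obtain l where "csum f l x < - real (b + b0)" using x unfolding good_def by blast
      then have "csum f (l - k) (iter k x) < - real b" using b0 by (simp add: c)
      then show ?thesis ..
    qed
    ultimately show ?thesis using iter_in_space[OF sp] by (simp add: good_def)
  qed
  show ?thesis using *[of x k] *[of "iter k x" "-k"] iter_minus(1)[OF x, of k] by auto
qed

lemma space_N: "space N = {(x, s). x \<in> space M \<and> 0 \<le> s \<and> s < f x}"
  by (auto simp: special_measure_def space_restrict_space space_pair_measure)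

lemma sets_subgraph [measurable]: "{(x, s). x \<in> space M \<and> 0 \<le> s \<and> s < f x} \<in> sets (M \<Otimes>\<^sub>M lborel)"
proof -
  have "{(x, s). x \<in> space M \<and> 0 \<le> s \<and> s < f x} =
        {y \<in> space (M \<Otimes>\<^sub>M lborel). 0 \<le> snd y \<and> snd y < f (fst y)}"
    by (auto simp: space_pair_measure)
  also have "\<dots> \<in> sets (M \<Otimes>\<^sub>M lborel)" by measurable
  finally show ?thesis .
qed

lemma subgraph_Int_space:
  "{(x, s). x \<in> space M \<and> 0 \<le> s \<and> s < f x} \<inter> space (M \<Otimes>\<^sub>M lborel) =
   {(x, s). x \<in> space M \<and> 0 \<le> s \<and> s < f x}"
  by (auto simp: space_pair_measure)

lemma base_flow_in_N:
  assumes x: "x \<in> space M"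
  shows "base_flow x v \<in> space N"
proof (cases "x \<in> good")
  case True
  then show ?thesis
    using floor_index[OF True, of v] csum_Suc[of f "floor_index x v" x] iter_in_space[OF x]
    by (simp add: base_flow_def space_N)
qed (use x roof_pos in \<open>simp add: base_flow_def space_N\<close>)

text \<open>The point (T^k x, 0) lies on the orbit of (x, 0) at time f^(k)(x), so a change of base
  point along an orbit merely resets the clock.\<close>

lemma base_flow_iter:
  assumes x: "x \<in> good"
  shows "base_flow (iter k x) v = base_flow x (v + csum f k x)"
proof -
  note sp = good_in_space[OF x]
  have g: "iter k x \<in> good" using x sp by simp
  define n where "n = floor_index (iter k x) v"
  have "csum f n (iter k x) \<le> v" "v < csum f (n + 1) (iter k x)"
    using floor_index[OF g, of v] by (simp_all add: n_def)
  then have "floor_index x (v + csum f k x) = n + k"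
    using csum_add[OF sp, of f n k] csum_add[OF sp, of f "n + 1" k]
    by (intro floor_index_eq[OF sp]) (simp_all add: algebra_simps)
  then show ?thesis
    using x g iter_add[OF sp, of n k] csum_add[OF sp, of f n k]
    by (simp add: base_flow_def n_def[symmetric])
qed

lemma base_flow_fiber:
  assumes x: "x \<in> good" and r: "0 \<le> r" "r < f x"
  shows "base_flow x r = (x, r)"
proof -
  have "floor_index x r = 0"
    using r csum_Suc[of f 0 x] by (intro floor_index_eq good_in_space[OF x]) simp_all
  then show ?thesis using x by (simp add: base_flow_def)
qed

lemma flow_eq:
  assumes "x \<in> space M"
  shows "flow t (x, r) = (if x \<in> good then base_flow x (r + t) else (x, r))"
  using good_iff[OF assms] by (simp add: special_flow_def base_flow_def floor_index_def Let_def)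

text \<open>In the coordinate \<open>v\<close> over a good point the flow is a translation. The
  group law follows from this without any comparison of floor indices.\<close>

lemma flow_base_flow:
  assumes x: "x \<in> space M"
  shows "flow t (base_flow x v) = (if x \<in> good then base_flow x (v + t) else base_flow x v)"
proof (cases "x \<in> good")
  case True
  then show ?thesis
    using iter_in_space[OF x] base_flow_iter[OF True, of "floor_index x v"] x
    by (simp add: base_flow_def[of x v] flow_eq)
next
  case False
  then show ?thesis using x by (simp add: base_flow_def flow_eq)
qed

lemma flow_in_N: "y \<in> space N \<Longrightarrow> flow t y \<in> space N"
  using base_flow_in_N by (cases y) (auto simp: flow_eq space_N[THEN eqset_imp_iff, of "(_, _)"])

lemma flow_add:
  assumes "y \<in> space N"
  shows "flow s (flow t y) = flow (s + t) y"
proof -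
  obtain x r where y: "y = (x, r)" "x \<in> space M" using assms by (auto simp: space_N)
  then show ?thesis
    by (cases "x \<in> good") (simp_all add: flow_eq flow_base_flow algebra_simps)
qed

lemma flow_0: "y \<in> space N \<Longrightarrow> flow 0 y = y"
  by (auto simp: space_N flow_eq base_flow_fiber)

text \<open>The floor index takes countably many values, and on each of its level sets the map is an
  explicit measurable expression.\<close>

lemma measurable_base_flow:
  "(\<lambda>(x, v). base_flow x v) \<in> M \<Otimes>\<^sub>M borel \<rightarrow>\<^sub>M N"
proof -
  \<comment> \<open>Over points that are not good the index is fixed to 0, so that its level sets
    have an explicit description there as well.\<close>
  define k where "k y = (if fst y \<in> good then floor_index (fst y) (snd y) else 0)" for y
  have "k -` {n} \<inter> space (M \<Otimes>\<^sub>M borel) =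
      {y \<in> space (M \<Otimes>\<^sub>M borel). if fst y \<in> good
         then csum f n (fst y) \<le> snd y \<and> snd y < csum f (n + 1) (fst y) else n = 0}" for n
    using floor_index floor_index_eq good_in_space
    by (auto simp: space_pair_measure k_def)
  moreover have "{y \<in> space (M \<Otimes>\<^sub>M borel). if fst y \<in> good
         then csum f n (fst y) \<le> snd y \<and> snd y < csum f (n + 1) (fst y) else n = 0}
     \<in> sets (M \<Otimes>\<^sub>M borel)" for n
    by measurable
  ultimately have [measurable]: "k \<in> M \<Otimes>\<^sub>M borel \<rightarrow>\<^sub>M count_space UNIV"
    by (subst measurable_count_space_eq2_countable) auto
  have "(\<lambda>y. (\<lambda>n y. if fst y \<in> good then (iter n (fst y), snd y - csum f n (fst y)) else (fst y, 0)) (k y) y)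
      \<in> M \<Otimes>\<^sub>M borel \<rightarrow>\<^sub>M M \<Otimes>\<^sub>M lborel"
    by (rule measurable_compose_countable) measurable
  also have "(\<lambda>y. (\<lambda>n y. if fst y \<in> good then (iter n (fst y), snd y - csum f n (fst y)) else (fst y, 0)) (k y) y)
      = (\<lambda>(x, v). base_flow x v)"
    by (auto simp: fun_eq_iff base_flow_def k_def)
  finally show ?thesis
    unfolding special_measure_def
    using base_flow_in_N
    by (intro measurable_restrict_space2)
       (auto simp: space_pair_measure simp flip: space_N)
qed

lemma measurable_base_flow_compose [measurable (raw)]:
  "g \<in> L \<rightarrow>\<^sub>M M \<Longrightarrow> h \<in> borel_measurable L \<Longrightarrow> (\<lambda>x. base_flow (g x) (h x)) \<in> L \<rightarrow>\<^sub>M N"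
  using measurable_compose[OF measurable_Pair[of g L M h borel] measurable_base_flow] by simp

lemma measurable_fst_N [measurable]: "fst \<in> N \<rightarrow>\<^sub>M M" and measurable_snd_N [measurable]: "snd \<in> borel_measurable N"
  unfolding special_measure_def by (auto intro!: measurable_restrict_space1)

text \<open>Stated jointly in time and point, because the flow times of the limit joining are
  integrated against \<open>P\<close>.\<close>

lemma measurable_flow [measurable (raw)]:
  assumes [measurable]: "t \<in> borel_measurable L" and g [measurable]: "g \<in> L \<rightarrow>\<^sub>M N"
  shows "(\<lambda>x. flow (t x) (g x)) \<in> L \<rightarrow>\<^sub>M N"
proof -
  have eq: "flow (t x) (g x) = (if fst (g x) \<in> good then base_flow (fst (g x)) (snd (g x) + t x) else g x)"
    if "x \<in> space L" for x
    using measurable_space[OF g that] flow_eq[of "fst (g x)" "t x" "snd (g x)"]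
    by (simp add: space_N split_beta)
  have 1: "(\<lambda>x. fst (g x)) \<in> L \<rightarrow>\<^sub>M M"
    by (rule measurable_compose[OF g measurable_fst_N])
  have 2: "(\<lambda>x. snd (g x)) \<in> borel_measurable L"
    by (rule measurable_compose[OF g measurable_snd_N])
  have "{x \<in> space L. fst (g x) \<in> good} \<in> sets L"
    using measurable_sets[OF 1 sets_good] by (simp add: vimage_def Int_def conj_commute)
  then have "(\<lambda>x. if fst (g x) \<in> good then base_flow (fst (g x)) (snd (g x) + t x) else g x) \<in> L \<rightarrow>\<^sub>M N"
    using 2 by (intro measurable_If measurable_base_flow_compose 1 g borel_measurable_add assms)
  then show ?thesis
    by (subst measurable_cong[OF eq])
qed

lemma sets_N_iff: "A \<in> sets N \<longleftrightarrow> A \<in> sets (M \<Otimes>\<^sub>M lborel) \<and> A \<subseteq> space N"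
  unfolding special_measure_def
  using sets_subgraph
  by (subst sets_restrict_space_iff, unfold subgraph_Int_space)
     (auto simp: space_restrict_space space_pair_measure)

lemma nn_integral_N:
  assumes [measurable]: "g \<in> borel_measurable N"
  shows "(\<integral>\<^sup>+y. g y \<partial>N) = (\<integral>\<^sup>+x. \<integral>\<^sup>+r. g (x, r) * indicator {0..<f x} r \<partial>lborel \<partial>M)"
proof -
  let ?S = "{(x, s). x \<in> space M \<and> 0 \<le> s \<and> s < f x}"
  have gm: "(\<lambda>y. g y * indicator ?S y) \<in> borel_measurable (M \<Otimes>\<^sub>M lborel)"
    using assms borel_measurable_restrict_space_iff_ennreal[of ?S "M \<Otimes>\<^sub>M lborel" g]
    unfolding special_measure_def subgraph_Int_space by (simp only: sets_subgraph)
  have "(\<integral>\<^sup>+y. g y \<partial>N) = (\<integral>\<^sup>+y. g y * indicator ?S y \<partial>(M \<Otimes>\<^sub>M lborel))"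
    unfolding special_measure_def
    by (rule nn_integral_restrict_space) (unfold subgraph_Int_space, rule sets_subgraph)
  also have "\<dots> = (\<integral>\<^sup>+x. \<integral>\<^sup>+r. g (x, r) * indicator ?S (x, r) \<partial>lborel \<partial>M)"
    using lborel.nn_integral_fst[OF gm] by simp
  also have "\<dots> = (\<integral>\<^sup>+x. \<integral>\<^sup>+r. g (x, r) * indicator {0..<f x} r \<partial>lborel \<partial>M)"
    by (intro nn_integral_cong) (auto simp: indicator_def)
  finally show ?thesis .
qed

lemma prob_space_N: "prob_space N"
proof
  have "emeasure N (space N) = (\<integral>\<^sup>+y. 1 \<partial>N)" by simp
  also have "\<dots> = (\<integral>\<^sup>+x. f x \<partial>M)"
    by (subst nn_integral_N) (auto intro!: nn_integral_cong simp: roof_pos less_imp_le)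
  also have "\<dots> = ennreal (\<integral>x. f x \<partial>M)"
    by (intro nn_integral_eq_integral integrable_roof) (auto intro!: AE_I2 simp: roof_pos less_imp_le)
  finally show "emeasure N (space N) = 1" by (simp add: integral_roof)
qed

text \<open>Cut the fiber over \<open>x\<close> according to which roof is reached at time \<open>t\<close>, move each piece
  by the invariance of \<open>M\<close> under the iterates, and reassemble the pieces as the partition of the
  target fiber by the position at time \<open>-t\<close>.\<close>

lemma nn_integral_flow:
  assumes g [measurable]: "g \<in> borel_measurable N"
  shows "(\<integral>\<^sup>+y. g (flow t y) \<partial>N) = (\<integral>\<^sup>+y. g y \<partial>N)"
proof -
  define b where "b n x v = (if csum f n x \<le> v \<and> v < csum f (n + 1) x then 1 else 0 :: ennreal)" for n x v
  define e where "e x v = (if 0 \<le> v \<and> v < f x then 1 else 0 :: ennreal)" for x v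
  define G where "G x v = g (base_flow x v)" for x v
  have [measurable]: "(\<lambda>y. b n (X y) (V y)) \<in> borel_measurable L"
      "(\<lambda>y. e (X y) (V y)) \<in> borel_measurable L"
      "(\<lambda>y. G (X y) (V y)) \<in> borel_measurable L"
    if [measurable]: "X \<in> L \<rightarrow>\<^sub>M M" "V \<in> borel_measurable L" for n X V and L :: "'c measure"
    unfolding b_def e_def G_def by measurable
  have sum_b: "(\<integral>\<^sup>+n. b n x v \<partial>count_space UNIV) = 1" if x: "x \<in> good" for x v
  proof -
    have "b n x v = indicator {floor_index x v} n" for n
      using floor_index[OF x, of v] floor_index_eq[OF good_in_space[OF x], of n v]
      by (auto simp: b_def indicator_def)
    then show ?thesis by simp
  qed
  \<comment> \<open>Seen from the target fiber over T^n x, the points that came from the fiber over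
    x are those whose position at time -t has floor index -n.\<close>
  have b_minus: "b (- n) (iter n x) (v - t) = e x (v - t + csum f n x)" if x: "x \<in> space M" for n x v
    using csum_add[OF x, of f "-n" n] csum_add[OF x, of f "-n+1" n] csum_Suc[of f 0 x]
    by (auto simp: b_def e_def algebra_simps)
  have "(\<integral>\<^sup>+y. g (flow t y) \<partial>N) = (\<integral>\<^sup>+x. \<integral>\<^sup>+r. g (flow t (x, r)) * indicator {0..<f x} r \<partial>lborel \<partial>M)"
    by (rule nn_integral_N) measurable
  also have "\<dots> = (\<integral>\<^sup>+x. \<integral>\<^sup>+r. \<integral>\<^sup>+n. G x (r + t) * e x r * b n x (r + t) \<partial>count_space UNIV \<partial>lborel \<partial>M)"
  proof (rule nn_integral_cong_AE)
    show "AE x in M. (\<integral>\<^sup>+r. g (flow t (x, r)) * indicator {0..<f x} r \<partial>lborel) =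
      (\<integral>\<^sup>+r. \<integral>\<^sup>+n. G x (r + t) * e x r * b n x (r + t) \<partial>count_space UNIV \<partial>lborel)"
      using AE_good
    proof eventually_elim
      case (elim x)
      then show ?case
        by (auto intro!: nn_integral_cong simp: nn_integral_cmult sum_b flow_eq good_in_space
            G_def e_def indicator_def)
    qed
  qed
  also have "\<dots> = (\<integral>\<^sup>+x. \<integral>\<^sup>+n. \<integral>\<^sup>+r. G x (r + t) * e x r * b n x (r + t) \<partial>lborel \<partial>count_space UNIV \<partial>M)"
    by (intro nn_integral_cong nn_integral_count_space_nn_integral) auto
  also have "\<dots> = (\<integral>\<^sup>+n. \<integral>\<^sup>+x. \<integral>\<^sup>+r. G x (r + t) * e x r * b n x (r + t) \<partial>lborel \<partial>M \<partial>count_space UNIV)"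
    by (intro nn_integral_count_space_nn_integral) auto
  also have "\<dots> = (\<integral>\<^sup>+n. \<integral>\<^sup>+x. \<integral>\<^sup>+v. G x v * e x v * b (- n) x (v - t) \<partial>lborel \<partial>M \<partial>count_space UNIV)"
  proof (rule nn_integral_cong)
    fix n :: int
    have "(\<integral>\<^sup>+x. \<integral>\<^sup>+r. G x (r + t) * e x r * b n x (r + t) \<partial>lborel \<partial>M) =
          (\<integral>\<^sup>+x. \<integral>\<^sup>+v. G (iter n x) v * e (iter n x) v * b (- n) (iter n x) (v - t) \<partial>lborel \<partial>M)"
    proof (rule nn_integral_cong_AE)
      show "AE x in M. (\<integral>\<^sup>+r. G x (r + t) * e x r * b n x (r + t) \<partial>lborel) =
          (\<integral>\<^sup>+v. G (iter n x) v * e (iter n x) v * b (- n) (iter n x) (v - t) \<partial>lborel)"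
        using AE_good
      proof eventually_elim
        case (elim x)
        note sp = good_in_space[OF elim]
        have "(\<integral>\<^sup>+r. G x (r + t) * e x r * b n x (r + t) \<partial>lborel) =
          (\<integral>\<^sup>+v. G x (v + csum f n x) * e x (v - t + csum f n x) * b n x (v + csum f n x) \<partial>lborel)"
          \<comment> \<open>The substitution r = v + f^(n)(x) - t makes v the height above the image
            point T^n x.\<close>
          using sp by (subst nn_integral_real_affine[where c = 1 and t = "csum f n x - t"])
             (auto simp: algebra_simps)
        also have "\<dots> = (\<integral>\<^sup>+v. G (iter n x) v * e (iter n x) v * b (- n) (iter n x) (v - t) \<partial>lborel)"
        proof (rule nn_integral_cong)
          fix v
          have "b n x (v + csum f n x) = e (iter n x) v"
            using csum_Suc[of f n x] by (auto simp: b_def e_def)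
          then show "G x (v + csum f n x) * e x (v - t + csum f n x) * b n x (v + csum f n x) =
              G (iter n x) v * e (iter n x) v * b (- n) (iter n x) (v - t)"
            using b_minus[OF sp] base_flow_iter[OF elim] by (simp add: G_def mult_ac)
        qed
        finally show ?case .
      qed
    qed
    also have "\<dots> = (\<integral>\<^sup>+x. \<integral>\<^sup>+v. G x v * e x v * b (- n) x (v - t) \<partial>lborel \<partial>M)"
      by (rule nn_integral_iter) measurable
    finally show "(\<integral>\<^sup>+x. \<integral>\<^sup>+r. G x (r + t) * e x r * b n x (r + t) \<partial>lborel \<partial>M) =
        (\<integral>\<^sup>+x. \<integral>\<^sup>+v. G x v * e x v * b (- n) x (v - t) \<partial>lborel \<partial>M)" .
  qed
  also have "\<dots> = (\<integral>\<^sup>+x. \<integral>\<^sup>+n. \<integral>\<^sup>+v. G x v * e x v * b (- n) x (v - t) \<partial>lborel \<partial>count_space UNIV \<partial>M)"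
    by (intro nn_integral_count_space_nn_integral[symmetric]) auto
  also have "\<dots> = (\<integral>\<^sup>+x. \<integral>\<^sup>+v. \<integral>\<^sup>+n. G x v * e x v * b (- n) x (v - t) \<partial>count_space UNIV \<partial>lborel \<partial>M)"
    by (intro nn_integral_cong nn_integral_count_space_nn_integral[symmetric]) auto
  also have "\<dots> = (\<integral>\<^sup>+x. \<integral>\<^sup>+r. g (x, r) * indicator {0..<f x} r \<partial>lborel \<partial>M)"
  proof (rule nn_integral_cong_AE)
    have sum_b': "(\<integral>\<^sup>+n. b (- n) x v \<partial>count_space UNIV) = 1" if "x \<in> good" for x v
      using nn_integral_bij_count_space[of uminus UNIV UNIV "\<lambda>n. b n x v"] sum_b[OF that]
      by (simp add: bij_uminus)
    show "AE x in M. (\<integral>\<^sup>+v. \<integral>\<^sup>+n. G x v * e x v * b (- n) x (v - t) \<partial>count_space UNIV \<partial>lborel) =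
      (\<integral>\<^sup>+r. g (x, r) * indicator {0..<f x} r \<partial>lborel)"
      using AE_good
      by eventually_elim (auto intro!: nn_integral_cong simp: nn_integral_cmult sum_b' G_def e_def
          indicator_def base_flow_fiber)
  qed
  also have "\<dots> = (\<integral>\<^sup>+y. g y \<partial>N)"
    by (rule nn_integral_N[symmetric]) measurable
  finally show ?thesis .
qed

lemma measurable_flow1 [measurable]: "flow t \<in> N \<rightarrow>\<^sub>M N"
  by measurable

lemma distr_flow: "distr N N (flow t) = N"
proof (rule measure_eqI)
  fix A assume "A \<in> sets (distr N N (flow t))"
  then have A [measurable]: "A \<in> sets N" by simp
  have "emeasure (distr N N (flow t)) A = (\<integral>\<^sup>+y. indicator A (flow t y) \<partial>N)"
    using nn_integral_distr[of "flow t" N N "indicator A"] by simp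
  also have "\<dots> = emeasure N A" by (subst nn_integral_flow) simp_all
  finally show "emeasure (distr N N (flow t)) A = emeasure N A" .
qed simp

lemma integral_flow:
  fixes g :: "'a \<times> real \<Rightarrow> real"
  assumes "g \<in> borel_measurable N"
  shows "(\<integral>y. g (flow t y) \<partial>N) = (\<integral>y. g y \<partial>N)"
  using integral_distr[of "flow t" N N g] assms by (simp add: distr_flow)

end

section \<open>Graph joinings and integrals of joinings for a general system\<close>

lemma sets_graph_joining [simp]: "sets (graph_joining k N S) = sets (Pi\<^sub>M {..<k} (\<lambda>_. N))"
  by (simp add: graph_joining_def)

lemma measurable_graph_vector:
  assumes "\<And>i. i < k - 1 \<Longrightarrow> (\<lambda>y. S i y) \<in> L \<rightarrow>\<^sub>M N" "g \<in> L \<rightarrow>\<^sub>M N"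
  shows "(\<lambda>y. \<lambda>i\<in>{..<k}. if i < k - 1 then S i y else g y) \<in> L \<rightarrow>\<^sub>M Pi\<^sub>M {..<k} (\<lambda>_. N)"
proof (rule measurable_restrict)
  fix i
  show "(\<lambda>y. if i < k - 1 then S i y else g y) \<in> L \<rightarrow>\<^sub>M N"
    using assms by (cases "i < k - 1") simp_all
qed

text \<open>Commutation moves \<open>R t\<close> through the graph map: the product action after the
  graph map equals the graph map after \<open>R t\<close>, and \<open>R t\<close> preserves
  \<open>N\<close>. The marginals are images of \<open>N\<close> under the \<open>S i\<close> or the
  identity.\<close>

lemma graph_joining_self_joining:
  assumes N: "prob_space N"
    and [measurable]: "\<And>t. R t \<in> N \<rightarrow>\<^sub>M N" "\<And>i. i < k - 1 \<Longrightarrow> S i \<in> N \<rightarrow>\<^sub>M N"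
    and R: "\<And>t. distr N N (R t) = N" and S: "\<And>i. i < k - 1 \<Longrightarrow> distr N N (S i) = N"
    and comm: "\<And>i t y. i < k - 1 \<Longrightarrow> y \<in> space N \<Longrightarrow> R t (S i y) = S i (R t y)"
  shows "graph_joining k N S \<in> self_joinings k N R"
proof -
  let ?P = "Pi\<^sub>M {..<k} (\<lambda>_. N)"
  let ?v = "\<lambda>y. \<lambda>i\<in>{..<k}. if i < k - 1 then S i y else y"
  have v [measurable]: "?v \<in> N \<rightarrow>\<^sub>M ?P"
    by (rule measurable_graph_vector) (auto intro: assms)
  show ?thesis
    unfolding self_joinings_def mem_Collect_eq
  proof (intro conjI allI impI)
    show "prob_space (graph_joining k N S)"
      unfolding graph_joining_def by (rule prob_space.prob_space_distr[OF N v])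
    fix t
    have m: "(\<lambda>y. \<lambda>i\<in>{..<k}. R t (y i)) \<in> ?P \<rightarrow>\<^sub>M ?P"
      by (rule measurable_restrict) measurable
    have "distr (graph_joining k N S) ?P (\<lambda>y. \<lambda>i\<in>{..<k}. R t (y i)) =
          distr N ?P (\<lambda>y. ?v (R t y))"
      unfolding graph_joining_def distr_distr[OF m v]
      by (intro distr_cong) (auto simp: comm)
    also have "\<dots> = distr (distr N N (R t)) ?P ?v"
      unfolding distr_distr[OF v assms(2)] by (simp add: comp_def)
    finally show "distr (graph_joining k N S) ?P (\<lambda>y. \<lambda>i\<in>{..<k}. R t (y i)) = graph_joining k N S"
      unfolding R graph_joining_def .
  next
    fix i assume i: "i < k"
    have m: "(\<lambda>y. y i) \<in> ?P \<rightarrow>\<^sub>M N"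
      using i by (intro measurable_component_singleton) simp
    have "distr (graph_joining k N S) N (\<lambda>y. y i) = distr N N (\<lambda>y. if i < k - 1 then S i y else y)"
      unfolding graph_joining_def distr_distr[OF m v] comp_def using i by simp
    also have "\<dots> = N" using S[of i] by (cases "i < k - 1") (simp_all add: distr_id)
    finally show "distr (graph_joining k N S) N (\<lambda>y. y i) = N" .
  qed simp
qed

lemma sets_joining_integral [simp]: "sets (joining_integral k N P \<rho>) = sets (Pi\<^sub>M {..<k} (\<lambda>_. N))"
  and space_joining_integral [simp]: "space (joining_integral k N P \<rho>) = space (Pi\<^sub>M {..<k} (\<lambda>_. N))"
  unfolding joining_integral_def by (simp_all add: sets.space_closed sets.sigma_sets_eq)

text \<open>\<open>measure_of\<close> returns the prescribed set function once countable additivity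
  is known; here it comes from exchanging the series with the integral over \<open>P\<close>, for
  which measurability in \<open>t\<close> is assumed.\<close>

lemma emeasure_joining_integral:
  assumes \<rho>: "\<And>t. t \<in> space P \<Longrightarrow> sets (\<rho> t) = sets (Pi\<^sub>M {..<k} (\<lambda>_. N))"
    and m: "\<And>A. A \<in> sets (Pi\<^sub>M {..<k} (\<lambda>_. N)) \<Longrightarrow> (\<lambda>t. emeasure (\<rho> t) A) \<in> borel_measurable P"
    and A: "A \<in> sets (Pi\<^sub>M {..<k} (\<lambda>_. N))"
  shows "emeasure (joining_integral k N P \<rho>) A = (\<integral>\<^sup>+t. emeasure (\<rho> t) A \<partial>P)"
proof (rule emeasure_measure_of[OF joining_integral_def])
  show "countably_additive (sets (joining_integral k N P \<rho>)) (\<lambda>A. \<integral>\<^sup>+t. emeasure (\<rho> t) A \<partial>P)"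
  proof (rule countably_additiveI)
    fix A :: "nat \<Rightarrow> _"
    assume A: "range A \<subseteq> sets (joining_integral k N P \<rho>)" "disjoint_family A"
    have "(\<Sum>i. \<integral>\<^sup>+t. emeasure (\<rho> t) (A i) \<partial>P) = (\<integral>\<^sup>+t. (\<Sum>i. emeasure (\<rho> t) (A i)) \<partial>P)"
      using A by (intro nn_integral_suminf[symmetric] m) auto
    also have "\<dots> = (\<integral>\<^sup>+t. emeasure (\<rho> t) (\<Union>i. A i) \<partial>P)"
      using A by (intro nn_integral_cong suminf_emeasure) (auto simp: \<rho>)
    finally show "(\<Sum>i. \<integral>\<^sup>+t. emeasure (\<rho> t) (A i) \<partial>P) = (\<integral>\<^sup>+t. emeasure (\<rho> t) (\<Union>i. A i) \<partial>P)" .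
  qed
qed (use A in \<open>auto simp: positive_def sets.sets_into_space[THEN subsetD] dest: sets.sets_into_space\<close>)

text \<open>Taking images commutes with the setwise integral (\<open>distr_J\<close>), so
  invariance, marginals and total mass are inherited from the integrand at each
  \<open>t\<close>.\<close>

lemma joining_integral_self_joining:
  assumes P: "prob_space P"
    and \<rho>: "\<And>t. t \<in> space P \<Longrightarrow> \<rho> t \<in> self_joinings k N R"
    and m: "\<And>A. A \<in> sets (Pi\<^sub>M {..<k} (\<lambda>_. N)) \<Longrightarrow> (\<lambda>t. emeasure (\<rho> t) A) \<in> borel_measurable P"
    and R [measurable]: "\<And>t. R t \<in> N \<rightarrow>\<^sub>M N" and N: "prob_space N"
  shows "joining_integral k N P \<rho> \<in> self_joinings k N R"
proof -
  let ?P = "Pi\<^sub>M {..<k} (\<lambda>_. N)" and ?J = "joining_integral k N P \<rho>"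
  interpret P: prob_space P by fact
  interpret N: prob_space N by fact
  have sets_\<rho>: "sets (\<rho> t) = sets ?P" and prob_\<rho>: "prob_space (\<rho> t)"
    and inv_\<rho>: "\<And>s. distr (\<rho> t) ?P (\<lambda>y. \<lambda>i\<in>{..<k}. R s (y i)) = \<rho> t"
    and marg_\<rho>: "\<And>i. i < k \<Longrightarrow> distr (\<rho> t) N (\<lambda>y. y i) = N" if "t \<in> space P" for t
    using \<rho>[OF that] by (auto simp: self_joinings_def)
  have em: "emeasure ?J A = (\<integral>\<^sup>+t. emeasure (\<rho> t) A \<partial>P)" if "A \<in> sets ?P" for A
    using that by (intro emeasure_joining_integral sets_\<rho> m)
  have distr_J: "emeasure (distr ?J L h) A = (\<integral>\<^sup>+t. emeasure (distr (\<rho> t) L h) A \<partial>P)"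
    if h: "h \<in> ?P \<rightarrow>\<^sub>M L" and A: "A \<in> sets L" for h A and L :: "'d measure"
  proof -
    have hJ: "h \<in> ?J \<rightarrow>\<^sub>M L" using h by (simp cong: measurable_cong_sets)
    have h\<rho>: "h \<in> \<rho> t \<rightarrow>\<^sub>M L" if "t \<in> space P" for t
      using h sets_\<rho>[OF that] by (simp cong: measurable_cong_sets)
    have "emeasure (distr ?J L h) A = (\<integral>\<^sup>+t. emeasure (\<rho> t) (h -` A \<inter> space ?P) \<partial>P)"
      using emeasure_distr[OF hJ A] em[OF measurable_sets[OF h A]] by simp
    also have "\<dots> = (\<integral>\<^sup>+t. emeasure (distr (\<rho> t) L h) A \<partial>P)"
      using emeasure_distr[OF h\<rho> A] sets_eq_imp_space_eq[OF sets_\<rho>]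
      by (intro nn_integral_cong) simp
    finally show ?thesis .
  qed
  show ?thesis
    unfolding self_joinings_def mem_Collect_eq
  proof (intro conjI allI impI)
    show "prob_space ?J"
    proof
      have "emeasure ?J (space ?P) = (\<integral>\<^sup>+t. 1 \<partial>P)"
        using prob_space.emeasure_space_1[OF prob_\<rho>] sets_eq_imp_space_eq[OF sets_\<rho>]
        unfolding em[OF sets.top] by (intro nn_integral_cong) simp
      then show "emeasure ?J (space ?J) = 1" by (simp add: P.emeasure_space_1)
    qed
    fix s
    have m1: "(\<lambda>y. \<lambda>i\<in>{..<k}. R s (y i)) \<in> ?P \<rightarrow>\<^sub>M ?P"
      by (rule measurable_restrict) measurable
    show "distr ?J ?P (\<lambda>y. \<lambda>i\<in>{..<k}. R s (y i)) = ?J"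
    proof (rule measure_eqI)
      fix A assume "A \<in> sets (distr ?J ?P (\<lambda>y. \<lambda>i\<in>{..<k}. R s (y i)))"
      then have A: "A \<in> sets ?P" by simp
      show "emeasure (distr ?J ?P (\<lambda>y. \<lambda>i\<in>{..<k}. R s (y i))) A = emeasure ?J A"
        unfolding distr_J[OF m1 A] em[OF A] by (intro nn_integral_cong) (simp add: inv_\<rho>)
    qed simp
  next
    fix i assume i: "i < k"
    have m2: "(\<lambda>y. y i) \<in> ?P \<rightarrow>\<^sub>M N"
      using i by (intro measurable_component_singleton) simp
    show "distr ?J N (\<lambda>y. y i) = N"
    proof (rule measure_eqI)
      fix A assume "A \<in> sets (distr ?J N (\<lambda>y. y i))"
      then have A: "A \<in> sets N" by simp
      have "emeasure (distr ?J N (\<lambda>y. y i)) A = (\<integral>\<^sup>+t. emeasure N A \<partial>P)"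
        unfolding distr_J[OF m2 A] by (intro nn_integral_cong) (simp add: marg_\<rho> i)
      then show "emeasure (distr ?J N (\<lambda>y. y i)) A = emeasure N A"
        by (simp add: P.emeasure_space_1)
    qed simp
  qed simp
qed

section \<open>Approximation by functions that are Lipschitz along the flow\<close>

context special_flow_space begin

sublocale N: prob_space N
  by (rule prob_space_N)

text \<open>Values in [0, 1] make a difference of products at most the sum of the differences of the
  factors. The Lipschitz constant serves all points and all times at once, since it is applied to
  displacements that depend on the point.\<close>

definition flow_lipschitz :: "('a \<times> real \<Rightarrow> real) \<Rightarrow> bool" where
  "flow_lipschitz b \<longleftrightarrow> b \<in> borel_measurable N \<and> (\<forall>y\<in>space N. 0 \<le> b y \<and> b y \<le> 1) \<and>
     (\<exists>K\<ge>0. \<forall>y\<in>space N. \<forall>t. \<bar>b (flow t y) - b y\<bar> \<le> K * \<bar>t\<bar>)"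

text \<open>This property is preserved by complements and countable unions, so it spreads from the
  generators of \<open>sets N\<close> to all its members.\<close>

definition flow_approximable :: "('a \<times> real) set \<Rightarrow> bool" where
  "flow_approximable A \<longleftrightarrow> A \<in> sets N \<and>
     (\<forall>e>0. \<exists>b. flow_lipschitz b \<and> (\<integral>y. \<bar>indicator A y - b y\<bar> \<partial>N) < e)"

lemma flow_lipschitz_measurable: "flow_lipschitz b \<Longrightarrow> b \<in> borel_measurable N"
  by (simp add: flow_lipschitz_def)

lemma flow_lipschitz_bounds: "flow_lipschitz b \<Longrightarrow> y \<in> space N \<Longrightarrow> 0 \<le> b y \<and> b y \<le> 1"
  by (simp add: flow_lipschitz_def)

lemma flow_lipschitz_diff_le:
  assumes "flow_lipschitz b" "y \<in> space N"
  shows "\<bar>indicator A y - b y\<bar> \<le> 1"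
  using flow_lipschitz_bounds[OF assms] by (cases "y \<in> A") auto

lemma integrable_flow_lipschitz_diff:
  assumes "flow_lipschitz b" "A \<in> sets N"
  shows "integrable N (\<lambda>y. \<bar>indicator A y - b y\<bar>)"
proof (rule N.integrable_const_bound[where B = 1])
  show "AE y in N. norm \<bar>indicator A y - b y\<bar> \<le> 1"
    using flow_lipschitz_diff_le[OF assms(1)] by (intro AE_I2) simp
  show "(\<lambda>y. \<bar>indicator A y - b y\<bar>) \<in> borel_measurable N"
    using assms flow_lipschitz_measurable by measurable
qed

lemma flow_approximable_compl:
  assumes "flow_approximable A"
  shows "flow_approximable (space N - A)"
  unfolding flow_approximable_def
proof (intro conjI allI impI)
  show "space N - A \<in> sets N" using assms by (auto simp: flow_approximable_def)
  fix e :: real assume "e > 0"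
  then obtain b where b: "flow_lipschitz b" and e: "(\<integral>y. \<bar>indicator A y - b y\<bar> \<partial>N) < e"
    using assms by (auto simp: flow_approximable_def)
  obtain K where K: "K \<ge> 0" "\<And>y t. y \<in> space N \<Longrightarrow> \<bar>b (flow t y) - b y\<bar> \<le> K * \<bar>t\<bar>"
    using b by (auto simp: flow_lipschitz_def)
  have "flow_lipschitz (\<lambda>y. 1 - b y)"
    using b K unfolding flow_lipschitz_def
    by (auto intro!: exI[of _ K] simp: abs_minus_commute)
  moreover have "(\<integral>y. \<bar>indicator (space N - A) y - (1 - b y)\<bar> \<partial>N) = (\<integral>y. \<bar>indicator A y - b y\<bar> \<partial>N)"
    by (intro Bochner_Integration.integral_cong) (auto simp: indicator_def)
  ultimately show "\<exists>b. flow_lipschitz b \<and> (\<integral>y. \<bar>indicator (space N - A) y - b y\<bar> \<partial>N) < e"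
    using e by force
qed

text \<open>The maximum of two approximants works: errors and Lipschitz constants both add, and the
  indicator of a union is the maximum of the indicators.\<close>

lemma flow_approximable_Un:
  assumes "flow_approximable A" "flow_approximable B"
  shows "flow_approximable (A \<union> B)"
  unfolding flow_approximable_def
proof (intro conjI allI impI)
  have sets: "A \<in> sets N" "B \<in> sets N" using assms by (auto simp: flow_approximable_def)
  then show "A \<union> B \<in> sets N" by simp
  fix e :: real assume "e > 0"
  then have e2: "e / 2 > 0" by simp
  obtain a where a: "flow_lipschitz a" and ea: "(\<integral>y. \<bar>indicator A y - a y\<bar> \<partial>N) < e / 2"
    using assms(1) e2 unfolding flow_approximable_def by blast
  obtain b where b: "flow_lipschitz b" and eb: "(\<integral>y. \<bar>indicator B y - b y\<bar> \<partial>N) < e / 2"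
    using assms(2) e2 unfolding flow_approximable_def by blast
  obtain K where K: "K \<ge> 0" "\<And>y t. y \<in> space N \<Longrightarrow> \<bar>a (flow t y) - a y\<bar> \<le> K * \<bar>t\<bar>"
    using a by (auto simp: flow_lipschitz_def)
  obtain L where L: "L \<ge> 0" "\<And>y t. y \<in> space N \<Longrightarrow> \<bar>b (flow t y) - b y\<bar> \<le> L * \<bar>t\<bar>"
    using b by (auto simp: flow_lipschitz_def)
  have max_diff: "\<bar>max p q - max r s\<bar> \<le> \<bar>p - r\<bar> + \<bar>q - s\<bar>" for p q r s :: real
    by (auto simp: max_def)
  have lip: "flow_lipschitz (\<lambda>y. max (a y) (b y))"
    unfolding flow_lipschitz_def
  proof (intro conjI ballI allI exI[of _ "K + L"])
    show "(\<lambda>y. max (a y) (b y)) \<in> borel_measurable N"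
      using a b flow_lipschitz_measurable by measurable
    fix y assume y: "y \<in> space N"
    show "0 \<le> max (a y) (b y)" "max (a y) (b y) \<le> 1"
      using flow_lipschitz_bounds[OF a y] flow_lipschitz_bounds[OF b y] by auto
    show "\<bar>max (a (flow t y)) (b (flow t y)) - max (a y) (b y)\<bar> \<le> (K + L) * \<bar>t\<bar>" for t
      using max_diff[of "a (flow t y)" "b (flow t y)" "a y" "b y"] K(2)[OF y, of t] L(2)[OF y, of t]
      by (simp add: algebra_simps)
  qed (use K L in simp)
  note int = integrable_flow_lipschitz_diff[OF a sets(1)] integrable_flow_lipschitz_diff[OF b sets(2)]
  have "(\<integral>y. \<bar>indicator (A \<union> B) y - max (a y) (b y)\<bar> \<partial>N) \<le>
        (\<integral>y. \<bar>indicator A y - a y\<bar> + \<bar>indicator B y - b y\<bar> \<partial>N)"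
  proof (rule integral_mono)
    show "integrable N (\<lambda>y. \<bar>indicator (A \<union> B) y - max (a y) (b y)\<bar>)"
      using sets by (intro integrable_flow_lipschitz_diff lip) auto
    show "integrable N (\<lambda>y. \<bar>indicator A y - a y\<bar> + \<bar>indicator B y - b y\<bar>)"
      using int by simp
    show "\<bar>indicator (A \<union> B) y - max (a y) (b y)\<bar> \<le> \<bar>indicator A y - a y\<bar> + \<bar>indicator B y - b y\<bar>" for y
      using max_diff[of "indicator A y" "indicator B y" "a y" "b y"]
      by (simp add: indicator_def max_def split: if_splits)
  qed
  also have "\<dots> < e" using int ea eb by simp
  finally show "\<exists>b. flow_lipschitz b \<and> (\<integral>y. \<bar>indicator (A \<union> B) y - b y\<bar> \<partial>N) < e"
    using lip by blast
qed

lemma flow_approximable_Int: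
  assumes "flow_approximable A" "flow_approximable B"
  shows "flow_approximable (A \<inter> B)"
proof -
  have "A \<subseteq> space N" "B \<subseteq> space N"
    using assms sets.sets_into_space by (auto simp: flow_approximable_def)
  then have "A \<inter> B = space N - ((space N - A) \<union> (space N - B))" by auto
  then show ?thesis
    using assms by (simp only: flow_approximable_compl flow_approximable_Un)
qed

lemma flow_approximable_empty: "flow_approximable {}"
  unfolding flow_approximable_def
  by (auto intro!: exI[of _ "\<lambda>_. 0"] exI[of _ "0::real"] simp: flow_lipschitz_def)

text \<open>Lipschitz constants may blow up along the sequence, so no limit of approximants is
  taken: a finite stage \<open>U n\<close> carries all but e/2 of the mass, and its approximant
  serves the whole union.\<close>

lemma flow_approximable_UN:
  fixes A :: "nat \<Rightarrow> _"
  assumes A: "\<And>i. flow_approximable (A i)"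
  shows "flow_approximable (\<Union>i. A i)"
  unfolding flow_approximable_def
proof (intro conjI allI impI)
  have [measurable]: "A i \<in> sets N" for i using A by (simp add: flow_approximable_def)
  show "(\<Union>i. A i) \<in> sets N" by measurable
  define U where "U n = (\<Union>i<n. A i)" for n
  have U: "flow_approximable (U n)" for n
  proof (induction n)
    case (Suc n)
    have "U (Suc n) = U n \<union> A n" by (auto simp: U_def less_Suc_eq)
    then show ?case using Suc A flow_approximable_Un by simp
  qed (simp add: U_def flow_approximable_empty)
  have [measurable]: "U n \<in> sets N" for n using U by (simp add: flow_approximable_def)
  fix e :: real assume "e > 0"
  then have e2: "e / 2 > 0" by simp
  have "(\<Union>n. U n) = (\<Union>i. A i)" by (auto simp: U_def)
  moreover have "incseq U" unfolding incseq_def U_def by force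
  ultimately have "(\<lambda>n. measure N (U n)) \<longlonglongrightarrow> measure N (\<Union>i. A i)"
    using N.finite_Lim_measure_incseq[of U] \<open>\<And>n. U n \<in> sets N\<close> by (simp add: image_subset_iff)
  then have "eventually (\<lambda>n. measure N (U n) > measure N (\<Union>i. A i) - e / 2) sequentially"
    by (rule order_tendstoD) (use e2 in simp)
  then obtain n where "measure N (U n) > measure N (\<Union>i. A i) - e / 2"
    by (auto simp: eventually_sequentially)
  moreover have "measure N ((\<Union>i. A i) - U n) = measure N (\<Union>i. A i) - measure N (U n)"
    by (rule N.finite_measure_Diff) (auto simp: U_def)
  ultimately have n: "measure N ((\<Union>i. A i) - U n) < e / 2" by simp
  obtain b where b: "flow_lipschitz b" and eb: "(\<integral>y. \<bar>indicator (U n) y - b y\<bar> \<partial>N) < e / 2"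
    using U[of n] e2 unfolding flow_approximable_def by blast
  have int: "integrable N (\<lambda>y. \<bar>indicator (U n) y - b y\<bar>)"
    by (rule integrable_flow_lipschitz_diff[OF b]) simp
  have "(\<integral>y. \<bar>indicator (\<Union>i. A i) y - b y\<bar> \<partial>N) \<le>
        (\<integral>y. indicator ((\<Union>i. A i) - U n) y + \<bar>indicator (U n) y - b y\<bar> \<partial>N)"
  proof (rule integral_mono)
    show "integrable N (\<lambda>y. \<bar>indicator (\<Union>i. A i) y - b y\<bar>)"
      by (intro integrable_flow_lipschitz_diff b) simp
    show "integrable N (\<lambda>y. indicator ((\<Union>i. A i) - U n) y + \<bar>indicator (U n) y - b y\<bar>)"
      by (intro Bochner_Integration.integrable_add int integrable_real_indicator)
         (auto simp: less_top[symmetric])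
    show "\<bar>indicator (\<Union>i. A i) y - b y\<bar> \<le>
      indicator ((\<Union>i. A i) - U n) y + \<bar>indicator (U n) y - b y\<bar>" for y
      by (auto simp: indicator_def U_def)
  qed
  also have "\<dots> = measure N ((\<Union>i. A i) - U n) + (\<integral>y. \<bar>indicator (U n) y - b y\<bar> \<partial>N)"
    by (subst Bochner_Integration.integral_add) (auto intro!: int simp: less_top[symmetric])
  also have "\<dots> < e" using n eb by simp
  finally show "\<exists>b. flow_lipschitz b \<and> (\<integral>y. \<bar>indicator (\<Union>i. A i) y - b y\<bar> \<partial>N) < e"
    using b by blast
qed

text \<open>A tent over the base, of slope \<open>m\<close> along the fibers, vanishes on the floor and on the roof
  and is therefore Lipschitz along the flow also across the identification of roof and floor.\<close>

lemma flow_lipschitz_tent: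
  assumes a [measurable]: "a \<in> sets M" and m: "m \<ge> 0"
  shows "flow_lipschitz (\<lambda>(x, r). indicator a x * max 0 (min 1 (m * min (r - p) (min r (f x - r)))))"
proof -
  \<comment> \<open>Distances to the level \<open>p\<close>, to the floor and to the roof. The
    middle term keeps the tent zero on the floor when \<open>p\<close> is negative.\<close>
  define h where "h x r = min (r - p) (min r (f x - r))" for x r
  define b where "b = (\<lambda>(x, r). indicator a x * max 0 (min 1 (m * h x r)) :: real)"
  have fwd: "\<bar>b (flow t y) - b y\<bar> \<le> m * t" if y: "y \<in> space N" and t: "t \<ge> 0" for t y
  proof -
    obtain x r where y: "y = (x, r)" and x: "x \<in> space M" and r: "0 \<le> r" "r < f x"
      using y by (auto simp: space_N)
    have mt: "0 \<le> m * t" using m t by simp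
    show ?thesis
    proof (cases "x \<in> good")
      case False
      then show ?thesis using x y mt by (simp add: flow_eq)
    next
      case True
      define n where "n = floor_index x (r + t)"
      have n: "csum f n x \<le> r + t" "r + t < csum f (n + 1) x"
        using floor_index[OF True, of "r + t"] by (simp_all add: n_def)
      have fl: "flow t y = (iter n x, r + t - csum f n x)"
        using True x by (simp add: y flow_eq base_flow_def n_def)
      have n0: "n \<ge> 0"
        using csum_roof_le[OF x, of "n + 1" 0] n r t by (cases "n < 0") auto
      show ?thesis
      proof (cases "n = 0")
        case True
        have "\<bar>h x (r + t) - h x r\<bar> \<le> t"
          using t unfolding h_def by (auto simp: min_def)
        then have "\<bar>m * h x (r + t) - m * h x r\<bar> \<le> m * t"
          using m by (simp add: abs_mult mult_left_mono flip: right_diff_distrib)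
        then have "\<bar>max 0 (min 1 (m * h x (r + t))) - max 0 (min 1 (m * h x r))\<bar> \<le> m * t"
          using mt by (auto simp: max_def min_def)
        then show ?thesis
          using True mt unfolding fl unfolding y b_def by (simp add: indicator_def)
      next
        case False
        have "csum f 1 x \<le> csum f n x" using n0 False by (intro csum_roof_le x) auto
        then have fx: "f x \<le> csum f n x" using csum_Suc[of f 0 x] by simp
        have le: "max 0 (min 1 (m * h z s)) \<le> m * t" if "h z s \<le> t" for z s
        proof -
          have "m * h z s \<le> m * t" using that m by (rule mult_left_mono)
          then show ?thesis using mt by auto
        qed
        \<comment> \<open>At least one roof was crossed within time \<open>t\<close>: the start lies
          within \<open>t\<close> of its roof and the end within \<open>t\<close> of its floor, so
          both tent values are at most \<open>m * t\<close>.\<close>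
        have "h x r \<le> t" using fx n by (simp add: h_def)
        moreover have "h (iter n x) (r + t - csum f n x) \<le> t" using fx r by (simp add: h_def)
        ultimately have "b y \<le> m * t" "b (flow t y) \<le> m * t"
          using le mt unfolding fl unfolding y b_def by (auto simp: indicator_def)
        moreover have "0 \<le> b z" for z by (auto simp: b_def split_beta)
        ultimately show ?thesis by (smt (verit, best))
      qed
    qed
  qed
  have "flow_lipschitz b"
    unfolding flow_lipschitz_def
  proof (intro conjI ballI allI exI[of _ m] m)
    show "b \<in> borel_measurable N" unfolding b_def h_def split_beta by measurable
    fix y assume y: "y \<in> space N"
    show "0 \<le> b y" "b y \<le> 1" by (auto simp: b_def split_beta indicator_def)
    fix t
    show "\<bar>b (flow t y) - b y\<bar> \<le> m * \<bar>t\<bar>"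
    proof (cases "t \<ge> 0")
      case True
      then show ?thesis using fwd[OF y] by simp
    next
      \<comment> \<open>A negative time is the reverse of a positive one, so the forward bound is
        applied at the end point \<open>flow t y\<close>.\<close>
      case False
      then show ?thesis
        using fwd[OF flow_in_N[OF y], of "-t" t] flow_add[OF y, of "-t" t] flow_0[OF y]
        by (simp add: abs_minus_commute)
    qed
  qed
  then show ?thesis by (simp add: b_def h_def)
qed

text \<open>On the floor all tents vanish, even when the set to be approximated contains it
  (\<open>p < 0\<close>); the floor is therefore discarded as a null set.\<close>

lemma AE_N_not_floor: "AE y in N. snd y \<noteq> 0"
proof -
  have "emeasure N {y \<in> space N. snd y = 0} =
      (\<integral>\<^sup>+y. indicator {y \<in> space N. snd y = 0} y \<partial>N)"
    by simp
  also have "\<dots> = (\<integral>\<^sup>+y. indicator {0} (snd y) \<partial>N)"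
    by (intro nn_integral_cong) (simp add: indicator_def)
  also have "\<dots> = (\<integral>\<^sup>+x. \<integral>\<^sup>+r. indicator {0} r * indicator {0..<f x} r \<partial>lborel \<partial>M)"
    by (subst nn_integral_N) auto
  also have "\<dots> = (\<integral>\<^sup>+x. \<integral>\<^sup>+r. indicator {0} (r :: real) \<partial>lborel \<partial>M)"
  proof (rule nn_integral_cong)
    fix x assume "x \<in> space M"
    then have "indicator {0} r * indicator {0..<f x} r = (indicator {0} r :: ennreal)" for r :: real
      using roof_pos by (auto simp: indicator_def)
    then show "(\<integral>\<^sup>+r. indicator {0} r * indicator {0..<f x} r \<partial>lborel) =
        (\<integral>\<^sup>+r. indicator {0} (r :: real) \<partial>lborel)"
      by simp
  qed
  also have "\<dots> = 0" by simp
  finally show ?thesis by (intro AE_I[OF _ _ _]) auto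
qed

text \<open>At a point of the set off the floor the tent equals 1 once its slope exceeds the
  reciprocal of the distance \<open>h\<close>; outside the set it is 0 for every slope. Dominated
  convergence turns this into an L^1 statement.\<close>

lemma flow_approximable_rectangle:
  assumes a [measurable]: "a \<in> sets M"
  shows "flow_approximable {y \<in> space N. fst y \<in> a \<and> p < snd y}"
  unfolding flow_approximable_def
proof (intro conjI allI impI)
  let ?A = "{y \<in> space N. fst y \<in> a \<and> p < snd y}"
  show A [measurable]: "?A \<in> sets N" by measurable
  define b where "b m = (\<lambda>(x, r). indicator a x * max 0 (min 1 (real m * min (r - p) (min r (f x - r)))))"
    for m :: nat
  have b: "flow_lipschitz (b m)" for m
    unfolding b_def by (rule flow_lipschitz_tent) auto
  have lim: "(\<lambda>m. \<integral>y. \<bar>indicator ?A y - b m y\<bar> \<partial>N) \<longlonglongrightarrow> (\<integral>y. 0 \<partial>N)"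
  proof (rule integral_dominated_convergence[where w = "\<lambda>_. 1"])
    show "(\<lambda>y. \<bar>indicator ?A y - b m y\<bar>) \<in> borel_measurable N" for m
      using flow_lipschitz_measurable[OF b[of m]] by measurable
    show "AE y in N. norm \<bar>indicator ?A y - b m y\<bar> \<le> 1" for m
      using flow_lipschitz_diff_le[OF b] by (intro AE_I2) simp
    have pointwise: "(\<lambda>m. \<bar>indicator ?A y - b m y\<bar>) \<longlonglongrightarrow> 0" if "y \<in> space N" "snd y \<noteq> 0" for y
    proof -
      obtain x r where y: "y = (x, r)" by (cases y)
      with that have x: "x \<in> space M" and r: "0 < r" "r < f x"
        by (auto simp: space_N)
      define h where "h = min (r - p) (min r (f x - r))"
      show ?thesis
      proof (cases "x \<in> a \<and> p < r")
        case True
        then have "h > 0" using r by (simp add: h_def)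
        then obtain m0 :: nat where m0: "real m0 * h > 1"
          using reals_Archimedean3 by blast
        have "\<bar>indicator ?A y - b m y\<bar> = 0" if "m \<ge> m0" for m
        proof -
          have "real m0 * h \<le> real m * h" using that \<open>h > 0\<close> by simp
          then have "real m * h > 1" using m0 by simp
          then show ?thesis using True that y x r by (simp add: b_def space_N h_def)
        qed
        then show ?thesis
          by (intro tendsto_eventually) (auto simp: eventually_sequentially)
      next
        case False
        have "b m y = 0" for m
        proof (cases "x \<in> a")
          case True
          with False have "h \<le> 0" by (simp add: h_def)
          then have "real m * h \<le> 0" by (simp add: mult_nonneg_nonpos)
          then show ?thesis by (simp add: b_def y h_def)
        qed (simp add: b_def y)
        then show ?thesis using False y by (auto simp: indicator_def)
      qed
    qed
    show "AE y in N. (\<lambda>m. \<bar>indicator ?A y - b m y\<bar>) \<longlonglongrightarrow> 0"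
      by (rule AE_mp[OF AE_N_not_floor], rule AE_I2, rule impI, rule pointwise)
  qed auto
  fix e :: real assume "e > 0"
  with lim have "eventually (\<lambda>m. (\<integral>y. \<bar>indicator ?A y - b m y\<bar> \<partial>N) < e) sequentially"
    by (intro order_tendstoD(2)[OF lim]) simp
  then show "\<exists>b. flow_lipschitz b \<and> (\<integral>y. \<bar>indicator ?A y - b y\<bar> \<partial>N) < e"
    using b by (auto simp: eventually_sequentially)
qed

lemma flow_approximable_fiber_set:
  assumes "b \<in> sets borel"
  shows "flow_approximable {y \<in> space N. snd y \<in> b}"
proof -
  have "b \<in> sigma_sets UNIV (range greaterThan)"
    using assms unfolding borel_Ioi by simp
  then show ?thesis
  proof induction
    case (Basic b)
    then obtain p where "b = {p<..}" by auto
    then have "{y \<in> space N. snd y \<in> b} = {y \<in> space N. fst y \<in> space M \<and> p < snd y}"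
      by (auto simp: space_N)
    then show ?case using flow_approximable_rectangle[OF sets.top] by simp
  next
    case Empty
    then show ?case using flow_approximable_empty by simp
  next
    case (Compl b)
    have "{y \<in> space N. snd y \<in> UNIV - b} = space N - {y \<in> space N. snd y \<in> b}" by auto
    then show ?case using flow_approximable_compl[OF Compl.IH] by simp
  next
    case (Union b)
    have "{y \<in> space N. snd y \<in> (\<Union>i. b i)} = (\<Union>i. {y \<in> space N. snd y \<in> b i})" by auto
    then show ?case using flow_approximable_UN[OF Union.IH] by simp
  qed
qed

lemma flow_approximable_sets:
  assumes A: "A \<in> sets N"
  shows "flow_approximable A"
proof -
  have "A \<in> sets (M \<Otimes>\<^sub>M lborel)" "A \<subseteq> space N" using A by (simp_all add: sets_N_iff)
  then have "A \<in> sigma_sets (space M \<times> space lborel) {a \<times> b |a b. a \<in> sets M \<and> b \<in> sets lborel}"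
    by (simp add: sets_pair_measure)
  then have "flow_approximable (space N \<inter> A)"
  proof induction
    case (Basic A)
    then obtain a b where ab: "A = a \<times> b" "a \<in> sets M" "b \<in> sets borel" by auto
    \<comment> \<open>Heights are nonnegative, so the condition \<open>-1 < snd y\<close> is void
      and the first factor is the full cylinder over \<open>a\<close>.\<close>
    have "space N \<inter> A = {y \<in> space N. fst y \<in> a \<and> -1 < snd y} \<inter> {y \<in> space N. snd y \<in> b}"
      by (auto simp: ab(1) space_N)
    then show ?case
      using flow_approximable_Int flow_approximable_rectangle[OF ab(2)]
        flow_approximable_fiber_set[OF ab(3)] by simp
  next
    case Empty
    then show ?case using flow_approximable_empty by simp
  next
    case (Compl A)
    have "space N \<inter> (space M \<times> space lborel - A) = space N - (space N \<inter> A)"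
      by (auto simp: space_N)
    then show ?case using flow_approximable_compl[OF Compl.IH] by simp
  next
    case (Union A)
    then show ?case using flow_approximable_UN[OF Union.IH] by simp
  qed
  then show ?thesis using \<open>A \<subseteq> space N\<close> by (simp add: Int_absorb1)
qed

end

section \<open>Ergodic averages and rigidity in \<open>L\<^sup>1\<close>\<close>

context automorphism_space begin

section \<open>Maximal inequality and pointwise ergodic theorem\<close>

lemma csum_nat_Suc:
  "x \<in> space M \<Longrightarrow> csum g (int (Suc n)) x = g x + csum g (int n) (T x)"
  using csum_add[of x g "int n" 1] csum_Suc[of g 0 x] iter_Suc[of x 0] by (simp add: add.commute)

text \<open>Garsia's proof of the maximal ergodic theorem: \<open>partial_max\<close> is the maximum of the first
  ergodic sums, and it is dominated by \<open>g\<close> plus its own translate wherever it is positive.\<close>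

primrec partial_max :: "('a \<Rightarrow> real) \<Rightarrow> nat \<Rightarrow> 'a \<Rightarrow> real" where
  "partial_max g 0 x = 0"
| "partial_max g (Suc n) x = max 0 (g x + partial_max g n (T x))"

lemma partial_max_nonneg: "0 \<le> partial_max g n x"
  by (cases n) auto

lemma partial_max_mono: "x \<in> space M \<Longrightarrow> partial_max g n x \<le> partial_max g (Suc n) x"
proof (induction n arbitrary: x)
  case (Suc n)
  have "partial_max g n (T x) \<le> partial_max g (Suc n) (T x)"
    by (rule Suc.IH) (use Suc.prems T_inverse in auto)
  then show ?case by auto
qed simp

lemma csum_le_partial_max: "x \<in> space M \<Longrightarrow> k \<le> n \<Longrightarrow> csum g (int k) x \<le> partial_max g n x"
proof (induction n arbitrary: x k)
  case (Suc n)
  show ?case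
  proof (cases k)
    case (Suc j)
    have "csum g (int j) (T x) \<le> partial_max g n (T x)"
      by (rule Suc.IH) (use Suc.prems \<open>k = Suc j\<close> T_inverse in auto)
    then show ?thesis
      using csum_nat_Suc[OF Suc.prems(1), of g j] \<open>k = Suc j\<close> by simp
  qed (simp add: partial_max_nonneg)
qed simp

lemma integrable_partial_max:
  assumes "integrable M g"
  shows "integrable M (partial_max g n)"
proof (induction n)
  case (Suc n)
  have "integrable M (\<lambda>x. partial_max g n (T x))"
    using integrable_iter[OF Suc, of 1] iter_of_nat[of 1] by simp
  then show ?case using assms by simp
qed simp

text \<open>The difference of \<open>partial_max g n\<close> and its translate integrates to 0 by
  invariance and lies below the integrand: on the positive set by the recursion and monotonicity in
  \<open>n\<close>, elsewhere because the first term is 0 and the second is nonnegative.\<close>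

lemma maximal_ergodic:
  assumes g: "integrable M g"
  shows "0 \<le> (\<integral>x. g x * indicator {x. 0 < partial_max g n x} x \<partial>M)"
proof -
  have [measurable]: "g \<in> borel_measurable M" using g by simp
  note int = integrable_partial_max[OF g, of n]
  have [measurable]: "partial_max g n \<in> borel_measurable M" using int by simp
  have intT: "integrable M (\<lambda>x. partial_max g n (T x))"
    using integrable_iter[OF int, of 1] iter_of_nat[of 1] by simp
  have "(\<integral>x. partial_max g n x - partial_max g n (T x) \<partial>M) = 0"
    using int intT integral_iter[of "partial_max g n" 1] iter_of_nat[of 1] by simp
  moreover have "(\<integral>x. partial_max g n x - partial_max g n (T x) \<partial>M) \<le>
      (\<integral>x. g x * indicator {x. 0 < partial_max g n x} x \<partial>M)"
  proof (rule integral_mono)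
    show "integrable M (\<lambda>x. partial_max g n x - partial_max g n (T x))"
      using int intT by simp
    show "integrable M (\<lambda>x. g x * indicator {x. 0 < partial_max g n x} x)"
      by (rule Bochner_Integration.integrable_bound[OF g]) (auto simp: indicator_def)
    fix x assume x: "x \<in> space M"
    show "partial_max g n x - partial_max g n (T x) \<le> g x * indicator {x. 0 < partial_max g n x} x"
    proof (cases "0 < partial_max g n x")
      case True
      then obtain m where m: "n = Suc m" by (cases n) auto
      have "partial_max g m (T x) \<le> partial_max g n (T x)"
        unfolding m by (rule partial_max_mono) (use x T_inverse in auto)
      then show ?thesis using True by (simp add: m max_def split: if_splits)
    next
      case False
      then show ?thesis using partial_max_nonneg[of g n "T x"] by simp
    qed
  qed
  ultimately show ?thesis by simp
qed

text \<open>The sets on which \<open>partial_max g n\<close> is positive exhaust almost all of the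
  space, so the maximal inequality passes to the limit, dominated by \<bar>g\<bar>.\<close>

lemma integral_nonneg_if_csum_pos:
  assumes g: "integrable M g" and pos: "AE x in M. \<exists>n::nat. 0 < csum g (int n) x"
  shows "0 \<le> (\<integral>x. g x \<partial>M)"
proof (rule LIMSEQ_le_const)
  have [measurable]: "g \<in> borel_measurable M" using g by simp
  have [measurable]: "partial_max g n \<in> borel_measurable M" for n
    using integrable_partial_max[OF g] by simp
  show "(\<lambda>n. \<integral>x. g x * indicator {x. 0 < partial_max g n x} x \<partial>M) \<longlonglongrightarrow> (\<integral>x. g x \<partial>M)"
  proof (rule integral_dominated_convergence[where w = "\<lambda>x. \<bar>g x\<bar>"])
    have pointwise: "(\<lambda>n. g x * indicator {x. 0 < partial_max g n x} x) \<longlonglongrightarrow> g x"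
      if x: "x \<in> space M" and ex: "\<exists>n::nat. 0 < csum g (int n) x" for x
    proof -
      obtain k :: nat where "0 < csum g (int k) x" using ex by blast
      then have "g x * indicator {x. 0 < partial_max g n x} x = g x" if "n \<ge> k" for n
        using csum_le_partial_max[OF x that, of g] by simp
      then show ?thesis
        by (intro tendsto_eventually) (auto simp: eventually_sequentially)
    qed
    show "AE x in M. (\<lambda>n. g x * indicator {x. 0 < partial_max g n x} x) \<longlonglongrightarrow> g x"
      by (rule AE_mp[OF pos], rule AE_I2, rule impI, rule pointwise)
  qed (use g in \<open>auto simp: indicator_def\<close>)
  show "\<exists>N. \<forall>n\<ge>N. 0 \<le> (\<integral>x. g x * indicator {x. 0 < partial_max g n x} x \<partial>M)"
    using maximal_ergodic[OF g] by blast
qed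

text \<open>The set \<open>E\<close> of unbounded sums is invariant, hence null or of full measure.
  In the second case some sum is positive almost everywhere, which would force a nonnegative
  integral.\<close>

lemma csum_bounded_above:
  assumes erg: "ergodic M T" and g: "integrable M g" and neg: "(\<integral>x. g x \<partial>M) < 0"
  shows "AE x in M. \<exists>b::nat. \<forall>n::nat. csum g (int n) x \<le> real b"
proof -
  have [measurable]: "g \<in> borel_measurable M" using g by simp
  define E where "E = {x \<in> space M. \<forall>b::nat. \<exists>n::nat. real b < csum g (int n) x}"
  have E [measurable]: "E \<in> sets M" unfolding E_def by measurable
  have "T x \<in> E \<longleftrightarrow> x \<in> E" if x: "x \<in> space M" for x
  proof -
    obtain c :: nat where c: "\<bar>g x\<bar> < real c" using reals_Archimedean2 by blast
    show ?thesis
    proof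
      assume T: "T x \<in> E"
      have "\<exists>n::nat. real b < csum g (int n) x" for b
      proof -
        obtain n :: nat where "real (b + c) < csum g (int n) (T x)" using T unfolding E_def by blast
        then show ?thesis
          using csum_nat_Suc[OF x, of g n] c by (intro exI[of _ "Suc n"]) simp
      qed
      then show "x \<in> E" using x by (simp add: E_def)
    next
      assume E: "x \<in> E"
      have "\<exists>n::nat. real b < csum g (int n) (T x)" for b
      proof -
        obtain n :: nat where n: "real (b + c) < csum g (int n) x" using E unfolding E_def by blast
        then obtain m where "n = Suc m" by (cases n) auto
        then show ?thesis
          using csum_nat_Suc[OF x, of g m] c n by (intro exI[of _ m]) simp
      qed
      then show "T x \<in> E" using T_inverse(1)[OF x] by (simp add: E_def)
    qed
  qed
  then have "T -` E \<inter> space M = E" by (auto simp: E_def)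
  then have "prob E = 0 \<or> prob E = 1" using erg by (simp add: ergodic_def)
  moreover have "prob E \<noteq> 1"
  proof
    assume "prob E = 1"
    then have "AE x in M. x \<in> E" by (simp add: prob_eq_1)
    then have "AE x in M. \<exists>n::nat. 0 < csum g (int n) x"
    proof (rule AE_mp, intro AE_I2 impI)
      fix x assume "x \<in> E"
      then have "\<exists>n::nat. real 0 < csum g (int n) x" unfolding E_def by blast
      then show "\<exists>n::nat. 0 < csum g (int n) x" by simp
    qed
    from integral_nonneg_if_csum_pos[OF g this] neg show False by simp
  qed
  ultimately have "AE x in M. x \<notin> E" by (simp add: prob_eq_0)
  then show ?thesis by (rule AE_mp) (auto intro!: AE_I2 simp: E_def not_less)
qed

text \<open>Subtracting \<open>a\<close> makes the integral negative, and the sums of the shifted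
  function are then bounded above.\<close>

lemma csum_average_bound:
  assumes erg: "ergodic M T" and g: "integrable M g" and a: "(\<integral>x. g x \<partial>M) < a"
  shows "AE x in M. \<exists>b::nat. \<forall>n::nat. csum g (int n) x \<le> a * real n + real b"
proof -
  have "AE x in M. \<exists>b::nat. \<forall>n::nat. csum (\<lambda>x. g x - a) (int n) x \<le> real b"
    by (rule csum_bounded_above[OF erg]) (use g a in \<open>auto simp: prob_space\<close>)
  then show ?thesis by (simp add: csum_const_diff algebra_simps)
qed

lemma csum_uminus: "csum (\<lambda>x. - g x) k x = - csum g k x"
  by (simp add: cocycle_sum_def sum_negf)

text \<open>The one-sided linear bound for \<open>g\<close> and for \<open>- g\<close> gives both
  inequalities. It is taken with slack 1/(k + 1) for all k on a single set of full measure, and the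
  additive constants vanish after division by \<open>n\<close>.\<close>

lemma birkhoff_AE:
  assumes erg: "ergodic M T" and g: "integrable M g"
  shows "AE x in M. (\<lambda>n. csum g (int n) x / real n) \<longlonglongrightarrow> (\<integral>x. g x \<partial>M)"
proof -
  let ?I = "\<integral>x. g x \<partial>M"
  have "AE x in M. \<forall>k::nat. \<exists>b::nat. \<forall>n::nat. csum g (int n) x \<le> (?I + inverse (real (Suc k))) * real n + real b"
    unfolding AE_all_countable by (intro allI csum_average_bound erg g) simp
  moreover have "AE x in M. \<forall>k::nat. \<exists>b::nat. \<forall>n::nat.
      csum (\<lambda>x. - g x) (int n) x \<le> (- ?I + inverse (real (Suc k))) * real n + real b"
    unfolding AE_all_countable
    by (intro allI csum_average_bound erg Bochner_Integration.integrable_minus g) simp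
  ultimately show ?thesis
  proof eventually_elim
    case (elim x)
    show ?case
    proof (rule LIMSEQ_I)
      fix e :: real assume e: "e > 0"
      then obtain k where k: "inverse (real (Suc k)) < e / 2"
        using reals_Archimedean[of "e / 2"] by auto
      obtain b1 :: nat where b1: "\<And>n::nat. csum g (int n) x \<le> (?I + inverse (real (Suc k))) * real n + real b1"
        using elim(1) by blast
      obtain b2 :: nat where b2: "\<And>n::nat. - csum g (int n) x \<le> (- ?I + inverse (real (Suc k))) * real n + real b2"
        using elim(2) unfolding csum_uminus by blast
      obtain n0 :: nat where n0: "real b1 + real b2 < real n0 * (e / 2)"
        using reals_Archimedean3[of "e / 2"] e by (meson half_gt_zero)
      have "norm (csum g (int n) x / real n - ?I) < e" if n: "n \<ge> Suc n0" for n
      proof -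
        have npos: "real n > 0" using n by simp
        have "real n0 * (e / 2) \<le> real n * (e / 2)" using n e by (intro mult_right_mono) auto
        then have b: "real b1 + real b2 < real n * (e / 2)" using n0 by simp
        have kn: "inverse (real (Suc k)) * real n < e / 2 * real n"
          using k npos by (rule mult_strict_right_mono)
        have "csum g (int n) x - ?I * real n < e * real n"
          using b1[of n] b kn by (simp add: algebra_simps)
        moreover have "- (e * real n) < csum g (int n) x - ?I * real n"
          using b2[of n] b kn by (simp add: algebra_simps)
        ultimately have "\<bar>csum g (int n) x - ?I * real n\<bar> < e * real n" by linarith
        then have "\<bar>csum g (int n) x - ?I * real n\<bar> / real n < e"
          using npos by (simp add: field_simps)
        moreover have "csum g (int n) x / real n - ?I = (csum g (int n) x - ?I * real n) / real n"
          using npos by (simp add: field_simps)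
        ultimately show ?thesis using npos by (simp add: abs_divide)
      qed
      then show "\<exists>no. \<forall>n\<ge>no. norm (csum g (int n) x / real n - ?I) < e" by blast
    qed
  qed
qed

lemma birkhoff_L1:
  assumes erg: "ergodic M T" and [measurable]: "g \<in> borel_measurable M"
    and B: "\<And>x. x \<in> space M \<Longrightarrow> \<bar>g x\<bar> \<le> B"
  shows "(\<lambda>n. \<integral>x. \<bar>csum g (int n) x / real n - (\<integral>x. g x \<partial>M)\<bar> \<partial>M) \<longlonglongrightarrow> 0"
proof -
  have g: "integrable M g"
    by (rule integrable_const_bound[where B = B]) (use B in \<open>auto intro!: AE_I2\<close>)
  have B0: "0 \<le> B" using B not_empty by fastforce
  have avg: "\<bar>csum g (int n) x / real n\<bar> \<le> B" if "x \<in> space M" for x n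
  proof -
    have "\<bar>csum g (int n) x\<bar> \<le> (\<Sum>j<n. \<bar>g ((T ^^ j) x)\<bar>)" unfolding csum_of_nat by (rule sum_abs)
    also have "\<dots> \<le> (\<Sum>j<n. B)"
      using iter_in_space[OF that] by (intro sum_mono B) (simp flip: iter_of_nat)
    \<comment> \<open>For \<open>n = 0\<close> the quotient is 0 by the convention on division, so
      the bound survives.\<close>
    finally show ?thesis using B0 by (cases "n = 0") (simp_all add: field_simps)
  qed
  let ?I = "\<integral>x. g x \<partial>M"
  have "(\<lambda>n. \<integral>x. \<bar>csum g (int n) x / real n - ?I\<bar> \<partial>M) \<longlonglongrightarrow> (\<integral>x. 0 \<partial>M)"
  proof (rule integral_dominated_convergence[where w = "\<lambda>x. B + \<bar>?I\<bar>"])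
    show "AE x in M. (\<lambda>n. \<bar>csum g (int n) x / real n - ?I\<bar>) \<longlonglongrightarrow> 0"
      using birkhoff_AE[OF erg g]
    proof eventually_elim
      case (elim x)
      then have "(\<lambda>n. \<bar>csum g (int n) x / real n - ?I\<bar>) \<longlonglongrightarrow> \<bar>?I - ?I\<bar>"
        by (intro tendsto_intros)
      then show ?case by simp
    qed
    have "\<bar>csum g (int n) x / real n - ?I\<bar> \<le> B + \<bar>?I\<bar>" if "x \<in> space M" for x n
      using avg[OF that, of n] by linarith
    then show "AE x in M. norm \<bar>csum g (int n) x / real n - ?I\<bar> \<le> B + \<bar>?I\<bar>" for n
      by (intro AE_I2) simp
  qed auto
  then show ?thesis by simp
qed

text \<open>Rigidity on sets is the case of indicators. It extends to all integrable functions
  because composition with an iterate preserves the L^1 distance, so the error of an approximation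
  does not depend on \<open>n\<close>.\<close>

lemma rigidity_L1:
  fixes g :: "'a \<Rightarrow> real"
  assumes q: "rigidity_sequence M T q" and g: "integrable M g"
  shows "(\<lambda>n. \<integral>x. \<bar>g (iter (q n) x) - g x\<bar> \<partial>M) \<longlonglongrightarrow> 0"
  using g
proof (induction rule: integrable_induct)
  case (base A c)
  note [measurable] = base(1)
  have "(\<integral>x. \<bar>indicator A (iter (q n) x) *\<^sub>R c - indicator A x *\<^sub>R c\<bar> \<partial>M) =
        \<bar>c\<bar> * prob (sym_diff (iter (q n) ` A) A)" for n
  proof -
    have A: "A \<subseteq> space M" using base(1) by (rule sets.sets_into_space)
    have im: "iter k ` A = iter (- k) -` A \<inter> space M" for k
    proof (intro subset_antisym subsetI)
      fix x assume "x \<in> iter k ` A"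
      then show "x \<in> iter (- k) -` A \<inter> space M" using A iter_minus iter_in_space by auto
    next
      fix x assume "x \<in> iter (- k) -` A \<inter> space M"
      then have "x = iter k (iter (- k) x)" "iter (- k) x \<in> A" using iter_minus by auto
      then show "x \<in> iter k ` A" by blast
    qed
    have [measurable]: "iter k ` A \<in> sets M" for k unfolding im by measurable
    have "prob (sym_diff (iter (q n) ` A) A) = (\<integral>x. indicator (sym_diff (iter (q n) ` A) A) x \<partial>M)"
      using A by (simp add: Int_absorb1 im)
    \<comment> \<open>Rigidity is stated with the image of \<open>A\<close>. Evaluating at
      \<open>iter (q n) x\<close> turns membership in the image into membership of x in
      \<open>A\<close>.\<close>
    also have "\<dots> = (\<integral>x. indicator (sym_diff (iter (q n) ` A) A) (iter (q n) x) \<partial>M)"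
      by (rule integral_iter[symmetric]) measurable
    also have "\<bar>c\<bar> * \<dots> = (\<integral>x. \<bar>c\<bar> * indicator (sym_diff (iter (q n) ` A) A) (iter (q n) x) \<partial>M)"
      by simp
    also have "\<dots> = (\<integral>x. \<bar>indicator A (iter (q n) x) *\<^sub>R c - indicator A x *\<^sub>R c\<bar> \<partial>M)"
    proof (intro Bochner_Integration.integral_cong refl)
      fix x assume x: "x \<in> space M"
      have "iter (q n) x \<in> iter (q n) ` A \<longleftrightarrow> x \<in> A"
        using x iter_minus(1)[OF x, of "q n"] iter_in_space[OF x] by (simp add: im)
      then show "\<bar>c\<bar> * indicator (sym_diff (iter (q n) ` A) A) (iter (q n) x) =
          \<bar>indicator A (iter (q n) x) *\<^sub>R c - indicator A x *\<^sub>R c\<bar>"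
        by (auto simp: indicator_def)
    qed
    finally show ?thesis by simp
  qed
  moreover have "(\<lambda>n. \<bar>c\<bar> * prob (sym_diff (iter (q n) ` A) A)) \<longlonglongrightarrow> \<bar>c\<bar> * 0"
    using q base(1) by (intro tendsto_mult_left) (simp add: rigidity_sequence_def)
  ultimately show ?case by simp
next
  case (add u v)
  have "(\<lambda>n. (\<integral>x. \<bar>u (iter (q n) x) - u x\<bar> \<partial>M) + (\<integral>x. \<bar>v (iter (q n) x) - v x\<bar> \<partial>M)) \<longlonglongrightarrow> 0"
    using tendsto_add[OF add.IH] by simp
  then show ?case
  proof (rule Lim_null_comparison[rotated], intro eventuallyI always_eventually allI)
    fix n
    note int = integrable_iter[OF add(1), of "q n"] integrable_iter[OF add(2), of "q n"] add(1,2)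
    have "(\<integral>x. \<bar>u (iter (q n) x) + v (iter (q n) x) - (u x + v x)\<bar> \<partial>M) \<le>
      (\<integral>x. \<bar>u (iter (q n) x) - u x\<bar> + \<bar>v (iter (q n) x) - v x\<bar> \<partial>M)"
      using int by (intro integral_mono) auto
    also have "\<dots> = (\<integral>x. \<bar>u (iter (q n) x) - u x\<bar> \<partial>M) + (\<integral>x. \<bar>v (iter (q n) x) - v x\<bar> \<partial>M)"
      using int by (intro Bochner_Integration.integral_add) auto
    finally show "norm (\<integral>x. \<bar>u (iter (q n) x) + v (iter (q n) x) - (u x + v x)\<bar> \<partial>M) \<le>
       (\<integral>x. \<bar>u (iter (q n) x) - u x\<bar> \<partial>M) + (\<integral>x. \<bar>v (iter (q n) x) - v x\<bar> \<partial>M)"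
      by simp
  qed
next
  case (lim h s)
  have "(\<lambda>i. \<integral>x. \<bar>s i x - h x\<bar> \<partial>M) \<longlonglongrightarrow> (\<integral>x. 0 \<partial>M)"
  proof (rule integral_dominated_convergence[where w = "\<lambda>x. 3 * \<bar>h x\<bar>"])
    have "(\<lambda>i. \<bar>s i x - h x\<bar>) \<longlonglongrightarrow> 0" if "x \<in> space M" for x
      using lim(2)[OF that] LIM_zero_iff tendsto_rabs_zero by blast
    then show "AE x in M. (\<lambda>i. \<bar>s i x - h x\<bar>) \<longlonglongrightarrow> 0" by simp
    have "\<bar>s i x - h x\<bar> \<le> 3 * \<bar>h x\<bar>" if "x \<in> space M" for x i
      using lim(3)[OF that, of i] by simp
    then show "AE x in M. norm \<bar>s i x - h x\<bar> \<le> 3 * \<bar>h x\<bar>" for i by (intro AE_I2) simp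
  qed (use lim in auto)
  then have s0: "(\<lambda>i. \<integral>x. \<bar>s i x - h x\<bar> \<partial>M) \<longlonglongrightarrow> 0" by simp
  show ?case
  proof (rule LIMSEQ_I)
    fix e :: real assume e: "e > 0"
    then have "eventually (\<lambda>i. (\<integral>x. \<bar>s i x - h x\<bar> \<partial>M) < e / 3) sequentially"
      by (intro order_tendstoD(2)[OF s0]) simp
    then obtain i where i: "(\<integral>x. \<bar>s i x - h x\<bar> \<partial>M) < e / 3"
      by (auto simp: eventually_sequentially)
    have "eventually (\<lambda>n. (\<integral>x. \<bar>s i (iter (q n) x) - s i x\<bar> \<partial>M) < e / 3) sequentially"
      using e by (intro order_tendstoD(2)[OF lim.IH]) simp
    then obtain n0 where n0: "\<And>n. n \<ge> n0 \<Longrightarrow> (\<integral>x. \<bar>s i (iter (q n) x) - s i x\<bar> \<partial>M) < e / 3"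
      by (auto simp: eventually_sequentially)
    have "norm ((\<integral>x. \<bar>h (iter (q n) x) - h x\<bar> \<partial>M) - 0) < e" if n: "n \<ge> n0" for n
    proof -
      note int = lim(1)[of i] lim(4) integrable_iter[OF lim(1)[of i], of "q n"]
        integrable_iter[OF lim(4), of "q n"]
      have "(\<integral>x. \<bar>h (iter (q n) x) - h x\<bar> \<partial>M) \<le>
        (\<integral>x. \<bar>s i (iter (q n) x) - h (iter (q n) x)\<bar> + (\<bar>s i (iter (q n) x) - s i x\<bar> + \<bar>s i x - h x\<bar>) \<partial>M)"
        using int by (intro integral_mono) auto
      also have "\<dots> = (\<integral>x. \<bar>s i (iter (q n) x) - h (iter (q n) x)\<bar> \<partial>M) +
          ((\<integral>x. \<bar>s i (iter (q n) x) - s i x\<bar> \<partial>M) + (\<integral>x. \<bar>s i x - h x\<bar> \<partial>M))"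
        using int by simp
      also have "(\<integral>x. \<bar>s i (iter (q n) x) - h (iter (q n) x)\<bar> \<partial>M) = (\<integral>x. \<bar>s i x - h x\<bar> \<partial>M)"
        using lim by (intro integral_iter) auto
      finally show ?thesis using i n0[OF n] by simp
    qed
    then show "\<exists>no. \<forall>n\<ge>no. norm ((\<integral>x. \<bar>h (iter (q n) x) - h x\<bar> \<partial>M) - 0) < e" by blast
  qed
qed

end

section \<open>Uniformity over a parameter in Euclidean space\<close>

lemma space_borel_Rd: "space (borel_Rd d) = {..<d} \<rightarrow>\<^sub>E UNIV"
  by (simp add: borel_Rd_def space_PiM)

lemma measurable_borel_Rd_component [measurable]:
  "i < d \<Longrightarrow> (\<lambda>t. t i) \<in> borel_measurable (borel_Rd d)"
  unfolding borel_Rd_def by (rule measurable_component_singleton) simp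

text \<open>For \<open>t\<close> in a large box, \<open>W m x t\<close> is controlled by its values at a finite net; the
  complement of the box is controlled by the first moments of \<open>G n\<close>.\<close>

lemma (in prob_space) uniform_net:
  fixes W :: "nat \<Rightarrow> 'a \<Rightarrow> (nat \<Rightarrow> real) \<Rightarrow> real"
  assumes W [measurable]: "\<And>m. (\<lambda>(x, t). W m x t) \<in> borel_measurable (M \<Otimes>\<^sub>M borel_Rd d)"
    and W0: "\<And>m x t. x \<in> space M \<Longrightarrow> 0 \<le> W m x t"
    and WB: "\<And>m x t. x \<in> space M \<Longrightarrow> W m x t \<le> B"
    and lip: "\<And>m x s t. x \<in> space M \<Longrightarrow> \<bar>W m x s - W m x t\<bar> \<le> K * (\<Sum>i<d. \<bar>s i - t i\<bar>)"
    and lim: "\<And>t. t \<in> space (borel_Rd d) \<Longrightarrow> (\<lambda>m. \<integral>x. W m x t \<partial>M) \<longlonglongrightarrow> 0"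
    and G [measurable]: "\<And>n. G n \<in> M \<rightarrow>\<^sub>M borel_Rd d"
    and Gint: "\<And>n i. i < d \<Longrightarrow> integrable M (\<lambda>x. G n x i)"
    and GC: "\<And>n i. i < d \<Longrightarrow> (\<integral>x. \<bar>G n x i\<bar> \<partial>M) \<le> C"
    and K: "0 \<le> K" and e: "0 < e"
  shows "\<exists>m0. \<forall>m\<ge>m0. \<forall>n. (\<integral>x. W m x (G n x) \<partial>M) < e"
proof -
  have B: "0 \<le> B" using W0 WB not_empty by (meson all_not_in_conv order_trans)
  \<comment> \<open>Mesh of the net: a displacement of \<delta> in each of the \<open>d\<close>
    coordinates costs at most e/4. Adding 1 in the denominator covers the case K d = 0.\<close>
  define \<delta> where "\<delta> = e / (4 * (K * real d + 1))"
  have Kd: "0 \<le> K * real d" using K by simp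
  then have \<delta>: "\<delta> > 0" using e by (simp add: \<delta>_def)
  have K\<delta>: "K * real d * \<delta> \<le> e / 4"
    using Kd e by (simp add: \<delta>_def field_simps)
  \<comment> \<open>Markov-type cutoff: beyond the box of radius \<open>R\<close> the bound
    \<open>B\<close> costs at most B d \<bar>C\<bar> / R, that is at most e/4. Adding 1 keeps
    \<open>R\<close> positive.\<close>
  define R where "R = 4 * (B * real d * \<bar>C\<bar>) / e + 1"
  have R: "R > 0" using B e by (simp add: R_def add_nonneg_pos)
  have BR: "B * real d * \<bar>C\<bar> / R \<le> e / 4"
    using R e by (simp add: field_simps R_def)
  \<comment> \<open>Large enough that rounding down t/\<delta> stays within -k and k for
    \<bar>t\<bar> up to \<open>R\<close>; the 1 pays for the rounding.\<close>
  define k where "k = \<lceil>R / \<delta>\<rceil> + 1"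
  define Z where "Z = {..<d} \<rightarrow>\<^sub>E (\<lambda>j. \<delta> * real_of_int j) ` {-k..k}"
  have fin: "finite Z" unfolding Z_def by (intro finite_PiE) auto
  have Z: "z \<in> space (borel_Rd d)" if "z \<in> Z" for z
    using that by (auto simp: Z_def space_borel_Rd PiE_iff)
  \<comment> \<open>Inside the box the nearby net value is one term of the nonnegative sum over
    \<open>Z\<close>, and e/4 pays for rounding. Outside the box the last term alone is at least
    \<open>B\<close>. Only this last term depends on \<open>t\<close>, and linearly in its
    moments.\<close>
  have pointwise: "W m x t \<le> e / 4 + (\<Sum>z\<in>Z. W m x z) + B / R * (\<Sum>i<d. \<bar>t i\<bar>)"
    if x: "x \<in> space M" for m x t
  proof (cases "\<forall>i<d. \<bar>t i\<bar> \<le> R")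
    case True
    define z where "z = (\<lambda>i\<in>{..<d}. \<delta> * real_of_int \<lfloor>t i / \<delta>\<rfloor>)"
    have "\<lfloor>t i / \<delta>\<rfloor> \<in> {-k..k}" if "i < d" for i
    proof -
      have "\<bar>t i / \<delta>\<bar> \<le> R / \<delta>" using True that \<delta> by (simp add: divide_right_mono)
      then show ?thesis unfolding k_def by (auto; linarith)
    qed
    then have zZ: "z \<in> Z" by (auto simp: Z_def z_def)
    have "\<bar>t i - z i\<bar> \<le> \<delta>" if "i < d" for i
    proof -
      have "t i - z i = \<delta> * (t i / \<delta> - real_of_int \<lfloor>t i / \<delta>\<rfloor>)"
        using that \<delta> by (simp add: z_def field_simps)
      moreover have "\<bar>t i / \<delta> - real_of_int \<lfloor>t i / \<delta>\<rfloor>\<bar> \<le> 1" by linarith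
      ultimately show ?thesis using \<delta> by (simp add: abs_mult)
    qed
    then have "(\<Sum>i<d. \<bar>t i - z i\<bar>) \<le> (\<Sum>i<d. \<delta>)" by (intro sum_mono) auto
    then have "K * (\<Sum>i<d. \<bar>t i - z i\<bar>) \<le> K * (real d * \<delta>)"
      using K by (intro mult_left_mono) auto
    then have "W m x t \<le> W m x z + e / 4"
      using lip[OF x, of m t z] K\<delta> by (simp add: mult.assoc)
    moreover have "W m x z \<le> (\<Sum>z\<in>Z. W m x z)"
      using zZ fin W0[OF x] by (intro member_le_sum) auto
    moreover have "0 \<le> B / R * (\<Sum>i<d. \<bar>t i\<bar>)" using B R by (simp add: sum_nonneg)
    ultimately show ?thesis by linarith
  next
    case False
    then obtain i where i: "i < d" "\<bar>t i\<bar> > R" by force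
    then have "R \<le> (\<Sum>i<d. \<bar>t i\<bar>)"
      using member_le_sum[of i "{..<d}" "\<lambda>i. \<bar>t i\<bar>"] by simp
    then have "B / R * R \<le> B / R * (\<Sum>i<d. \<bar>t i\<bar>)" using B R by (intro mult_left_mono) auto
    then have "B \<le> B / R * (\<Sum>i<d. \<bar>t i\<bar>)" using R by simp
    moreover have "0 \<le> (\<Sum>z\<in>Z. W m x z)" by (intro sum_nonneg W0 x)
    ultimately show ?thesis using WB[OF x, of m t] e by linarith
  qed
  have int: "integrable M (\<lambda>x. W m x (g x))" if [measurable]: "g \<in> M \<rightarrow>\<^sub>M borel_Rd d" for m g
  proof (rule integrable_const_bound[where B = B])
    show "AE x in M. norm (W m x (g x)) \<le> B" using W0 WB by (intro AE_I2) simp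
    show "(\<lambda>x. W m x (g x)) \<in> borel_measurable M"
      using measurable_compose[OF measurable_Pair[OF measurable_ident_sets[OF refl] that] W[of m]] by simp
  qed
  have "(\<lambda>m. \<Sum>z\<in>Z. \<integral>x. W m x z \<partial>M) \<longlonglongrightarrow> (\<Sum>z\<in>Z. 0)"
    by (intro tendsto_sum lim Z)
  then have "eventually (\<lambda>m. (\<Sum>z\<in>Z. \<integral>x. W m x z \<partial>M) < e / 4) sequentially"
    using e by (intro order_tendstoD(2)) auto
  then obtain m0 where m0: "\<And>m. m \<ge> m0 \<Longrightarrow> (\<Sum>z\<in>Z. \<integral>x. W m x z \<partial>M) < e / 4"
    by (auto simp: eventually_sequentially)
  show ?thesis
  proof (intro exI[of _ m0] allI impI)
    fix m n assume m: "m \<ge> m0"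
    have i1: "integrable M (\<lambda>x. \<Sum>z\<in>Z. W m x z)"
      using int[of "\<lambda>_. _"] Z by (intro Bochner_Integration.integrable_sum) auto
    have i2: "integrable M (\<lambda>x. \<Sum>i<d. \<bar>G n x i\<bar>)"
      using Gint by (intro Bochner_Integration.integrable_sum) auto
    have "(\<integral>x. W m x (G n x) \<partial>M) \<le>
        (\<integral>x. e / 4 + (\<Sum>z\<in>Z. W m x z) + B / R * (\<Sum>i<d. \<bar>G n x i\<bar>) \<partial>M)"
      using i1 i2 by (intro integral_mono int G pointwise) auto
    also have "\<dots> = e / 4 + (\<integral>x. (\<Sum>z\<in>Z. W m x z) \<partial>M) + B / R * (\<integral>x. (\<Sum>i<d. \<bar>G n x i\<bar>) \<partial>M)"
      using i1 i2 by (simp add: prob_space)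
    also have "(\<integral>x. (\<Sum>z\<in>Z. W m x z) \<partial>M) = (\<Sum>z\<in>Z. \<integral>x. W m x z \<partial>M)"
      using int[of "\<lambda>_. _"] Z by (intro Bochner_Integration.integral_sum) auto
    also have "(\<integral>x. (\<Sum>i<d. \<bar>G n x i\<bar>) \<partial>M) = (\<Sum>i<d. \<integral>x. \<bar>G n x i\<bar> \<partial>M)"
      using Gint by (intro Bochner_Integration.integral_sum) auto
    finally have "(\<integral>x. W m x (G n x) \<partial>M) \<le> e / 4 + (\<Sum>z\<in>Z. \<integral>x. W m x z \<partial>M) +
        B / R * (\<Sum>i<d. \<integral>x. \<bar>G n x i\<bar> \<partial>M)" .
    moreover have "(\<Sum>i<d. \<integral>x. \<bar>G n x i\<bar> \<partial>M) \<le> (\<Sum>i<d. \<bar>C\<bar>)"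
      using GC by (intro sum_mono) (meson abs_ge_self lessThan_iff order_trans)
    then have "B / R * (\<Sum>i<d. \<integral>x. \<bar>G n x i\<bar> \<partial>M) \<le> B / R * (\<Sum>i<d. \<bar>C\<bar>)"
      using B R by (intro mult_left_mono) auto
    also have "\<dots> = B * real d * \<bar>C\<bar> / R" by simp
    also note BR
    ultimately show "(\<integral>x. W m x (G n x) \<partial>M) < e" using m0[OF m] e by linarith
  qed
qed

section \<open>Independence of the cocycle sums and the base point\<close>

text \<open>Weak convergence is tested by functions continuous for the product topology. The l^1
  distance to a fixed point is a finite sum of continuous coordinate functions, so its balls are
  open there.\<close>

lemma continuous_map_Rd_Lipschitz:
  fixes H :: "(nat \<Rightarrow> real) \<Rightarrow> real"
  assumes lip: "\<And>s t. \<bar>H s - H t\<bar> \<le> K * (\<Sum>i<d. \<bar>s i - t i\<bar>)" and K: "0 \<le> K"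
  shows "continuous_map (product_topology (\<lambda>_. euclideanreal) {..<d}) euclideanreal H"
proof -
  let ?X = "product_topology (\<lambda>_. euclideanreal) {..<d}"
  have "openin ?X {t \<in> topspace ?X. H t \<in> U}" if U: "open U" for U
  proof (subst openin_subopen, intro ballI)
    fix t0 assume t0: "t0 \<in> {t \<in> topspace ?X. H t \<in> U}"
    then obtain e where e: "e > 0" "\<And>v. \<bar>v - H t0\<bar> < e \<Longrightarrow> v \<in> U"
      using U by (auto simp: open_dist dist_real_def)
    have "continuous_map ?X euclideanreal (\<lambda>t. K * (\<Sum>i<d. \<bar>t i - t0 i\<bar>))"
      by (intro continuous_map_real_mult_left continuous_map_sum continuous_map_real_abs
          continuous_map_diff continuous_map_product_projection) auto
    then have op: "openin ?X {t \<in> topspace ?X. K * (\<Sum>i<d. \<bar>t i - t0 i\<bar>) \<in> {..<e}}"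
      by (rule openin_continuous_map_preimage) simp
    show "\<exists>V. openin ?X V \<and> t0 \<in> V \<and> V \<subseteq> {t \<in> topspace ?X. H t \<in> U}"
    proof (intro exI conjI)
      show "t0 \<in> {t \<in> topspace ?X. K * (\<Sum>i<d. \<bar>t i - t0 i\<bar>) \<in> {..<e}}"
        using t0 e by simp
      show "{t \<in> topspace ?X. K * (\<Sum>i<d. \<bar>t i - t0 i\<bar>) \<in> {..<e}} \<subseteq> {t \<in> topspace ?X. H t \<in> U}"
        using e(2) lip[of _ t0] by (auto intro: le_less_trans)
    qed (rule op)
  qed
  then show ?thesis by (auto simp: continuous_map_def)
qed

context automorphism_space begin

text \<open>The vectors \<open>F n\<close> are asymptotically invariant, so by ergodicity they become independent of
  the base point: average \<open>h\<close> over orbits in its first argument only.\<close>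

lemma stable_convergence:
  fixes h :: "'a \<Rightarrow> (nat \<Rightarrow> real) \<Rightarrow> real"
  assumes erg: "ergodic M T"
    and h [measurable]: "(\<lambda>(x, t). h x t) \<in> borel_measurable (M \<Otimes>\<^sub>M borel_Rd d)"
    and B: "\<And>x t. x \<in> space M \<Longrightarrow> \<bar>h x t\<bar> \<le> B"
    and lip: "\<And>x s t. x \<in> space M \<Longrightarrow> \<bar>h x s - h x t\<bar> \<le> K * (\<Sum>i<d. \<bar>s i - t i\<bar>)"
    and K: "0 \<le> K"
    and F [measurable]: "\<And>n. F n \<in> M \<rightarrow>\<^sub>M borel_Rd d"
    and Fint: "\<And>n i. i < d \<Longrightarrow> integrable M (\<lambda>x. F n x i)"
    and FC: "\<And>n i. i < d \<Longrightarrow> (\<integral>x. \<bar>F n x i\<bar> \<partial>M) \<le> C"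
    and inv: "\<And>i k. i < d \<Longrightarrow> (\<lambda>n. \<integral>x. \<bar>F n (iter k x) i - F n x i\<bar> \<partial>M) \<longlonglongrightarrow> 0"
    and weak: "weakly_converges_Rd d (\<lambda>n. distr M (borel_Rd d) (F n)) P"
  shows "(\<lambda>n. \<integral>x. h x (F n x) \<partial>M) \<longlonglongrightarrow> (\<integral>t. \<integral>x. h x t \<partial>M \<partial>P)"
proof -
  have hm: "(\<lambda>y. h (u y) (v y)) \<in> borel_measurable L"
    if u: "u \<in> L \<rightarrow>\<^sub>M M" and v: "v \<in> L \<rightarrow>\<^sub>M borel_Rd d" for u v and L :: "'z measure"
    using measurable_compose[OF measurable_Pair[OF u v] h] by simp
  note [measurable] = hm
  have hm_iter: "(\<lambda>y. h (iter k (u y)) (v y)) \<in> borel_measurable L"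
    if "u \<in> L \<rightarrow>\<^sub>M M" "v \<in> L \<rightarrow>\<^sub>M borel_Rd d" for u v k and L :: "'z measure"
    using that by (intro hm measurable_compose[OF _ measurable_iter]) auto
  have B0: "0 \<le> B" using B not_empty by fastforce
  have hint: "integrable M (\<lambda>x. h (iter k x) (v x))" if [measurable]: "v \<in> M \<rightarrow>\<^sub>M borel_Rd d" for v k
    by (rule integrable_const_bound[where B = B])
       (use B iter_in_space in \<open>auto intro!: AE_I2 hm_iter\<close>)
  have hint': "integrable M (\<lambda>x. h x (v x))" if "v \<in> M \<rightarrow>\<^sub>M borel_Rd d" for v
    using hint[OF that, of 0] by simp
  have hint_const: "integrable M (\<lambda>x. h x t)" for t
  proof -
    have "(\<lambda>x. h x (restrict t {..<d})) \<in> borel_measurable M"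
      by (rule hm) (auto simp: space_borel_Rd)
    \<comment> \<open>\<open>t\<close> need not be extensional; restricting it changes no coordinate
      below \<open>d\<close>, so the Lipschitz bound between the two values is 0.\<close>
    moreover have "h x (restrict t {..<d}) = h x t" if "x \<in> space M" for x
      using lip[OF that, of "restrict t {..<d}" t] by simp
    ultimately have "(\<lambda>x. h x t) \<in> borel_measurable M" by (simp cong: measurable_cong)
    then show ?thesis using B by (intro integrable_const_bound[where B = B]) (auto intro!: AE_I2)
  qed
  define H where "H t = (\<integral>x. h x t \<partial>M)" for t
  have H [measurable]: "H \<in> borel_measurable (borel_Rd d)"
  proof -
    have "(\<lambda>(t, x). h x t) \<in> borel_measurable (borel_Rd d \<Otimes>\<^sub>M M)"
      unfolding split_beta by (rule hm) measurable
    then show ?thesis unfolding H_def by (rule borel_measurable_lebesgue_integral)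
  qed
  have Hlip: "\<bar>H s - H t\<bar> \<le> K * (\<Sum>i<d. \<bar>s i - t i\<bar>)" for s t
  proof -
    have "\<bar>H s - H t\<bar> = \<bar>\<integral>x. h x s - h x t \<partial>M\<bar>"
      unfolding H_def by (subst Bochner_Integration.integral_diff[OF hint_const hint_const]) simp
    also have "\<dots> \<le> (\<integral>x. \<bar>h x s - h x t\<bar> \<partial>M)" by (rule integral_abs_bound)
    also have "\<dots> \<le> (\<integral>x. K * (\<Sum>i<d. \<bar>s i - t i\<bar>) \<partial>M)"
      using hint_const by (intro integral_mono lip) auto
    finally show ?thesis by (simp add: prob_space)
  qed
  have HB: "\<bar>H t\<bar> \<le> B" for t
  proof -
    have "\<bar>H t\<bar> \<le> (\<integral>x. \<bar>h x t\<bar> \<partial>M)" unfolding H_def by (rule integral_abs_bound)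
    also have "\<dots> \<le> (\<integral>x. B \<partial>M)" using hint_const by (intro integral_mono B) auto
    finally show ?thesis by (simp add: prob_space)
  qed
  have "bounded (H ` ({..<d} \<rightarrow>\<^sub>E UNIV))" using HB by (auto simp: bounded_iff)
  then have "(\<lambda>n. \<integral>t. H t \<partial>distr M (borel_Rd d) (F n)) \<longlonglongrightarrow> (\<integral>t. H t \<partial>P)"
    using weak continuous_map_Rd_Lipschitz[OF Hlip K] by (simp add: weakly_converges_Rd_def)
  then have Hlim: "(\<lambda>n. \<integral>x. H (F n x) \<partial>M) \<longlonglongrightarrow> (\<integral>t. H t \<partial>P)"
    by (simp add: integral_distr)
  have HF: "integrable M (\<lambda>x. H (F n x))" for n
    by (rule integrable_const_bound[where B = B]) (use HB in auto)
  define A where "A m x t = (\<Sum>j<m. h (iter (int j) x) t) / real m" for m :: nat and x t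
  have Aint: "integrable M (\<lambda>x. A m x (F n x))" for m n
    unfolding A_def using hint by (auto intro!: Bochner_Integration.integrable_sum)
  have AB: "\<bar>A m x t\<bar> \<le> B" if x: "x \<in> space M" for m x t
  proof -
    have "\<bar>\<Sum>j<m. h (iter (int j) x) t\<bar> \<le> (\<Sum>j<m. B)"
      using B[OF iter_in_space[OF x]] by (intro order_trans[OF sum_abs] sum_mono)
    then show ?thesis using B0 by (cases "m = 0") (simp_all add: A_def field_simps)
  qed
  have Alip: "\<bar>A m x s - A m x t\<bar> \<le> K * (\<Sum>i<d. \<bar>s i - t i\<bar>)" if x: "x \<in> space M" for m x s t
  proof -
    have "\<bar>\<Sum>j<m. h (iter (int j) x) s - h (iter (int j) x) t\<bar> \<le> (\<Sum>j<m. K * (\<Sum>i<d. \<bar>s i - t i\<bar>))"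
      using lip[OF iter_in_space[OF x]] by (intro order_trans[OF sum_abs] sum_mono)
    then show ?thesis using K
      by (cases "m = 0")
        (simp_all add: A_def field_simps sum_subtractf abs_divide sum_nonneg flip: diff_divide_distrib)
  qed
  \<comment> \<open>For fixed \<open>t\<close> this is the L^1 ergodic theorem;
    \<open>uniform_net\<close> permits t = F n x, with an \<open>m0\<close> that serves all
    \<open>n\<close>. This is what allows \<open>m\<close> to be chosen before \<open>n\<close>
    tends to infinity.\<close>
  have net: "\<exists>m0. \<forall>m\<ge>m0. \<forall>n. (\<integral>x. \<bar>A m x (F n x) - H (F n x)\<bar> \<partial>M) < e" if e: "e > 0" for e
  proof (rule uniform_net[where W = "\<lambda>m x t. \<bar>A m x t - H t\<bar>" and G = F and B = "2 * B" and K = "2 * K" and d = d and C = C])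
    show "(\<lambda>(x, t). \<bar>A m x t - H t\<bar>) \<in> borel_measurable (M \<Otimes>\<^sub>M borel_Rd d)" for m
      unfolding A_def split_beta
      by (intro borel_measurable_abs borel_measurable_diff borel_measurable_divide
          borel_measurable_sum hm_iter) measurable
    show "\<bar>A m x t - H t\<bar> \<le> 2 * B" if "x \<in> space M" for m x t
      using AB[OF that, of m t] HB[of t] by linarith
    show "\<bar>\<bar>A m x s - H s\<bar> - \<bar>A m x t - H t\<bar>\<bar> \<le> 2 * K * (\<Sum>i<d. \<bar>s i - t i\<bar>)"
      if "x \<in> space M" for m x s t
      using Alip[OF that, of m s t] Hlip[of s t] by linarith
    show "(\<lambda>m. \<integral>x. \<bar>A m x t - H t\<bar> \<partial>M) \<longlonglongrightarrow> 0" for t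
      using birkhoff_L1[OF erg, of "\<lambda>x. h x t" B] hint_const[of t] B
      by (simp add: A_def H_def csum_of_nat iter_of_nat)
  qed (use K e Fint FC in auto)
  have shift: "(\<lambda>n. (\<integral>x. h x (F n x) \<partial>M) - (\<integral>x. A m x (F n x) \<partial>M)) \<longlonglongrightarrow> 0" if m: "m > 0" for m
  proof -
    \<comment> \<open>By invariance both arguments may be moved to T^j x; the Lipschitz bound then
      brings \<open>F n\<close> back to x at a cost that vanishes by asymptotic invariance.\<close>
    have one: "(\<lambda>n. (\<integral>x. h x (F n x) \<partial>M) - (\<integral>x. h (iter (int j) x) (F n x) \<partial>M)) \<longlonglongrightarrow> 0" for j
    proof (rule Lim_null_comparison)
      have "(\<lambda>n. K * (\<Sum>i<d. \<integral>x. \<bar>F n (iter (int j) x) i - F n x i\<bar> \<partial>M)) \<longlonglongrightarrow> K * (\<Sum>i<d. 0)"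
        by (intro tendsto_mult_left tendsto_sum inv) simp
      then show "(\<lambda>n. K * (\<Sum>i<d. \<integral>x. \<bar>F n (iter (int j) x) i - F n x i\<bar> \<partial>M)) \<longlonglongrightarrow> 0" by simp
      show "eventually (\<lambda>n. norm ((\<integral>x. h x (F n x) \<partial>M) - (\<integral>x. h (iter (int j) x) (F n x) \<partial>M)) \<le>
          K * (\<Sum>i<d. \<integral>x. \<bar>F n (iter (int j) x) i - F n x i\<bar> \<partial>M)) sequentially"
      proof (intro always_eventually allI)
        fix n
        have Fi: "integrable M (\<lambda>x. F n (iter (int j) x) i - F n x i)" if "i < d" for i
          using integrable_iter[OF Fint[OF that], of n "int j"] Fint[OF that] by simp
        have Fj: "(\<lambda>x. F n (iter (int j) x)) \<in> M \<rightarrow>\<^sub>M borel_Rd d" by measurable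
        have "(\<integral>x. h x (F n x) \<partial>M) = (\<integral>x. h (iter (int j) x) (F n (iter (int j) x)) \<partial>M)"
          by (rule integral_iter[symmetric, of "\<lambda>x. h x (F n x)"]) (intro hm F measurable_ident_sets refl)
        then have "\<bar>(\<integral>x. h x (F n x) \<partial>M) - (\<integral>x. h (iter (int j) x) (F n x) \<partial>M)\<bar> =
            \<bar>\<integral>x. h (iter (int j) x) (F n (iter (int j) x)) - h (iter (int j) x) (F n x) \<partial>M\<bar>"
          using hint[OF Fj] hint[OF F] by simp
        also have "\<dots> \<le> (\<integral>x. \<bar>h (iter (int j) x) (F n (iter (int j) x)) - h (iter (int j) x) (F n x)\<bar> \<partial>M)"
          by (rule integral_abs_bound)
        also have "\<dots> \<le> (\<integral>x. K * (\<Sum>i<d. \<bar>F n (iter (int j) x) i - F n x i\<bar>) \<partial>M)"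
          using hint[OF Fj] hint[OF F] Fi
          by (intro integral_mono lip iter_in_space) (auto intro!: Bochner_Integration.integrable_sum)
        also have "\<dots> = K * (\<Sum>i<d. \<integral>x. \<bar>F n (iter (int j) x) i - F n x i\<bar> \<partial>M)"
          using Fi by (simp add: Bochner_Integration.integral_sum)
        finally show "norm ((\<integral>x. h x (F n x) \<partial>M) - (\<integral>x. h (iter (int j) x) (F n x) \<partial>M)) \<le>
          K * (\<Sum>i<d. \<integral>x. \<bar>F n (iter (int j) x) i - F n x i\<bar> \<partial>M)" by simp
      qed
    qed
    have "(\<lambda>n. (\<Sum>j<m. (\<integral>x. h x (F n x) \<partial>M) - (\<integral>x. h (iter (int j) x) (F n x) \<partial>M)) / real m)
        \<longlonglongrightarrow> (\<Sum>j<m. 0) / real m"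
      by (intro tendsto_intros one) (use m in simp)
    moreover have "(\<Sum>j<m. (\<integral>x. h x (F n x) \<partial>M) - (\<integral>x. h (iter (int j) x) (F n x) \<partial>M)) / real m =
        (\<integral>x. h x (F n x) \<partial>M) - (\<integral>x. A m x (F n x) \<partial>M)" for n
      using m hint[OF F]
      by (simp add: A_def sum_subtractf diff_divide_distrib Bochner_Integration.integral_sum)
    ultimately show ?thesis by simp
  qed
  show ?thesis
  proof (rule LIMSEQ_I)
    fix e :: real assume e: "e > 0"
    then have e3: "e / 3 > 0" by simp
    obtain m0 where m0: "\<And>m n. m \<ge> m0 \<Longrightarrow> (\<integral>x. \<bar>A m x (F n x) - H (F n x)\<bar> \<partial>M) < e / 3"
      using net[OF e3] by blast
    \<comment> \<open>The successor makes \<open>m\<close> positive, as \<open>shift\<close>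
      requires for a genuine average.\<close>
    define m where "m = Suc m0"
    have AH: "\<bar>(\<integral>x. A m x (F n x) \<partial>M) - (\<integral>x. H (F n x) \<partial>M)\<bar> < e / 3" for n
    proof -
      have "\<bar>(\<integral>x. A m x (F n x) \<partial>M) - (\<integral>x. H (F n x) \<partial>M)\<bar> = \<bar>\<integral>x. A m x (F n x) - H (F n x) \<partial>M\<bar>"
        using Aint HF by simp
      also have "\<dots> \<le> (\<integral>x. \<bar>A m x (F n x) - H (F n x)\<bar> \<partial>M)" by (rule integral_abs_bound)
      also have "\<dots> < e / 3" by (rule m0) (simp add: m_def)
      finally show ?thesis .
    qed
    have "m > 0" by (simp add: m_def)
    from LIMSEQ_D[OF shift[OF this] e3] obtain n1 where
      n1: "\<And>n. n \<ge> n1 \<Longrightarrow> \<bar>(\<integral>x. h x (F n x) \<partial>M) - (\<integral>x. A m x (F n x) \<partial>M)\<bar> < e / 3" by auto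
    from LIMSEQ_D[OF Hlim e3] obtain n2 where
      n2: "\<And>n. n \<ge> n2 \<Longrightarrow> \<bar>(\<integral>x. H (F n x) \<partial>M) - (\<integral>t. H t \<partial>P)\<bar> < e / 3" by auto
    have "norm ((\<integral>x. h x (F n x) \<partial>M) - (\<integral>t. H t \<partial>P)) < e" if n: "n \<ge> max n1 n2" for n
    proof -
      have "n1 \<le> n" "n2 \<le> n" using n by simp_all
      from n1[OF this(1)] n2[OF this(2)] AH[of n] show ?thesis
        unfolding real_norm_def by linarith
    qed
    then show "\<exists>no. \<forall>n\<ge>no. norm ((\<integral>x. h x (F n x) \<partial>M) - (\<integral>t. \<integral>x. h x t \<partial>M \<partial>P)) < e"
      unfolding H_def by blast
  qed
qed

end

section \<open>Convergence of the joinings\<close>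

context special_flow_space begin

lemma AE_N_good: "AE y in N. fst y \<in> good"
proof -
  have "emeasure N {y \<in> space N. fst y \<notin> good} =
      (\<integral>\<^sup>+y. indicator {y \<in> space N. fst y \<notin> good} y \<partial>N)"
    by simp
  also have "\<dots> = (\<integral>\<^sup>+y. indicator (- good) (fst y) \<partial>N)"
    by (intro nn_integral_cong) (simp add: indicator_def)
  also have "\<dots> = (\<integral>\<^sup>+x. \<integral>\<^sup>+r. indicator (- good) x * indicator {0..<f x} r \<partial>lborel \<partial>M)"
    by (subst nn_integral_N) auto
  also have "\<dots> = (\<integral>\<^sup>+x. 0 \<partial>M)"
    by (rule nn_integral_cong_AE, rule AE_mp[OF AE_good]) (auto intro!: AE_I2)
  finally show ?thesis by (intro AE_I[OF _ _ _]) auto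
qed

text \<open>Moving the base point to T^k x uses f^(k)(x) of the clock while time k was available,
  leaving k - f^(k)(x). The base point T^k x need not be the one under the point actually
  reached.\<close>

lemma flow_integer_time:
  assumes x: "x \<in> good"
  shows "flow (real_of_int k) (x, r) = base_flow (iter k x) (r - csum (\<lambda>x. f x - 1) k x)"
  using base_flow_iter[OF x, of k "r - csum (\<lambda>x. f x - 1) k x"] x good_in_space[OF x]
  by (simp add: flow_eq csum_const_diff algebra_simps)

text \<open>Over a good point, \<open>base_flow x u\<close> is the flow of
  \<open>base_flow x v\<close> for time u - v; elsewhere \<open>base_flow x\<close> is constant in
  its second argument.\<close>

lemma flow_lipschitz_base_flow:
  assumes b: "\<And>y t. y \<in> space N \<Longrightarrow> \<bar>b (flow t y) - b y\<bar> \<le> K * \<bar>t\<bar>" and K: "0 \<le> K"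
    and x: "x \<in> space M"
  shows "\<bar>b (base_flow x u) - b (base_flow x v)\<bar> \<le> K * \<bar>u - v\<bar>"
proof (cases "x \<in> good")
  case True
  then show ?thesis
    using b[OF base_flow_in_N[OF x, of v], of "u - v"] flow_base_flow[OF x, of "u - v" v] by simp
next
  case False
  then show ?thesis using K by (simp add: base_flow_def)
qed

text \<open>Integrating over the base first, at a fixed height \<open>r\<close>, leaves a problem on
  \<open>M\<close> alone. The function \<open>u\<close> lives on the full product because its values
  come from \<open>base_flow\<close>, defined at every real height; \<open>A\<close> enforces the
  roof.\<close>

lemma integral_N_subset:
  fixes u :: "'a \<times> real \<Rightarrow> real"
  assumes A: "A \<in> sets N" and u: "u \<in> borel_measurable (M \<Otimes>\<^sub>M borel)"
    and u1: "\<And>y. y \<in> space M \<times> UNIV \<Longrightarrow> \<bar>u y\<bar> \<le> 1"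
  shows "(\<integral>y. indicator A y * u y \<partial>N) = (\<integral>r. \<integral>x. indicator A (x, r) * u (x, r) \<partial>M \<partial>lborel)"
proof -
  interpret prd: pair_sigma_finite M lborel ..
  let ?S = "{(x, s). x \<in> space M \<and> 0 \<le> s \<and> s < f x}"
  have A': "A \<in> sets (M \<Otimes>\<^sub>M lborel)" "A \<subseteq> ?S" using A by (simp_all add: sets_N_iff space_N)
  have u': "u \<in> borel_measurable (M \<Otimes>\<^sub>M lborel)"
    using u by (simp cong: measurable_cong_sets sets_pair_measure_cong)
  have "emeasure (M \<Otimes>\<^sub>M lborel) A = emeasure N A"
    unfolding special_measure_def using A' sets_subgraph
    by (subst emeasure_restrict_space) (simp_all only: subgraph_Int_space)
  then have fin: "emeasure (M \<Otimes>\<^sub>M lborel) A < \<infinity>"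
    using N.emeasure_finite[of A] by (simp add: less_top[symmetric])
  have int: "integrable (M \<Otimes>\<^sub>M lborel) (\<lambda>y. indicator A y * u y)"
  proof (rule Bochner_Integration.integrable_bound)
    show "integrable (M \<Otimes>\<^sub>M lborel) (indicator A :: _ \<Rightarrow> real)"
      using A'(1) fin by (rule integrable_real_indicator)
    show "(\<lambda>y. indicator A y * u y) \<in> borel_measurable (M \<Otimes>\<^sub>M lborel)"
      using A'(1) u' by (intro borel_measurable_times borel_measurable_indicator)
    show "AE y in M \<Otimes>\<^sub>M lborel. norm (indicator A y * u y) \<le> norm (indicator A y :: real)"
      using u1 by (intro AE_I2) (auto simp: indicator_def space_pair_measure)
  qed
  have "(\<integral>y. indicator A y * u y \<partial>N) = (\<integral>y. indicator ?S y *\<^sub>R (indicator A y * u y) \<partial>(M \<Otimes>\<^sub>M lborel))"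
    unfolding special_measure_def
    by (rule integral_restrict_space) (unfold subgraph_Int_space, rule sets_subgraph)
  also have "\<dots> = (\<integral>y. indicator A y * u y \<partial>(M \<Otimes>\<^sub>M lborel))"
    using A'(2) by (intro Bochner_Integration.integral_cong) (auto simp: indicator_def)
  also have "\<dots> = (\<integral>r. \<integral>x. indicator A (x, r) * u (x, r) \<partial>M \<partial>lborel)"
    using prd.integral_snd[of "\<lambda>x r. indicator A (x, r) * u (x, r)"] int by (simp add: split_beta')
  finally show ?thesis .
qed

text \<open>The mass of a box under a graph joining with flow times \<open>\<tau>\<close>, with the indicators of all sides
  but the last one replaced by functions.\<close>

definition box_mass :: "nat \<Rightarrow> (nat \<Rightarrow> real) \<Rightarrow> (nat \<Rightarrow> 'a \<times> real \<Rightarrow> real) \<Rightarrow> ('a \<times> real) set \<Rightarrow> real" where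
  "box_mass d \<tau> a A = (\<integral>y. indicator A y * (\<Prod>i<d. a i (flow (\<tau> i) y)) \<partial>N)"

lemma prod_unit_interval:
  fixes a :: "nat \<Rightarrow> real"
  assumes "\<And>i. i < d \<Longrightarrow> 0 \<le> a i \<and> a i \<le> 1"
  shows "0 \<le> (\<Prod>i<d. a i)" "(\<Prod>i<d. a i) \<le> 1"
  using assms by (auto intro!: prod_nonneg prod_le_1)

lemma integrable_box:
  fixes a :: "nat \<Rightarrow> 'a \<times> real \<Rightarrow> real"
  assumes A: "A \<in> sets N" and a: "\<And>i. i < d \<Longrightarrow> a i \<in> borel_measurable N"
    and a01: "\<And>i y. i < d \<Longrightarrow> y \<in> space N \<Longrightarrow> 0 \<le> a i y \<and> a i y \<le> 1"
  shows "integrable N (\<lambda>y. indicator A y * (\<Prod>i<d. a i (flow (\<tau> i) y)))"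
proof (rule N.integrable_const_bound[where B = 1])
  show "AE y in N. norm (indicator A y * (\<Prod>i<d. a i (flow (\<tau> i) y))) \<le> 1"
    using prod_unit_interval[of d "\<lambda>i. a i (flow (\<tau> i) _)"] a01 flow_in_N
    by (intro AE_I2) (auto simp: indicator_def)
  show "(\<lambda>y. indicator A y * (\<Prod>i<d. a i (flow (\<tau> i) y))) \<in> borel_measurable N"
    using A a by (intro borel_measurable_times borel_measurable_indicator borel_measurable_prod
        measurable_compose[OF measurable_flow1]) auto
qed

text \<open>The product is compared factor by factor, and each error has an integral independent of
  \<tau> by invariance. The last side is shrunk to \<open>A'\<close> instead of being
  smoothed.\<close>

lemma box_mass_diff:
  assumes A: "A \<in> sets N" and A': "A' \<in> sets N" "A' \<subseteq> A"
    and B: "\<And>i. i < d \<Longrightarrow> B i \<in> sets N" and b: "\<And>i. i < d \<Longrightarrow> flow_lipschitz (b i)"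
  shows "\<bar>box_mass d \<tau> (\<lambda>i. indicator (B i)) A - box_mass d \<tau> b A'\<bar> \<le>
     N.prob (A - A') + (\<Sum>i<d. \<integral>y. \<bar>indicator (B i) y - b i y\<bar> \<partial>N)"
proof -
  let ?p = "\<lambda>y. \<Prod>i<d. indicator (B i) (flow (\<tau> i) y) :: real"
  let ?p' = "\<lambda>y. \<Prod>i<d. b i (flow (\<tau> i) y)"
  let ?D = "\<lambda>i y. \<bar>indicator (B i) y - b i y\<bar>"
  have Dm: "?D i \<in> borel_measurable N" if "i < d" for i
    using integrable_flow_lipschitz_diff[OF b B] that by blast
  have D: "integrable N (\<lambda>y. ?D i (flow (\<tau> i) y))" if "i < d" for i
    using integrable_distr[of "flow (\<tau> i)" N N "?D i"] integrable_flow_lipschitz_diff[OF b B] that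
    by (simp add: distr_flow)
  have int: "integrable N (\<lambda>y. indicator A y * ?p y)" "integrable N (\<lambda>y. indicator A' y * ?p' y)"
    using B flow_lipschitz_measurable[OF b] flow_lipschitz_bounds[OF b]
    by (auto intro!: integrable_box A A')
  have "\<bar>box_mass d \<tau> (\<lambda>i. indicator (B i)) A - box_mass d \<tau> b A'\<bar> =
      \<bar>\<integral>y. indicator A y * ?p y - indicator A' y * ?p' y \<partial>N\<bar>"
    unfolding box_mass_def using int by simp
  also have "\<dots> \<le> (\<integral>y. \<bar>indicator A y * ?p y - indicator A' y * ?p' y\<bar> \<partial>N)"
    by (rule integral_abs_bound)
  also have "\<dots> \<le> (\<integral>y. indicator (A - A') y + (\<Sum>i<d. ?D i (flow (\<tau> i) y)) \<partial>N)"
  proof (rule integral_mono)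
    show "integrable N (\<lambda>y. indicator (A - A') y + (\<Sum>i<d. ?D i (flow (\<tau> i) y)))"
      using A A' D by (intro Bochner_Integration.integrable_add integrable_real_indicator
          Bochner_Integration.integrable_sum) (auto simp: less_top[symmetric])
    fix y assume y: "y \<in> space N"
    have p01: "0 \<le> ?p y" "?p y \<le> 1"
      using prod_unit_interval[of d "\<lambda>i. indicator (B i) (flow (\<tau> i) y)"] by auto
    have diff: "\<bar>?p y - ?p' y\<bar> \<le> (\<Sum>i<d. ?D i (flow (\<tau> i) y))"
      using norm_prod_diff[of "{..<d}" "\<lambda>i. indicator (B i) (flow (\<tau> i) y) :: real" "\<lambda>i. b i (flow (\<tau> i) y)"]
        flow_lipschitz_bounds[OF b flow_in_N[OF y]] by simp
    have "0 \<le> (\<Sum>i<d. ?D i (flow (\<tau> i) y))" by (intro sum_nonneg) simp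
    then show "\<bar>indicator A y * ?p y - indicator A' y * ?p' y\<bar> \<le>
        indicator (A - A') y + (\<Sum>i<d. ?D i (flow (\<tau> i) y))"
      using diff p01 A'(2) by (cases "y \<in> A'"; cases "y \<in> A") auto
  qed (use int in simp)
  also have "\<dots> = N.prob (A - A') + (\<Sum>i<d. \<integral>y. ?D i (flow (\<tau> i) y) \<partial>N)"
    using A A' D
    by (subst Bochner_Integration.integral_add)
       (auto intro!: Bochner_Integration.integrable_sum integrable_real_indicator
          simp: less_top[symmetric] Bochner_Integration.integral_sum)
  also have "(\<Sum>i<d. \<integral>y. ?D i (flow (\<tau> i) y) \<partial>N) = (\<Sum>i<d. \<integral>y. ?D i y \<partial>N)"
    by (intro sum.cong refl integral_flow Dm) simp
  finally show ?thesis .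
qed

lemma measurable_box_mass:
  assumes A: "A \<in> sets N" and a: "\<And>i. i < d \<Longrightarrow> a i \<in> borel_measurable N"
  shows "(\<lambda>t. box_mass d (\<lambda>i. - t i) a A) \<in> borel_measurable (borel_Rd d)"
proof -
  have fm: "(\<lambda>z. flow (- (fst z) i) (snd z)) \<in> borel_Rd d \<Otimes>\<^sub>M N \<rightarrow>\<^sub>M N" if i: "i < d" for i
  proof (rule measurable_flow)
    show "(\<lambda>z. - (fst z) i) \<in> borel_measurable (borel_Rd d \<Otimes>\<^sub>M N)"
      by (intro borel_measurable_uminus measurable_compose[OF measurable_fst measurable_borel_Rd_component[OF i]])
  qed simp
  have "(\<lambda>(t, y). indicator A y * (\<Prod>i<d. a i (flow (- t i) y))) \<in> borel_measurable (borel_Rd d \<Otimes>\<^sub>M N)"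
    unfolding split_beta
    by (intro borel_measurable_times borel_measurable_prod measurable_compose[OF fm a]
        measurable_compose[OF measurable_snd borel_measurable_indicator[OF A]]) auto
  then show ?thesis
    unfolding box_mass_def by (rule N.borel_measurable_lebesgue_integral)
qed

lemma box_mass_bounds:
  assumes A: "A \<in> sets N" and a: "\<And>i. i < d \<Longrightarrow> a i \<in> borel_measurable N"
    and a01: "\<And>i y. i < d \<Longrightarrow> y \<in> space N \<Longrightarrow> 0 \<le> a i y \<and> a i y \<le> 1"
  shows "0 \<le> box_mass d \<tau> a A" "box_mass d \<tau> a A \<le> 1"
proof -
  have *: "0 \<le> indicator A y * (\<Prod>i<d. a i (flow (\<tau> i) y)) \<and>
      indicator A y * (\<Prod>i<d. a i (flow (\<tau> i) y)) \<le> 1" if "y \<in> space N" for y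
    using prod_unit_interval[of d "\<lambda>i. a i (flow (\<tau> i) y)"] a01 flow_in_N[OF that]
    by (auto simp: indicator_def)
  show "0 \<le> box_mass d \<tau> a A"
    unfolding box_mass_def using * by (intro integral_nonneg_AE AE_I2) simp
  have "box_mass d \<tau> a A \<le> (\<integral>y. 1 \<partial>N)"
    unfolding box_mass_def using * by (intro integral_mono integrable_box assms) auto
  then show "box_mass d \<tau> a A \<le> 1" by (simp add: N.prob_space)
qed

lemma measure_graph_joining_box:
  assumes A: "\<And>i. i < d + 1 \<Longrightarrow> A i \<in> sets N"
  shows "measure (graph_joining (d + 1) N (\<lambda>i. flow (\<tau> i))) (Pi\<^sub>E {..<d + 1} A) =
     box_mass d \<tau> (\<lambda>i. indicator (A i)) (A d)"
proof -
  let ?E = "{y \<in> space N. (\<forall>i<d. flow (\<tau> i) y \<in> A i) \<and> y \<in> A d}"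
  have [measurable]: "A i \<in> sets N" if "i < d + 1" for i by (rule A[OF that])
  have "measure (graph_joining (d + 1) N (\<lambda>i. flow (\<tau> i))) (Pi\<^sub>E {..<d + 1} A) = measure N ?E"
    unfolding measure_def using A by (subst emeasure_graph_joining_box) auto
  also have "\<dots> = (\<integral>y. indicator ?E y \<partial>N)"
    by (simp add: Int_absorb1 Collect_conj_eq)
  also have "\<dots> = box_mass d \<tau> (\<lambda>i. indicator (A i)) (A d)"
    unfolding box_mass_def
  proof (intro Bochner_Integration.integral_cong refl)
    fix y assume y: "y \<in> space N"
    show "indicator ?E y = indicator (A d) y * (\<Prod>i<d. indicator (A i) (flow (\<tau> i) y) :: real)"
    proof (cases "\<forall>i<d. flow (\<tau> i) y \<in> A i")
      case True
      then have "(\<Prod>i<d. indicator (A i) (flow (\<tau> i) y) :: real) = 1" by (intro prod.neutral) auto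
      then show ?thesis using True y by (simp add: indicator_def)
    next
      case False
      then obtain i where "i < d" "flow (\<tau> i) y \<notin> A i" by blast
      then have "(\<Prod>i<d. indicator (A i) (flow (\<tau> i) y) :: real) = 0"
        by (intro prod_zero bexI[of _ i]) auto
      then show ?thesis using False by (auto simp: indicator_def)
    qed
  qed
  finally show ?thesis .
qed

end

section \<open>Limits of box masses\<close>

lemma tendsto_approx:
  fixes x :: "nat \<Rightarrow> real"
  assumes "\<And>e. e > 0 \<Longrightarrow> \<exists>y l'. y \<longlonglongrightarrow> l' \<and> (\<forall>n. \<bar>x n - y n\<bar> \<le> e) \<and> \<bar>l - l'\<bar> \<le> e"
  shows "x \<longlonglongrightarrow> l"
proof (rule LIMSEQ_I)
  fix e :: real assume e: "e > 0"
  then obtain y l' where y: "y \<longlonglongrightarrow> l'" "\<And>n. \<bar>x n - y n\<bar> \<le> e / 4" "\<bar>l - l'\<bar> \<le> e / 4"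
    using assms[of "e / 4"] by auto
  from e have "e / 4 > 0" by simp
  from LIMSEQ_D[OF y(1) this] obtain n0 where n0: "\<And>n. n \<ge> n0 \<Longrightarrow> \<bar>y n - l'\<bar> < e / 4" by auto
  have "norm (x n - l) < e" if "n \<ge> n0" for n
    using n0[OF that] y(2)[of n] y(3) e unfolding real_norm_def by linarith
  then show "\<exists>no. \<forall>n\<ge>no. norm (x n - l) < e" by blast
qed

context special_flow_space begin

text \<open>At each height \<open>r\<close> two limits are combined: rigidity replaces T^q x by x
  inside the test functions, and \<open>stable_convergence\<close> then decouples x from
  \<open>F n x\<close>. The roof bound \<open>L\<close> over \<open>A\<close> dominates the
  remaining integral in \<open>r\<close>, and Fubini exchanges it with \<open>P\<close>.\<close>

lemma box_mass_limit_lipschitz: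
  fixes q :: "nat \<Rightarrow> nat \<Rightarrow> int" and d :: nat
  defines "F \<equiv> \<lambda>n x. \<lambda>i\<in>{..<d}. csum (\<lambda>x. f x - 1) (q i n) x"
  assumes erg: "ergodic M T"
    and rig: "\<And>i. i < d \<Longrightarrow> rigidity_sequence M T (q i)"
    and FC: "\<And>n i. i < d \<Longrightarrow> (\<integral>x. \<bar>F n x i\<bar> \<partial>M) \<le> C"
    and weak: "weakly_converges_Rd d (\<lambda>n. distr M (borel_Rd d) (F n)) P"
    and A: "A \<in> sets N" and L: "\<And>x r. (x, r) \<in> A \<Longrightarrow> f x \<le> L"
    and b: "\<And>i. i < d \<Longrightarrow> flow_lipschitz (b i)"
  shows "(\<lambda>n. box_mass d (\<lambda>i. real_of_int (q i n)) b A) \<longlonglongrightarrow> (\<integral>t. box_mass d (\<lambda>i. - t i) b A \<partial>P)"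
proof -
  have P: "prob_space P" "sets P = sets (borel_Rd d)"
    using weak by (auto simp: weakly_converges_Rd_def prob_measures_Rd_def)
  interpret P: prob_space P by fact
  interpret PL: pair_sigma_finite P lborel ..
  let ?f0 = "\<lambda>x. f x - 1"
  have f0: "integrable M ?f0" using integrable_roof by simp
  define c where "c i x v = b i (base_flow x v)" for i x v
  have "\<exists>K\<ge>0. \<forall>y\<in>space N. \<forall>t. \<bar>b i (flow t y) - b i y\<bar> \<le> K * \<bar>t\<bar>" if "i < d" for i
    using b[OF that] by (simp add: flow_lipschitz_def)
  then obtain \<kappa> where \<kappa>: "\<And>i. i < d \<Longrightarrow> 0 \<le> \<kappa> i"
    "\<And>i y t. i < d \<Longrightarrow> y \<in> space N \<Longrightarrow> \<bar>b i (flow t y) - b i y\<bar> \<le> \<kappa> i * \<bar>t\<bar>"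
    by metis
  define K where "K = (\<Sum>i<d. \<kappa> i)"
  have K: "0 \<le> K" unfolding K_def by (intro sum_nonneg \<kappa>(1)) simp
  have c_lip: "\<bar>c i x u - c i x v\<bar> \<le> K * \<bar>u - v\<bar>" if "i < d" "x \<in> space M" for i x u v
  proof -
    have "\<bar>c i x u - c i x v\<bar> \<le> \<kappa> i * \<bar>u - v\<bar>"
      unfolding c_def by (intro flow_lipschitz_base_flow \<kappa> that)
    also have "\<kappa> i \<le> K" unfolding K_def using that \<kappa>(1) by (intro member_le_sum) auto
    then have "\<kappa> i * \<bar>u - v\<bar> \<le> K * \<bar>u - v\<bar>" by (intro mult_right_mono) auto
    finally show ?thesis .
  qed
  have c01: "0 \<le> c i x v \<and> c i x v \<le> 1" if "i < d" "x \<in> space M" for i x v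
    unfolding c_def by (rule flow_lipschitz_bounds[OF b[OF that(1)] base_flow_in_N[OF that(2)]])
  have c_meas: "(\<lambda>y. c i (u y) (v y)) \<in> borel_measurable R"
    if "i < d" "u \<in> R \<rightarrow>\<^sub>M M" "v \<in> borel_measurable R" for i u v and R :: "'z measure"
    unfolding c_def
    by (rule measurable_compose[OF measurable_base_flow_compose flow_lipschitz_measurable[OF b]]) (use that in auto)
  have prod01: "0 \<le> (\<Prod>i<d. c i (u i) (v i))" "(\<Prod>i<d. c i (u i) (v i)) \<le> 1"
    if "\<And>i. u i \<in> space M" for u v
    using prod_unit_interval[of d "\<lambda>i. c i (u i) (v i)"] c01 that by auto
  have prod_diff: "\<bar>(\<Prod>i<d. c i (u i) (v i)) - (\<Prod>i<d. c i (u' i) (v' i))\<bar> \<le>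
      (\<Sum>i<d. \<bar>c i (u i) (v i) - c i (u' i) (v' i)\<bar>)"
    if "\<And>i. u i \<in> space M" "\<And>i. u' i \<in> space M" for u u' v v'
    using norm_prod_diff[of "{..<d}" "\<lambda>i. c i (u i) (v i)" "\<lambda>i. c i (u' i) (v' i)"] c01 that by simp
  have Fi: "F n x i = csum ?f0 (q i n) x" if "i < d" for n x i
    using that by (simp add: F_def)
  have F [measurable]: "F n \<in> M \<rightarrow>\<^sub>M borel_Rd d" for n
    unfolding F_def borel_Rd_def by (intro measurable_restrict measurable_csum) measurable
  have Fint: "integrable M (\<lambda>x. F n x i)" if "i < d" for n i
    using integrable_csum[OF f0] that by (simp add: Fi)
  have Finv: "(\<lambda>n. \<integral>x. \<bar>F n (iter k x) i - F n x i\<bar> \<partial>M) \<longlonglongrightarrow> 0" if i: "i < d" for i k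
  proof -
    \<comment> \<open>Using the cocycle identity in both orders trades the increment of the long sum
      over k steps for the increment of the fixed sum \<open>csum ?f0 k\<close> over
      \<open>q i n\<close> steps, to which rigidity applies.\<close>
    have "F n (iter k x) i - F n x i = csum ?f0 k (iter (q i n) x) - csum ?f0 k x"
      if x: "x \<in> space M" for n x
      using csum_add[OF x, of ?f0 "q i n" k] csum_add[OF x, of ?f0 k "q i n"] i
      by (simp add: Fi add.commute)
    then have "(\<integral>x. \<bar>F n (iter k x) i - F n x i\<bar> \<partial>M) =
        (\<integral>x. \<bar>csum ?f0 k (iter (q i n) x) - csum ?f0 k x\<bar> \<partial>M)" for n
      by (intro Bochner_Integration.integral_cong refl) simp
    then show ?thesis using rigidity_L1[OF rig[OF i] integrable_csum[OF f0, of k]] by simp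
  qed
  have A': "A \<in> sets (M \<Otimes>\<^sub>M borel)"
    using A by (simp add: sets_N_iff cong: sets_pair_measure_cong)
  have A_meas: "(\<lambda>y. indicator A (u y, v y) :: real) \<in> borel_measurable R"
    if "u \<in> R \<rightarrow>\<^sub>M M" "v \<in> borel_measurable R" for u v and R :: "'z measure"
    using measurable_compose[OF measurable_Pair[OF that] borel_measurable_indicator[OF A']] by simp
  have A_range: "r \<in> {0..L}" if "(x, r) \<in> A" for x r
    using L[OF that] sets.sets_into_space[OF A] that by (auto simp: space_N)
  define h where "h r x t = indicator A (x, r) * (\<Prod>i<d. c i x (r - t i))" for r x and t :: "nat \<Rightarrow> real"
  \<comment> \<open>\<open>Q n\<close> is the slice of the box mass at height \<open>r\<close> for
    the given times; \<open>g r t\<close> is the slice for the times -t.\<close>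
  define Q where "Q n r = (\<integral>x. indicator A (x, r) * (\<Prod>i<d. c i (iter (q i n) x) (r - F n x i)) \<partial>M)" for n r
  define g where "g r t = (\<integral>x. h r x t \<partial>M)" for r t
  have fiberwise: "(\<lambda>n. Q n r) \<longlonglongrightarrow> (\<integral>t. g r t \<partial>P)" for r
  proof -
    have hm: "(\<lambda>(x, t). h r x t) \<in> borel_measurable (M \<Otimes>\<^sub>M borel_Rd d)"
      unfolding h_def split_beta
      by (intro borel_measurable_times borel_measurable_prod A_meas c_meas borel_measurable_diff
          measurable_compose[OF measurable_snd measurable_borel_Rd_component]) auto
    have h1: "\<bar>h r x t\<bar> \<le> 1" if "x \<in> space M" for x t
      using prod01[of "\<lambda>_. x" "\<lambda>i. r - t i"] that by (simp add: h_def indicator_def)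
    have hlip: "\<bar>h r x s - h r x t\<bar> \<le> K * (\<Sum>i<d. \<bar>s i - t i\<bar>)" if x: "x \<in> space M" for x s t
    proof -
      have "\<bar>h r x s - h r x t\<bar> \<le> \<bar>(\<Prod>i<d. c i x (r - s i)) - (\<Prod>i<d. c i x (r - t i))\<bar>"
        by (simp add: h_def indicator_def)
      also have "\<dots> \<le> (\<Sum>i<d. \<bar>c i x (r - s i) - c i x (r - t i)\<bar>)"
        by (rule prod_diff) (rule x)+
      also have "\<dots> \<le> (\<Sum>i<d. K * \<bar>s i - t i\<bar>)"
        using c_lip[OF _ x, of _ "r - s _" "r - t _"] by (intro sum_mono) (simp add: abs_minus_commute)
      finally show ?thesis by (simp add: sum_distrib_left)
    qed
    have "(\<lambda>n. \<integral>x. h r x (F n x) \<partial>M) \<longlonglongrightarrow> (\<integral>t. g r t \<partial>P)"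
      unfolding g_def
      by (rule stable_convergence[OF erg hm h1 hlip K F Fint FC Finv weak])
    moreover have "(\<lambda>n. Q n r - (\<integral>x. h r x (F n x) \<partial>M)) \<longlonglongrightarrow> 0"
    proof -
      \<comment> \<open>Rigidity makes this small for each fixed \<open>t\<close>. Separate indices,
        \<open>m\<close> for the iterate and \<open>n\<close> for the vector, fit it to
        \<open>uniform_net\<close>, whose conclusion is then used with m = n.\<close>
      define W where "W i m x t = \<bar>c i (iter (q i m) x) (r - t i) - c i x (r - t i)\<bar>"
        for i m x and t :: "nat \<Rightarrow> real"
      have Wint: "integrable M (\<lambda>x. W i n x (F n x))" if i: "i < d" for i n
      proof (rule integrable_const_bound[where B = 1])
        have "W i n x (F n x) \<le> 1" if "x \<in> space M" for x
          using c01[OF i iter_in_space[OF that, of "q i n"], of "r - F n x i"]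
            c01[OF i that, of "r - F n x i"] unfolding W_def by linarith
        then show "AE x in M. norm (W i n x (F n x)) \<le> 1"
          by (intro AE_I2) (simp add: W_def)
        show "(\<lambda>x. W i n x (F n x)) \<in> borel_measurable M"
          unfolding W_def using Fint[OF i, of n]
          by (intro borel_measurable_abs borel_measurable_diff c_meas i) auto
      qed
      have W0: "(\<lambda>n. \<integral>x. W i n x (F n x) \<partial>M) \<longlonglongrightarrow> 0" if i: "i < d" for i
      proof (rule LIMSEQ_I)
        fix e :: real assume e: "e > 0"
        have "\<exists>m0. \<forall>m\<ge>m0. \<forall>n. (\<integral>x. W i m x (F n x) \<partial>M) < e"
        proof (rule uniform_net[where W = "W i" and G = F and B = 1 and K = "2 * K" and d = d and C = C])
          show "(\<lambda>(x, t). W i m x t) \<in> borel_measurable (M \<Otimes>\<^sub>M borel_Rd d)" for m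
            unfolding W_def split_beta
            by (intro borel_measurable_abs borel_measurable_diff c_meas i
                measurable_compose[OF measurable_fst measurable_iter]
                measurable_compose[OF measurable_snd measurable_borel_Rd_component]) auto
          fix m x assume x: "x \<in> space M"
          note x' = iter_in_space[OF x, of "q i m"]
          fix t
          show "0 \<le> W i m x t" by (simp add: W_def)
          show "W i m x t \<le> 1"
            using c01[OF i x', of "r - t i"] c01[OF i x, of "r - t i"] unfolding W_def by linarith
          fix s
          have "\<bar>W i m x s - W i m x t\<bar> \<le> 2 * (K * \<bar>s i - t i\<bar>)"
            using c_lip[OF i x', of "r - s i" "r - t i"] c_lip[OF i x, of "r - s i" "r - t i"]
            unfolding W_def by (simp add: abs_minus_commute)
          also have "\<dots> \<le> 2 * K * (\<Sum>i<d. \<bar>s i - t i\<bar>)"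
            using member_le_sum[of i "{..<d}" "\<lambda>i. \<bar>s i - t i\<bar>"] i K by (simp add: mult_left_mono)
          finally show "\<bar>W i m x s - W i m x t\<bar> \<le> 2 * K * (\<Sum>i<d. \<bar>s i - t i\<bar>)" .
        next
          fix t
          have "integrable M (\<lambda>x. c i x (r - t i))"
            by (rule integrable_const_bound[where B = 1])
               (use c01[OF i] in \<open>auto intro!: AE_I2 c_meas i simp: abs_le_iff intro: order_trans[of _ 0]\<close>)
          then show "(\<lambda>m. \<integral>x. W i m x t \<partial>M) \<longlonglongrightarrow> 0"
            unfolding W_def by (rule rigidity_L1[OF rig[OF i]])
        qed (use K e Fint FC in auto)
        then obtain m0 where m0: "\<And>m n. m \<ge> m0 \<Longrightarrow> (\<integral>x. W i m x (F n x) \<partial>M) < e" by blast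
        have "0 \<le> (\<integral>x. W i n x (F n x) \<partial>M)" for n by (simp add: W_def)
        then show "\<exists>no. \<forall>n\<ge>no. norm ((\<integral>x. W i n x (F n x) \<partial>M) - 0) < e"
          using m0 by (intro exI[of _ m0]) simp
      qed
      have "(\<lambda>n. \<Sum>i<d. \<integral>x. W i n x (F n x) \<partial>M) \<longlonglongrightarrow> (\<Sum>i<d. 0)"
        by (intro tendsto_sum W0) simp
      then have W0': "(\<lambda>n. \<Sum>i<d. \<integral>x. W i n x (F n x) \<partial>M) \<longlonglongrightarrow> 0" by simp
      show ?thesis
      proof (rule Lim_null_comparison[OF always_eventually W0'], rule allI)
        fix n
        let ?p = "\<lambda>x. indicator A (x, r) * (\<Prod>i<d. c i (iter (q i n) x) (r - F n x i))"
        have i1: "integrable M ?p"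
        proof (rule integrable_const_bound[where B = 1])
          show "AE x in M. norm (?p x) \<le> 1"
            using prod01 iter_in_space by (intro AE_I2) (simp add: indicator_def)
          show "?p \<in> borel_measurable M"
            using Fint[of _ n]
            by (intro borel_measurable_times borel_measurable_prod A_meas c_meas borel_measurable_diff)
               (auto intro: borel_measurable_integrable)
        qed
        have i2: "integrable M (\<lambda>x. h r x (F n x))"
        proof (rule integrable_const_bound[where B = 1])
          show "AE x in M. norm (h r x (F n x)) \<le> 1" using h1 by (intro AE_I2) simp
          show "(\<lambda>x. h r x (F n x)) \<in> borel_measurable M"
            using measurable_compose[OF measurable_Pair[OF measurable_ident_sets[OF refl] F] hm] by simp
        qed
        have "\<bar>Q n r - (\<integral>x. h r x (F n x) \<partial>M)\<bar> = \<bar>\<integral>x. ?p x - h r x (F n x) \<partial>M\<bar>"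
          unfolding Q_def using i1 i2 by simp
        also have "\<dots> \<le> (\<integral>x. \<bar>?p x - h r x (F n x)\<bar> \<partial>M)" by (rule integral_abs_bound)
        also have "\<dots> \<le> (\<integral>x. (\<Sum>i<d. W i n x (F n x)) \<partial>M)"
        proof (rule integral_mono)
          fix x assume x: "x \<in> space M"
          have "\<bar>?p x - h r x (F n x)\<bar> \<le>
              \<bar>(\<Prod>i<d. c i (iter (q i n) x) (r - F n x i)) - (\<Prod>i<d. c i x (r - F n x i))\<bar>"
            by (simp add: h_def indicator_def)
          also have "\<dots> \<le> (\<Sum>i<d. W i n x (F n x))"
            unfolding W_def by (rule prod_diff) (use x iter_in_space in auto)
          finally show "\<bar>?p x - h r x (F n x)\<bar> \<le> (\<Sum>i<d. W i n x (F n x))" .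
        qed (use i1 i2 Wint in auto)
        also have "\<dots> = (\<Sum>i<d. \<integral>x. W i n x (F n x) \<partial>M)"
          using Wint by (intro Bochner_Integration.integral_sum) auto
        finally show "norm (Q n r - (\<integral>x. h r x (F n x) \<partial>M)) \<le> (\<Sum>i<d. \<integral>x. W i n x (F n x) \<partial>M)"
          by simp
      qed
    qed
    ultimately show ?thesis using tendsto_add by fastforce
  qed
  have Qm: "Q n \<in> borel_measurable borel" for n
  proof -
    have "(\<lambda>(r, x). indicator A (x, r) * (\<Prod>i<d. c i (iter (q i n) x) (r - F n x i))) \<in>
        borel_measurable (borel \<Otimes>\<^sub>M M)"
      unfolding split_beta
      by (intro borel_measurable_times borel_measurable_prod A_meas c_meas borel_measurable_diff
          measurable_compose[OF measurable_snd measurable_iter]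
          measurable_compose[OF measurable_snd borel_measurable_integrable[OF Fint]]) auto
    then show ?thesis unfolding Q_def by (rule borel_measurable_lebesgue_integral)
  qed
  have gm: "(\<lambda>(r, t). g r t) \<in> borel_measurable (borel \<Otimes>\<^sub>M borel_Rd d)"
  proof -
    have "(\<lambda>(z, x). h (fst z) x (snd z)) \<in> borel_measurable ((borel \<Otimes>\<^sub>M borel_Rd d) \<Otimes>\<^sub>M M)"
      unfolding h_def split_beta
      by (intro borel_measurable_times borel_measurable_prod A_meas c_meas borel_measurable_diff
          measurable_compose[OF measurable_snd measurable_borel_Rd_component]
          measurable_compose[OF measurable_fst] measurable_snd measurable_fst
          measurable_compose[OF measurable_compose[OF measurable_fst measurable_snd] measurable_borel_Rd_component])
         auto
    then have "(\<lambda>z. \<integral>x. h (fst z) x (snd z) \<partial>M) \<in> borel_measurable (borel \<Otimes>\<^sub>M borel_Rd d)"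
      by (rule borel_measurable_lebesgue_integral)
    then show ?thesis by (simp add: g_def split_beta')
  qed
  \<comment> \<open>Heights outside [0, L] do not occur in \<open>A\<close>, so a single integrable
    function dominates all slices.\<close>
  have bound: "\<bar>\<integral>x. indicator A (x, r) * u x \<partial>M\<bar> \<le> indicator {0..L} r"
    if "\<And>x. x \<in> space M \<Longrightarrow> \<bar>u x\<bar> \<le> 1" for r and u :: "'a \<Rightarrow> real"
  proof (cases "r \<in> {0..L}")
    case True
    have "\<bar>\<integral>x. indicator A (x, r) * u x \<partial>M\<bar> \<le> (\<integral>x. \<bar>indicator A (x, r) * u x\<bar> \<partial>M)"
      by (rule integral_abs_bound)
    also have "\<dots> \<le> (\<integral>x. 1 \<partial>M)"
      using that by (intro integral_mono') (auto simp: indicator_def)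
    finally show ?thesis using True by (simp add: prob_space)
  next
    case False
    then have "(\<lambda>x. indicator A (x, r) * u x) = (\<lambda>_. 0)"
      using A_range by (fastforce simp: indicator_def fun_eq_iff)
    then show ?thesis by (simp only:) simp
  qed
  have Qbound: "\<bar>Q n r\<bar> \<le> indicator {0..L} r" for n r
    unfolding Q_def using prod01 iter_in_space by (intro bound) simp
  have gbound: "\<bar>g r t\<bar> \<le> indicator {0..L} r" for r t
    unfolding g_def h_def using prod01 by (intro bound) simp
  have ind_int: "integrable lborel (indicator {0..L} :: real \<Rightarrow> real)"
    by (intro integrable_real_indicator) (auto simp: emeasure_lborel_Icc_eq)
  have "(\<lambda>n. \<integral>r. Q n r \<partial>lborel) \<longlonglongrightarrow> (\<integral>r. \<integral>t. g r t \<partial>P \<partial>lborel)"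
  proof (rule integral_dominated_convergence[where w = "indicator {0..L}"])
    have "(\<lambda>(r, t). g r t) \<in> borel_measurable (lborel \<Otimes>\<^sub>M P)"
      using gm P(2) by (simp cong: measurable_cong_sets sets_pair_measure_cong)
    then show "(\<lambda>r. \<integral>t. g r t \<partial>P) \<in> borel_measurable lborel"
      by (rule P.borel_measurable_lebesgue_integral)
  qed (use fiberwise Qbound Qm ind_int in auto)
  moreover have "(\<integral>r. Q n r \<partial>lborel) = box_mass d (\<lambda>i. real_of_int (q i n)) b A" for n
  proof -
    let ?u = "\<lambda>y. \<Prod>i<d. c i (iter (q i n) (fst y)) (snd y - F n (fst y) i)"
    have "box_mass d (\<lambda>i. real_of_int (q i n)) b A = (\<integral>y. indicator A y * ?u y \<partial>N)"
      unfolding box_mass_def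
    proof (rule integral_cong_AE)
      show "(\<lambda>y. indicator A y * (\<Prod>i<d. b i (flow (real_of_int (q i n)) y))) \<in> borel_measurable N"
        using A flow_lipschitz_measurable[OF b]
        by (intro borel_measurable_times borel_measurable_indicator borel_measurable_prod
            measurable_compose[OF measurable_flow1]) auto
      show "(\<lambda>y. indicator A y * ?u y) \<in> borel_measurable N"
        using A Fint
        by (intro borel_measurable_times borel_measurable_prod borel_measurable_indicator c_meas
            borel_measurable_diff measurable_compose[OF measurable_fst_N measurable_iter]
            measurable_compose[OF measurable_fst_N borel_measurable_integrable[OF Fint]]) auto
      show "AE y in N. indicator A y * (\<Prod>i<d. b i (flow (real_of_int (q i n)) y)) = indicator A y * ?u y"
        using AE_N_good
      proof eventually_elim
        case (elim y)
        have "b i (flow (real_of_int (q i n)) y) = c i (iter (q i n) (fst y)) (snd y - F n (fst y) i)"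
          if "i < d" for i
          using flow_integer_time[OF elim, of "q i n" "snd y"] that by (simp add: c_def Fi)
        then show ?case by simp
      qed
    qed
    also have "\<dots> = (\<integral>r. \<integral>x. indicator A (x, r) * ?u (x, r) \<partial>M \<partial>lborel)"
    proof (rule integral_N_subset[OF A])
      show "?u \<in> borel_measurable (M \<Otimes>\<^sub>M borel)"
        by (intro borel_measurable_prod c_meas borel_measurable_diff
            measurable_compose[OF measurable_fst measurable_iter]
            measurable_compose[OF measurable_fst borel_measurable_integrable[OF Fint]]) auto
      show "\<bar>?u y\<bar> \<le> 1" if "y \<in> space M \<times> UNIV" for y
        using prod01[of "\<lambda>i. iter (q i n) (fst y)"] that iter_in_space by auto
    qed
    finally show ?thesis by (simp add: Q_def)
  qed
  moreover have "(\<integral>r. \<integral>t. g r t \<partial>P \<partial>lborel) = (\<integral>t. box_mass d (\<lambda>i. - t i) b A \<partial>P)"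
  proof -
    have gm': "(\<lambda>(t, r). g r t) \<in> borel_measurable (P \<Otimes>\<^sub>M lborel)"
      using measurable_compose[OF measurable_pair_swap' gm] P(2)
      by (simp add: split_beta' cong: measurable_cong_sets sets_pair_measure_cong)
    have "integrable (P \<Otimes>\<^sub>M lborel) (\<lambda>(t, r). g r t)"
    proof (rule Bochner_Integration.integrable_bound[OF _ gm'])
      have "emeasure (P \<Otimes>\<^sub>M lborel) (space P \<times> {0..L}) < \<infinity>"
        by (subst lborel.emeasure_pair_measure_Times)
           (auto simp: P.emeasure_space_1 emeasure_lborel_Icc_eq)
      then show "integrable (P \<Otimes>\<^sub>M lborel) (indicator (space P \<times> {0..L}) :: _ \<Rightarrow> real)"
        by (intro integrable_real_indicator) auto
      have "norm (g r t) \<le> norm (indicator (space P \<times> {0..L}) (t, r) :: real)" if "t \<in> space P" for t r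
        using gbound[of r t] that by (simp add: indicator_times)
      then show "AE z in P \<Otimes>\<^sub>M lborel. norm (case z of (t, r) \<Rightarrow> g r t) \<le>
          norm (indicator (space P \<times> {0..L}) z :: real)"
        by (intro AE_I2) (clarsimp simp: space_pair_measure)
    qed
    then have "(\<integral>r. \<integral>t. g r t \<partial>P \<partial>lborel) = (\<integral>t. \<integral>r. g r t \<partial>lborel \<partial>P)"
      by (rule PL.Fubini_integral)
    also have "\<dots> = (\<integral>t. box_mass d (\<lambda>i. - t i) b A \<partial>P)"
    proof (rule Bochner_Integration.integral_cong[OF refl])
      fix t
      let ?u = "\<lambda>y. \<Prod>i<d. c i (fst y) (snd y - t i)"
      have "box_mass d (\<lambda>i. - t i) b A = (\<integral>y. indicator A y * ?u y \<partial>N)"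
        unfolding box_mass_def
      proof (rule integral_cong_AE)
        show "(\<lambda>y. indicator A y * (\<Prod>i<d. b i (flow (- t i) y))) \<in> borel_measurable N"
          using A flow_lipschitz_measurable[OF b]
          by (intro borel_measurable_times borel_measurable_indicator borel_measurable_prod
              measurable_compose[OF measurable_flow1]) auto
        show "(\<lambda>y. indicator A y * ?u y) \<in> borel_measurable N"
          using A
          by (intro borel_measurable_times borel_measurable_prod borel_measurable_indicator c_meas
              borel_measurable_diff) auto
        show "AE y in N. indicator A y * (\<Prod>i<d. b i (flow (- t i) y)) = indicator A y * ?u y"
          using AE_N_good
        proof eventually_elim
          case (elim y)
          have "b i (flow (- t i) y) = c i (fst y) (snd y - t i)" for i
            using flow_eq[OF good_in_space[OF elim], of "- t i" "snd y"] elim by (simp add: c_def)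
          then show ?case by simp
        qed
      qed
      also have "\<dots> = (\<integral>r. \<integral>x. indicator A (x, r) * ?u (x, r) \<partial>M \<partial>lborel)"
      proof (rule integral_N_subset[OF A])
        show "?u \<in> borel_measurable (M \<Otimes>\<^sub>M borel)"
          by (intro borel_measurable_prod c_meas borel_measurable_diff) auto
        show "\<bar>?u y\<bar> \<le> 1" if "y \<in> space M \<times> UNIV" for y
          using prod01[of "\<lambda>i. fst y"] that by auto
      qed
      finally show "(\<integral>r. g r t \<partial>lborel) = box_mass d (\<lambda>i. - t i) b A"
        by (simp add: g_def h_def)
    qed
    finally show ?thesis .
  qed
  ultimately show ?thesis by simp
qed

lemma box_mass_limit:
  fixes q :: "nat \<Rightarrow> nat \<Rightarrow> int" and d :: nat
  defines "F \<equiv> \<lambda>n x. \<lambda>i\<in>{..<d}. csum (\<lambda>x. f x - 1) (q i n) x"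
  assumes erg: "ergodic M T"
    and rig: "\<And>i. i < d \<Longrightarrow> rigidity_sequence M T (q i)"
    and FC: "\<And>n i. i < d \<Longrightarrow> (\<integral>x. \<bar>F n x i\<bar> \<partial>M) \<le> C"
    and weak: "weakly_converges_Rd d (\<lambda>n. distr M (borel_Rd d) (F n)) P"
    and A: "\<And>i. i < d + 1 \<Longrightarrow> A i \<in> sets N"
  shows "(\<lambda>n. box_mass d (\<lambda>i. real_of_int (q i n)) (\<lambda>i. indicator (A i)) (A d)) \<longlonglongrightarrow>
     (\<integral>t. box_mass d (\<lambda>i. - t i) (\<lambda>i. indicator (A i)) (A d) \<partial>P)"
proof (rule tendsto_approx)
  fix e :: real assume e: "e > 0"
  have P: "prob_space P" "sets P = sets (borel_Rd d)"
    using weak by (auto simp: weakly_converges_Rd_def prob_measures_Rd_def)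
  interpret P: prob_space P by fact
  have Ad: "A d \<in> sets N" and Ai: "\<And>i. i < d \<Longrightarrow> A i \<in> sets N" using A by simp_all
  note [measurable] = Ad
  \<comment> \<open>Since the roof is finite everywhere, these sets increase to all of
    \<open>A d\<close>; each has the bounded roof needed for the Lipschitz case.\<close>
  define D where "D m = {y \<in> space N. y \<in> A d \<and> f (fst y) \<le> real m}" for m :: nat
  have fN [measurable]: "(\<lambda>y. f (fst y)) \<in> borel_measurable N"
    by (rule measurable_compose[OF measurable_fst_N measurable_roof])
  have D: "D m \<in> sets N" "D m \<subseteq> A d" for m unfolding D_def by auto
  have "(\<Union>m. D m) = A d"
    using sets.sets_into_space[OF Ad, THEN subsetD] real_arch_simple by (auto simp: D_def)
  moreover have "incseq D" by (auto simp: incseq_def D_def)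
  ultimately have lim: "(\<lambda>m. N.prob (D m)) \<longlonglongrightarrow> N.prob (A d)"
    using N.finite_Lim_measure_incseq[of D] D by (simp add: image_subset_iff)
  have "eventually (\<lambda>m. N.prob (A d) - e / 2 < N.prob (D m)) sequentially"
    by (rule order_tendstoD(1)[OF lim]) (use e in simp)
  then obtain m where "N.prob (A d) - e / 2 < N.prob (D m)"
    by (auto simp: eventually_sequentially)
  then have m: "N.prob (A d - D m) < e / 2"
    using N.finite_measure_Diff[OF Ad D(1) D(2)] by simp
  \<comment> \<open>The errors of the \<open>d\<close> smoothed sides add up to at most e/2, the
    other half being spent on \<open>D m\<close>.\<close>
  define e' where "e' = e / (2 * (real d + 1))"
  have e': "e' > 0" using e by (simp add: e'_def)
  have "\<exists>b. flow_lipschitz b \<and> (\<integral>y. \<bar>indicator (A i) y - b y\<bar> \<partial>N) < e'" if "i < d" for i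
    using flow_approximable_sets[OF Ai[OF that]] e' unfolding flow_approximable_def by blast
  then obtain b where b: "\<And>i. i < d \<Longrightarrow> flow_lipschitz (b i)"
    and be: "\<And>i. i < d \<Longrightarrow> (\<integral>y. \<bar>indicator (A i) y - b i y\<bar> \<partial>N) < e'"
    by metis
  have "(\<Sum>i<d. \<integral>y. \<bar>indicator (A i) y - b i y\<bar> \<partial>N) \<le> (\<Sum>i<d. e')"
    using be by (intro sum_mono) (simp add: less_imp_le)
  also have "\<dots> \<le> e / 2" using e by (simp add: e'_def field_simps)
  finally have close: "\<bar>box_mass d \<tau> (\<lambda>i. indicator (A i)) (A d) - box_mass d \<tau> b (D m)\<bar> \<le> e" for \<tau>
    using box_mass_diff[OF Ad D(1)[of m] D(2)[of m], where d = d and B = A and b = b and \<tau> = \<tau>, OF Ai b] m by simp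
  have int1: "integrable P (\<lambda>t. box_mass d (\<lambda>i. - t i) a A')"
    if "A' \<in> sets N" "\<And>i. i < d \<Longrightarrow> a i \<in> borel_measurable N"
      "\<And>i y. i < d \<Longrightarrow> y \<in> space N \<Longrightarrow> 0 \<le> a i y \<and> a i y \<le> 1" for a A'
  proof (rule P.integrable_const_bound[where B = 1])
    show "AE t in P. norm (box_mass d (\<lambda>i. - t i) a A') \<le> 1"
      using box_mass_bounds[of A' d a, OF that] by (intro AE_I2) simp
    show "(\<lambda>t. box_mass d (\<lambda>i. - t i) a A') \<in> borel_measurable P"
      using measurable_box_mass[of A' d a] that P(2) by (simp cong: measurable_cong_sets)
  qed
  have intA: "integrable P (\<lambda>t. box_mass d (\<lambda>i. - t i) (\<lambda>i. indicator (A i)) (A d))"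
    using Ad Ai by (intro int1) auto
  have intb: "integrable P (\<lambda>t. box_mass d (\<lambda>i. - t i) b (D m))"
    using flow_lipschitz_measurable[OF b] flow_lipschitz_bounds[OF b] D(1) by (intro int1) auto
  have "\<bar>(\<integral>t. box_mass d (\<lambda>i. - t i) (\<lambda>i. indicator (A i)) (A d) \<partial>P) - (\<integral>t. box_mass d (\<lambda>i. - t i) b (D m) \<partial>P)\<bar>
      = \<bar>\<integral>t. box_mass d (\<lambda>i. - t i) (\<lambda>i. indicator (A i)) (A d) - box_mass d (\<lambda>i. - t i) b (D m) \<partial>P\<bar>"
    using intA intb by simp
  also have "\<dots> \<le> (\<integral>t. \<bar>box_mass d (\<lambda>i. - t i) (\<lambda>i. indicator (A i)) (A d) - box_mass d (\<lambda>i. - t i) b (D m)\<bar> \<partial>P)"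
    by (rule integral_abs_bound)
  also have "\<dots> \<le> (\<integral>t. e \<partial>P)"
    using intA intb by (intro integral_mono close) auto
  finally have close_lim: "\<bar>(\<integral>t. box_mass d (\<lambda>i. - t i) (\<lambda>i. indicator (A i)) (A d) \<partial>P) -
      (\<integral>t. box_mass d (\<lambda>i. - t i) b (D m) \<partial>P)\<bar> \<le> e"
    by (simp add: P.prob_space)
  have "(\<lambda>n. box_mass d (\<lambda>i. real_of_int (q i n)) b (D m)) \<longlonglongrightarrow>
      (\<integral>t. box_mass d (\<lambda>i. - t i) b (D m) \<partial>P)"
    by (rule box_mass_limit_lipschitz[OF erg rig FC[unfolded F_def] weak[unfolded F_def] D(1) _ b])
       (auto simp: D_def)
  then show "\<exists>y l'. y \<longlonglongrightarrow> l' \<and>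
      (\<forall>n. \<bar>box_mass d (\<lambda>i. real_of_int (q i n)) (\<lambda>i. indicator (A i)) (A d) - y n\<bar> \<le> e) \<and>
      \<bar>(\<integral>t. box_mass d (\<lambda>i. - t i) (\<lambda>i. indicator (A i)) (A d) \<partial>P) - l'\<bar> \<le> e"
    using close close_lim by blast
qed

end

text \<open>The mass of a set is the integral over y of an indicator that is jointly measurable in
  (t, y), because the flow is. This is the measurability in \<open>t\<close> on which the integral
  of joinings rests.\<close>

lemma (in special_flow_space) measurable_emeasure_graph_joining:
  assumes A: "A \<in> sets (Pi\<^sub>M {..<d + 1} (\<lambda>_. N))"
  shows "(\<lambda>t. emeasure (graph_joining (d + 1) N (\<lambda>i. flow (- t i))) A) \<in> borel_measurable (borel_Rd d)"
proof -
  let ?v = "\<lambda>t y. \<lambda>i\<in>{..<d + 1}. if i < d + 1 - 1 then flow (- t i) y else y"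
  have "(\<lambda>z. ?v (fst z) (snd z)) \<in> borel_Rd d \<Otimes>\<^sub>M N \<rightarrow>\<^sub>M Pi\<^sub>M {..<d + 1} (\<lambda>_. N)"
  proof (rule measurable_graph_vector)
    fix i assume "i < d + 1 - 1"
    then have i: "i < d" by simp
    show "(\<lambda>z. flow (- fst z i) (snd z)) \<in> borel_Rd d \<Otimes>\<^sub>M N \<rightarrow>\<^sub>M N"
      by (intro measurable_flow borel_measurable_uminus measurable_snd
          measurable_compose[OF measurable_fst measurable_borel_Rd_component[OF i]])
  qed simp
  then have "(\<lambda>(t, y). indicator A (?v t y) :: ennreal) \<in> borel_measurable (borel_Rd d \<Otimes>\<^sub>M N)"
    unfolding split_beta by (rule measurable_compose[OF _ borel_measurable_indicator[OF A]])
  then have "(\<lambda>t. \<integral>\<^sup>+y. indicator A (?v t y) \<partial>N) \<in> borel_measurable (borel_Rd d)"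
    by (rule N.borel_measurable_nn_integral)
  moreover have "emeasure (graph_joining (d + 1) N (\<lambda>i. flow (- t i))) A = (\<integral>\<^sup>+y. indicator A (?v t y) \<partial>N)" for t
  proof -
    have v: "?v t \<in> N \<rightarrow>\<^sub>M Pi\<^sub>M {..<d + 1} (\<lambda>_. N)"
      by (rule measurable_graph_vector) simp_all
    have "emeasure (graph_joining (d + 1) N (\<lambda>i. flow (- t i))) A =
        (\<integral>\<^sup>+y. indicator A y \<partial>distr N (Pi\<^sub>M {..<d + 1} (\<lambda>_. N)) (?v t))"
      using A by (simp add: graph_joining_def)
    then show ?thesis using nn_integral_distr[OF v, of "indicator A"] A by simp
  qed
  ultimately show ?thesis by simp
qed

section \<open>From the growth and L^2 bounds to convergence of self-joinings\<close>

theorem proposition3p7: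
  fixes M :: "'a measure" and T :: "'a \<Rightarrow> 'a" and f f\<^sub>0 :: "'a \<Rightarrow> real"
    and d :: nat and q :: "nat \<Rightarrow> nat \<Rightarrow> int" and P :: "(nat \<Rightarrow> real) measure"
  assumes "standard_borel M" and "prob_space M"
    and "automorphism M T" and "ergodic M T"
    and "d \<ge> 1"
    and "in_L2 M f"
    and "\<forall>x\<in>space M. f x > 0"
    and "(\<integral>x. f x \<partial>M) = 1"
    and "\<exists>c>0. \<exists>K::nat. AE x in M. \<forall>k\<ge>K. cocycle_sum M T f (int k) x \<ge> c * real k"
    and "f\<^sub>0 = (\<lambda>x. f x - (\<integral>y. f y \<partial>M))"
    and "\<forall>i<d. rigidity_sequence M T (q i)"
    and "\<forall>i<d. bounded_in_L2 M (\<lambda>n. cocycle_sum M T f\<^sub>0 (q i n))"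
    and "P \<in> prob_measures_Rd d"
    and "weakly_converges_Rd d
           (\<lambda>n. distr M (borel_Rd d) (\<lambda>x. \<lambda>i\<in>{..<d}. cocycle_sum M T f\<^sub>0 (q i n) x)) P"
  shows "converges_in_self_joinings (d + 1) (special_measure M f) (special_flow M T f)
           (\<lambda>n. graph_joining (d + 1) (special_measure M f)
                  (\<lambda>i. special_flow M T f (real_of_int (q i n))))
           (joining_integral (d + 1) (special_measure M f) P
              (\<lambda>t. graph_joining (d + 1) (special_measure M f)
                     (\<lambda>i. special_flow M T f (- t i))))"
proof -
  interpret M: automorphism_space M T
    using assms(2,3) by (simp add: automorphism_space_def automorphism_space_axioms_def)
  have fm [measurable]: "f \<in> borel_measurable M" and f2: "integrable M (\<lambda>x. (f x)\<^sup>2)"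
    using assms(6) by (auto simp: in_L2_def)
  \<comment> \<open>Expanding (\<bar>u\<bar> - 1)^2 \<ge> 0. It gives integrability of
    \<open>f\<close> and turns the L^2 bounds into first moment bounds.\<close>
  have abs_le: "\<bar>u\<bar> \<le> 1 + u\<^sup>2" for u :: real
    using zero_le_power2[of "\<bar>u\<bar> - 1"] by (simp add: power2_diff)
  have f_int: "integrable M f"
    by (rule Bochner_Integration.integrable_bound[of _ "\<lambda>x. 1 + (f x)\<^sup>2"])
       (use f2 abs_le in \<open>auto intro!: AE_I2\<close>)
  obtain c :: real and K :: nat where c: "c > 0"
    and cK: "AE x in M. \<forall>k\<ge>K. cocycle_sum M T f (int k) x \<ge> c * real k"
    using assms(9) by blast
  \<comment> \<open>The growth bound is placed at all backward iterates because f^(-k)(x) = -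
    f^(k)(T^(-k) x): taking j = k gives unboundedness below, and j = 0 gives it above.\<close>
  have "AE x in M. \<forall>j::nat. \<forall>k\<ge>K. cocycle_sum M T f (int k) (int_iterate M T (- int j) x) \<ge> c * real k"
    by (subst AE_all_countable) (intro allI M.AE_iter[OF cK])
  then have unbounded: "AE x in M. (\<forall>b::nat. \<exists>k. real b < cocycle_sum M T f k x) \<and>
      (\<forall>b::nat. \<exists>k. cocycle_sum M T f k x < - real b)"
  proof (rule AE_mp, intro AE_I2 impI)
    fix x assume x: "x \<in> space M"
      and le: "\<forall>j::nat. \<forall>k\<ge>K. cocycle_sum M T f (int k) (int_iterate M T (- int j) x) \<ge> c * real k"
    have ex: "\<exists>k\<ge>K. real b < c * real k" for b :: nat
    proof -
      obtain k :: nat where k: "real b < real k * c" using reals_Archimedean3[OF c] by blast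
      have "real k * c \<le> c * real (max k K)" using c by simp
      then show ?thesis using k by (intro exI[of _ "max k K"]) simp
    qed
    have "\<exists>k. real b < cocycle_sum M T f k x" for b :: nat
    proof -
      obtain k where "k \<ge> K" "real b < c * real k" using ex by blast
      then have "real b < cocycle_sum M T f (int k) (int_iterate M T (- int 0) x)"
        using le by (meson less_le_trans)
      then show ?thesis by auto
    qed
    moreover have "\<exists>k. cocycle_sum M T f k x < - real b" for b :: nat
    proof -
      obtain k where "k \<ge> K" "real b < c * real k" using ex by blast
      then have "real b < cocycle_sum M T f (int k) (int_iterate M T (- int k) x)"
        using le by (meson less_le_trans)
      then show ?thesis using M.csum_minus[OF x, of f "int k"] by (intro exI[of _ "- int k"]) simp
    qed
    ultimately show "(\<forall>b::nat. \<exists>k. real b < cocycle_sum M T f k x) \<and>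
      (\<forall>b::nat. \<exists>k. cocycle_sum M T f k x < - real b)" by blast
  qed
  interpret special_flow_space M T f
    by unfold_locales (use f_int assms(7,8) unbounded in auto)
  have f0: "f\<^sub>0 = (\<lambda>x. f x - 1)" using assms(8,10) by simp
  have P: "prob_space P" "sets P = sets (borel_Rd d)"
    using assms(13) by (auto simp: prob_measures_Rd_def)
  interpret P: prob_space P by fact
  have rig: "rigidity_sequence M T (q i)" if "i < d" for i using assms(11) that by blast
  have "\<exists>C. \<forall>n. (\<integral>x. \<bar>cocycle_sum M T f\<^sub>0 (q i n) x\<bar> \<partial>M) \<le> 1 + C\<^sup>2" if "i < d" for i
  proof -
    have L2: "bounded_in_L2 M (\<lambda>n. cocycle_sum M T f\<^sub>0 (q i n))" using assms(12) that by blast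
    then obtain C where C: "\<And>n. sqrt (\<integral>x. (cocycle_sum M T f\<^sub>0 (q i n) x)\<^sup>2 \<partial>M) \<le> C"
      by (auto simp: bounded_in_L2_def)
    have "(\<integral>x. \<bar>cocycle_sum M T f\<^sub>0 (q i n) x\<bar> \<partial>M) \<le> 1 + C\<^sup>2" for n
    proof -
      have int2: "integrable M (\<lambda>x. (cocycle_sum M T f\<^sub>0 (q i n) x)\<^sup>2)"
        using L2 by (simp add: bounded_in_L2_def in_L2_def)
      have "integrable M (cocycle_sum M T f\<^sub>0 (q i n))"
        using f_int by (intro M.integrable_csum) (simp add: f0)
      then have "(\<integral>x. \<bar>cocycle_sum M T f\<^sub>0 (q i n) x\<bar> \<partial>M) \<le>
          (\<integral>x. 1 + (cocycle_sum M T f\<^sub>0 (q i n) x)\<^sup>2 \<partial>M)"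
        using int2 abs_le by (intro integral_mono) auto
      also have "\<dots> = 1 + (\<integral>x. (cocycle_sum M T f\<^sub>0 (q i n) x)\<^sup>2 \<partial>M)"
        using int2 by (simp add: M.prob_space)
      finally show ?thesis using sqrt_le_D[OF C[of n]] by simp
    qed
    then show ?thesis by blast
  qed
  then obtain C where C: "\<And>i n. i < d \<Longrightarrow> (\<integral>x. \<bar>cocycle_sum M T f\<^sub>0 (q i n) x\<bar> \<partial>M) \<le> 1 + (C i)\<^sup>2"
    by metis
  \<comment> \<open>One constant for all coordinates: the sum of the individual bounds dominates
    each of them, as all are nonnegative.\<close>
  have L1: "(\<integral>x. \<bar>(\<lambda>i\<in>{..<d}. cocycle_sum M T (\<lambda>x. f x - 1) (q i n) x) i\<bar> \<partial>M) \<le> (\<Sum>i<d. 1 + (C i)\<^sup>2)"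
    if "i < d" for n i
  proof -
    have "1 + (C i)\<^sup>2 \<le> (\<Sum>i<d. 1 + (C i)\<^sup>2)"
      using that by (intro member_le_sum) auto
    then show ?thesis using C[OF that, of n] that by (simp add: f0)
  qed
  have graph: "graph_joining (d + 1) N (\<lambda>i. flow (\<tau> i)) \<in> self_joinings (d + 1) N flow" for \<tau>
    by (rule graph_joining_self_joining) (auto simp: prob_space_N distr_flow flow_add add.commute)
  have meas: "(\<lambda>t. emeasure (graph_joining (d + 1) N (\<lambda>i. flow (- t i))) A) \<in> borel_measurable P"
    if "A \<in> sets (Pi\<^sub>M {..<d + 1} (\<lambda>_. N))" for A
    using measurable_emeasure_graph_joining[OF that] P(2) by (simp cong: measurable_cong_sets)
  let ?J = "joining_integral (d + 1) N P (\<lambda>t. graph_joining (d + 1) N (\<lambda>i. flow (- t i)))"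
  have box: "measure ?J (Pi\<^sub>E {..<d + 1} A) =
      (\<integral>t. box_mass d (\<lambda>i. - t i) (\<lambda>i. indicator (A i)) (A d) \<partial>P)"
    if A: "\<And>i. i < d + 1 \<Longrightarrow> A i \<in> sets N" for A
  proof -
    let ?m = "\<lambda>t. box_mass d (\<lambda>i. - t i) (\<lambda>i. indicator (A i)) (A d)"
    have sets: "Pi\<^sub>E {..<d + 1} A \<in> sets (Pi\<^sub>M {..<d + 1} (\<lambda>_. N))"
      using A by (intro sets_PiM_I_finite) auto
    have m01: "0 \<le> ?m t" "?m t \<le> 1" for t
      using A by (auto intro!: box_mass_bounds)
    have m: "?m \<in> borel_measurable P"
      using measurable_box_mass[of "A d" d "\<lambda>i. indicator (A i)"] A P(2)
      by (simp cong: measurable_cong_sets)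
    have "emeasure (graph_joining (d + 1) N (\<lambda>i. flow (- t i))) (Pi\<^sub>E {..<d + 1} A) = ennreal (?m t)" for t
    proof -
      have "prob_space (graph_joining (d + 1) N (\<lambda>i. flow (- t i)))"
        using graph[of "\<lambda>i. - t i"] by (simp add: self_joinings_def)
      then interpret J: prob_space "graph_joining (d + 1) N (\<lambda>i. flow (- t i))" .
      show ?thesis
        unfolding J.emeasure_eq_measure
        by (rule arg_cong[where f = ennreal],
            rule measure_graph_joining_box[where d = d and A = A and \<tau> = "\<lambda>i. - t i", OF A])
    qed
    then have "emeasure ?J (Pi\<^sub>E {..<d + 1} A) = (\<integral>\<^sup>+t. ennreal (?m t) \<partial>P)"
      using emeasure_joining_integral[OF sets_graph_joining meas sets] by simp
    also have "\<dots> = ennreal (\<integral>t. ?m t \<partial>P)"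
      using m m01 by (intro nn_integral_eq_integral P.integrable_const_bound[where B = 1]) auto
    finally show ?thesis
      using m01 by (simp add: measure_def)
  qed
  show ?thesis
    unfolding converges_in_self_joinings_def
  proof (intro conjI allI impI)
    show "graph_joining (d + 1) N (\<lambda>i. flow (real_of_int (q i n))) \<in> self_joinings (d + 1) N flow" for n
      by (rule graph)
    show "?J \<in> self_joinings (d + 1) N flow"
      by (rule joining_integral_self_joining[OF P(1) graph meas measurable_flow1 prob_space_N])
    fix A assume "\<forall>i<d + 1. A i \<in> sets N"
    then have A: "\<And>i. i < d + 1 \<Longrightarrow> A i \<in> sets N" by blast
    show "(\<lambda>n. measure (graph_joining (d + 1) N (\<lambda>i. flow (real_of_int (q i n)))) (Pi\<^sub>E {..<d + 1} A))
        \<longlonglongrightarrow> measure ?J (Pi\<^sub>E {..<d + 1} A)"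
      by (subst measure_graph_joining_box, erule A, subst box, erule A) (rule box_mass_limit[OF assms(4) rig L1 assms(14)[unfolded f0] A])
  qed
qed

end
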